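(* Let $q>5$ be a power of a prime $p>3$, and let $\mathbb{F}$ be a field of characteristic $p$. Fix $\lambda\in\mathbb{F}$ with $\lambda\ne 0$, and a positive integer $s$. Let $N=\bigoplus_{i=1}^{\infty}N_i$ be the Lie algebra over $\mathbb{F}$ on two generators $x$ and $y$ subject to the following relations, and graded by assigning degree $1$ to $x$ and $y$, where $v_k$ is defined recursively by $v_1=[yx^{q-2}]$ and $v_k=[v_{k-1}xyx^{q-3}]$ for $k>1$: - $[yx^iy]=0$ for $0<i<q-2$; - $[v_1xx]=0=[v_1yy]$ and $[v_1yx]=-2[v_1xy]$; - $[v_1yx^iy]=0$ for $0<i<q-2$; - $[v_kyx]+[v_kxy]=0$ for $2\le k\le p^s$ with $k$ even; - $\lambda[v_{p^s+1}yx]=(1-\lambda)[v_{p^s+1}xy]$. Then $L=N/Z(N)$ is a Nottingham algebra, with second diamond in degree $q$, and it has (possibly fake) diamonds in all degrees of the form $t(q-1)+1$, $t\ge 1$, where: if $t\not\equiv 1\pmod{p^s}$ the corresponding diamond has infinite type; if $t\equiv 1\pmod{p^s}$, say $t=rp^s+1$, the corresponding diamond has finite type $r\lambda+r-1$. (Thus the diamonds of finite type, including the fake ones if $\lambda\in\mathbb{F}_p$, follow an arithmetic progression.)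
   Context: Lie products are written without commas and are left-normed: $[abc]=[[ab]c]$, and $[ab^i]=[ab\cdots b]$ with $b$ occurring $i$ times. $Z(N)$ denotes the centre of $N$. A thin Lie algebra is a graded Lie algebra $L=\bigoplus_{i\ge 1}L_i$ over a field $\mathbb{F}$ with $\dim L_1=2$ satisfying the covering property: for each $i$ and each nonzero $z\in L_i$ one has $[zL_1]=L_{i+1}$. All homogeneous components then have dimension at most two. Components of dimension two are called (genuine) diamonds; $L_1$ is the first diamond, and thin Lie algebras are required to have at least one further diamond; the earliest diamond past $L_1$ is the second diamond. A Nottingham algebra is a thin Lie algebra over a field of characteristic $p>3$ with second diamond $L_q$, where $q>5$ is a power of $p$. Standard generators: in a Nottingham algebra $L$ with second diamond $L_q$ there are generators $x,y$ of $L_1$, each unique up to scalar multiples, such that $[yxy]=0$ and, setting $v_1=[yx^{q-2}]$ (which spans $L_{q-1}$), $[v_1xx]=0=[v_1yy]$ and $[v_1yx]=-2[v_1xy]$. Types: let $L_m$ be a two-dimensional component with $m>1$ and $L_{m+1}\ne 0$, and let $w$ be a nonzero element of $L_{m-1}$ (which is one-dimensional). $L_m$ is a diamond of finite type $\mu\in\mathbb{F}$ if $[wxx]=0=[wyy]$ and $\mu[wyx]=(1-\mu)[wxy]$; it is a diamond of infinite type if $[wxx]=0=[wyy]$ and $[wyx]=-[wxy]$. (The second diamond $L_q$ always has type $-1$; $L_1$ has no type; for two-dimensional $L_m$ one always has $\mu\ne 0,1$.) Fake diamonds: if $L_{m-1}$ is one-dimensional, spanned by $w$, with $m>1$ and $L_{m+1}\neq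 0$, then $L_m$ is a (fake) diamond of type $1$ if $[wxx]=0$ and $[wy]=0$, and a (fake) diamond of type $0$ if $[wx]=0$ and $[wyy]=0$; fake diamonds are one-dimensional components and count as diamonds of finite type. If $L_m$ satisfies the definition of type $1$ then $L_{m+1}$ satisfies the definition of type $0$; by convention one calls (fake) diamond precisely one of $L_m$, $L_{m+1}$, of the appropriate type, and not the other. *)

theory Defs
  imports "Jordan_Normal_Form.VS_Connect" "HOL-Algebra.QuotRing" "HOL-Number_Theory.Cong"
begin

section \<open>Lie algebras over a field\<close>

text \<open>
  The scalars form a type of class \<^class>\<open>field\<close>, which \<^term>\<open>class_ring\<close> turns into a field in
  the sense of HOL-Algebra. The record fields \<open>mult\<close> and \<open>one\<close>, inherited from
  the record of modules, play no role. The bracket associates to the left, so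
  \<open>a \<star> b \<star> c\<close> is the left-normed product \<open>[abc]\<close>.
\<close>

record ('f, 'a) lie = "('f, 'a) module" +
  bracket :: "'a \<Rightarrow> 'a \<Rightarrow> 'a" (infixl \<open>\<star>\<index>\<close> 70)

locale lie_algebra = vectorspace class_ring L
  for L :: "('f::field, 'a, 'm) lie_scheme" (structure) +
  assumes bracket_closed: "\<lbrakk>u \<in> carrier L; v \<in> carrier L\<rbrakk> \<Longrightarrow> u \<star> v \<in> carrier L"
    and bracket_add_left: "\<lbrakk>u \<in> carrier L; v \<in> carrier L; w \<in> carrier L\<rbrakk> \<Longrightarrow>
          (u \<oplus>\<^bsub>L\<^esub> v) \<star> w = u \<star> w \<oplus>\<^bsub>L\<^esub> v \<star> w"
    and bracket_add_right: "\<lbrakk>u \<in> carrier L; v \<in> carrier L; w \<in> carrier L\<rbrakk> \<Longrightarrow>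
          u \<star> (v \<oplus>\<^bsub>L\<^esub> w) = u \<star> v \<oplus>\<^bsub>L\<^esub> u \<star> w"
    and bracket_smult_left: "\<lbrakk>u \<in> carrier L; v \<in> carrier L\<rbrakk> \<Longrightarrow>
          (c \<odot>\<^bsub>L\<^esub> u) \<star> v = c \<odot>\<^bsub>L\<^esub> (u \<star> v)"
    and bracket_smult_right: "\<lbrakk>u \<in> carrier L; v \<in> carrier L\<rbrakk> \<Longrightarrow>
          u \<star> (c \<odot>\<^bsub>L\<^esub> v) = c \<odot>\<^bsub>L\<^esub> (u \<star> v)"
    and bracket_self: "u \<in> carrier L \<Longrightarrow> u \<star> u = \<zero>\<^bsub>L\<^esub>"
    and jacobi: "\<lbrakk>u \<in> carrier L; v \<in> carrier L; w \<in> carrier L\<rbrakk> \<Longrightarrow>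
          (u \<star> v \<star> w \<oplus>\<^bsub>L\<^esub> v \<star> w \<star> u) \<oplus>\<^bsub>L\<^esub> w \<star> u \<star> v = \<zero>\<^bsub>L\<^esub>"

text \<open>\<open>rpow br a b i\<close> is \<open>[a b ... b]\<close> with \<open>b\<close> occurring \<open>i\<close> times.\<close>

definition rpow :: "('a \<Rightarrow> 'a \<Rightarrow> 'a) \<Rightarrow> 'a \<Rightarrow> 'a \<Rightarrow> nat \<Rightarrow> 'a" where
  "rpow br a b i = ((\<lambda>w. br w b) ^^ i) a"

definition has_dim :: "('f::field, 'a, 'm) lie_scheme \<Rightarrow> 'a set \<Rightarrow> nat \<Rightarrow> bool" where
  "has_dim L W n \<longleftrightarrow> vectorspace.fin_dim class_ring (L\<lparr>carrier := W\<rparr>) \<and>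
     vectorspace.dim class_ring (L\<lparr>carrier := W\<rparr>) = n"

definition center :: "('f, 'a, 'm) lie_scheme \<Rightarrow> 'a set" where
  "center L = {z \<in> carrier L. \<forall>w \<in> carrier L. z \<star>\<^bsub>L\<^esub> w = \<zero>\<^bsub>L\<^esub>}"

definition lie_quotient :: "('f, 'a, 'm) lie_scheme \<Rightarrow> 'a set \<Rightarrow> ('f, 'a set) lie" where
  "lie_quotient L I =
    \<lparr>carrier = a_rcosets\<^bsub>L\<^esub> I, monoid.mult = undefined, one = undefined, zero = I, add = set_add L,
     smult = (\<lambda>c A. \<Union>a\<in>A. I +>\<^bsub>L\<^esub> (c \<odot>\<^bsub>L\<^esub> a)),
     bracket = (\<lambda>A B. \<Union>a\<in>A. \<Union>b\<in>B. I +>\<^bsub>L\<^esub> (a \<star>\<^bsub>L\<^esub> b))\<rparr>"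


section \<open>Thin Lie algebras and Nottingham algebras\<close>

text \<open>The components are \<open>G 1\<close>, \<open>G 2\<close>, ...; the value \<open>G 0\<close> is irrelevant.\<close>

locale graded_lie_algebra = lie_algebra L
  for L :: "('f::field, 'a, 'm) lie_scheme" (structure) +
  fixes G :: "nat \<Rightarrow> 'a set"
  assumes component_subspace: "i \<ge> 1 \<Longrightarrow> subspace class_ring (G i) L"
    and bracket_component: "\<lbrakk>i \<ge> 1; j \<ge> 1; u \<in> G i; v \<in> G j\<rbrakk> \<Longrightarrow> u \<star> v \<in> G (i + j)"
    and components_generate: "v \<in> carrier L \<Longrightarrow>
          \<exists>n c. (\<forall>i\<in>{1..n}. c i \<in> G i) \<and> v = (\<Oplus>\<^bsub>L\<^esub>i\<in>{1..n}. c i)"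
    and components_independent:
          "\<lbrakk>\<forall>i\<in>{1..n}. c i \<in> G i; (\<Oplus>\<^bsub>L\<^esub>i\<in>{1..n}. c i) = \<zero>\<^bsub>L\<^esub>\<rbrakk> \<Longrightarrow> \<forall>i\<in>{1..n}. c i = \<zero>\<^bsub>L\<^esub>"

locale thin_lie_algebra = graded_lie_algebra L G
  for L :: "('f::field, 'a, 'm) lie_scheme" (structure) and G +
  assumes first_diamond: "has_dim L (G 1) 2"
    and covering: "\<lbrakk>i \<ge> 1; z \<in> G i; z \<noteq> \<zero>\<^bsub>L\<^esub>\<rbrakk> \<Longrightarrow> {z \<star> u |u. u \<in> G 1} = G (i + 1)"
    and further_diamond: "\<exists>m>1. has_dim L (G m) 2"

definition second_diamond ::
  "('f::field, 'a, 'm) lie_scheme \<Rightarrow> (nat \<Rightarrow> 'a set) \<Rightarrow> nat \<Rightarrow> bool" where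
  "second_diamond L G m \<longleftrightarrow>
     m > 1 \<and> has_dim L (G m) 2 \<and> (\<forall>j. 1 < j \<and> j < m \<longrightarrow> \<not> has_dim L (G j) 2)"

locale nottingham_algebra = thin_lie_algebra L G
  for L :: "('f::field, 'a, 'm) lie_scheme" (structure) and G and q :: nat +
  assumes characteristic: "CHAR('f) > 3"
    and parameter: "q > 5" "\<exists>n. q = CHAR('f) ^ n"
    and second_diamond_at: "second_diamond L G q"

definition standard_generators ::
  "('f::field, 'a, 'm) lie_scheme \<Rightarrow> (nat \<Rightarrow> 'a set) \<Rightarrow> nat \<Rightarrow> 'a \<Rightarrow> 'a \<Rightarrow> bool" where
  "standard_generators L G q x y \<longleftrightarrow>
     x \<in> G 1 \<and> y \<in> G 1 \<and> LinearCombinations.module.span class_ring L {x, y} = G 1 \<and>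
     y \<star>\<^bsub>L\<^esub> x \<star>\<^bsub>L\<^esub> y = \<zero>\<^bsub>L\<^esub> \<and>
     (let v\<^sub>1 = rpow (bracket L) y x (q - 2) in
        v\<^sub>1 \<star>\<^bsub>L\<^esub> x \<star>\<^bsub>L\<^esub> x = \<zero>\<^bsub>L\<^esub> \<and> v\<^sub>1 \<star>\<^bsub>L\<^esub> y \<star>\<^bsub>L\<^esub> y = \<zero>\<^bsub>L\<^esub> \<and>
        v\<^sub>1 \<star>\<^bsub>L\<^esub> y \<star>\<^bsub>L\<^esub> x = (-2) \<odot>\<^bsub>L\<^esub> (v\<^sub>1 \<star>\<^bsub>L\<^esub> x \<star>\<^bsub>L\<^esub> y))"


section \<open>Types of diamonds\<close>

text \<open>
  The following are relative to standard generators \<open>x\<close>, \<open>y\<close>. All conditions on \<open>w\<close> are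
  invariant under rescaling \<open>w\<close>, \<open>x\<close> and \<open>y\<close>, and the component of degree \<open>m - 1\<close> is a line,
  so it does not matter which \<open>w\<close> spanning it is taken.
\<close>

definition infinite_type_diamond ::
  "('f::field, 'a, 'm) lie_scheme \<Rightarrow> (nat \<Rightarrow> 'a set) \<Rightarrow> 'a \<Rightarrow> 'a \<Rightarrow> nat \<Rightarrow> bool" where
  "infinite_type_diamond L G x y m \<longleftrightarrow>
     m > 1 \<and> has_dim L (G m) 2 \<and> has_dim L (G (m - 1)) 1 \<and> G (m + 1) \<noteq> {\<zero>\<^bsub>L\<^esub>} \<and>
     (\<forall>w \<in> G (m - 1). w \<noteq> \<zero>\<^bsub>L\<^esub> \<longrightarrow>
        w \<star>\<^bsub>L\<^esub> x \<star>\<^bsub>L\<^esub> x = \<zero>\<^bsub>L\<^esub> \<and> w \<star>\<^bsub>L\<^esub> y \<star>\<^bsub>L\<^esub> y = \<zero>\<^bsub>L\<^esub> \<and>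
        w \<star>\<^bsub>L\<^esub> y \<star>\<^bsub>L\<^esub> x = \<ominus>\<^bsub>L\<^esub> (w \<star>\<^bsub>L\<^esub> x \<star>\<^bsub>L\<^esub> y))"

definition genuine_finite_type_diamond ::
  "('f::field, 'a, 'm) lie_scheme \<Rightarrow> (nat \<Rightarrow> 'a set) \<Rightarrow> 'a \<Rightarrow> 'a \<Rightarrow> nat \<Rightarrow> 'f \<Rightarrow> bool" where
  "genuine_finite_type_diamond L G x y m \<mu> \<longleftrightarrow>
     m > 1 \<and> has_dim L (G m) 2 \<and> has_dim L (G (m - 1)) 1 \<and> G (m + 1) \<noteq> {\<zero>\<^bsub>L\<^esub>} \<and>
     (\<forall>w \<in> G (m - 1). w \<noteq> \<zero>\<^bsub>L\<^esub> \<longrightarrow>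
        w \<star>\<^bsub>L\<^esub> x \<star>\<^bsub>L\<^esub> x = \<zero>\<^bsub>L\<^esub> \<and> w \<star>\<^bsub>L\<^esub> y \<star>\<^bsub>L\<^esub> y = \<zero>\<^bsub>L\<^esub> \<and>
        \<mu> \<odot>\<^bsub>L\<^esub> (w \<star>\<^bsub>L\<^esub> y \<star>\<^bsub>L\<^esub> x) = (1 - \<mu>) \<odot>\<^bsub>L\<^esub> (w \<star>\<^bsub>L\<^esub> x \<star>\<^bsub>L\<^esub> y))"

definition fake_diamond_type_1 ::
  "('f::field, 'a, 'm) lie_scheme \<Rightarrow> (nat \<Rightarrow> 'a set) \<Rightarrow> 'a \<Rightarrow> 'a \<Rightarrow> nat \<Rightarrow> bool" where
  "fake_diamond_type_1 L G x y m \<longleftrightarrow>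
     m > 1 \<and> has_dim L (G (m - 1)) 1 \<and> G (m + 1) \<noteq> {\<zero>\<^bsub>L\<^esub>} \<and>
     (\<forall>w \<in> G (m - 1). w \<noteq> \<zero>\<^bsub>L\<^esub> \<longrightarrow>
        w \<star>\<^bsub>L\<^esub> x \<star>\<^bsub>L\<^esub> x = \<zero>\<^bsub>L\<^esub> \<and> w \<star>\<^bsub>L\<^esub> y = \<zero>\<^bsub>L\<^esub>)"

definition fake_diamond_type_0 ::
  "('f::field, 'a, 'm) lie_scheme \<Rightarrow> (nat \<Rightarrow> 'a set) \<Rightarrow> 'a \<Rightarrow> 'a \<Rightarrow> nat \<Rightarrow> bool" where
  "fake_diamond_type_0 L G x y m \<longleftrightarrow>
     m > 1 \<and> has_dim L (G (m - 1)) 1 \<and> G (m + 1) \<noteq> {\<zero>\<^bsub>L\<^esub>} \<and>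
     (\<forall>w \<in> G (m - 1). w \<noteq> \<zero>\<^bsub>L\<^esub> \<longrightarrow>
        w \<star>\<^bsub>L\<^esub> x = \<zero>\<^bsub>L\<^esub> \<and> w \<star>\<^bsub>L\<^esub> y \<star>\<^bsub>L\<^esub> y = \<zero>\<^bsub>L\<^esub>)"

text \<open>
  Whenever degree \<open>m\<close> satisfies the definition of a fake diamond of type 1, degree \<open>m + 1\<close>
  satisfies that of type 0. Which of the two is called a diamond is a matter of convention, to
  be fixed by the degrees at which diamonds are asserted.
\<close>

definition finite_type_diamond ::
  "('f::field, 'a, 'm) lie_scheme \<Rightarrow> (nat \<Rightarrow> 'a set) \<Rightarrow> 'a \<Rightarrow> 'a \<Rightarrow> nat \<Rightarrow> 'f \<Rightarrow> bool" where
  "finite_type_diamond L G x y m \<mu> \<longleftrightarrow>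
     genuine_finite_type_diamond L G x y m \<mu> \<or>
     (\<mu> = 1 \<and> fake_diamond_type_1 L G x y m) \<or>
     (\<mu> = 0 \<and> fake_diamond_type_0 L G x y m)"


section \<open>Lie algebras given by generators and relations\<close>

datatype ('f, 'g) lie_term =
    Gen 'g
  | Zero
  | Add "('f, 'g) lie_term" "('f, 'g) lie_term"
  | Scale 'f "('f, 'g) lie_term"
  | Br "('f, 'g) lie_term" "('f, 'g) lie_term" (infixl \<open>\<cdot>\<close> 75)

text \<open>
  \<open>R\<close> is a set of relations, a pair \<open>(t, u)\<close> standing for \<open>t = u\<close>. Two terms are congruent iff
  they are equal modulo the Lie algebra axioms and the relations.
\<close>

inductive lie_cong ::
  "(('f::field, 'g) lie_term \<times> ('f, 'g) lie_term) set \<Rightarrow>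
   ('f, 'g) lie_term \<Rightarrow> ('f, 'g) lie_term \<Rightarrow> bool"
  for R where
  rel: "(t, u) \<in> R \<Longrightarrow> lie_cong R t u"
| refl: "lie_cong R t t"
| sym: "lie_cong R t u \<Longrightarrow> lie_cong R u t"
| trans: "\<lbrakk>lie_cong R t u; lie_cong R u w\<rbrakk> \<Longrightarrow> lie_cong R t w"
| Add_cong: "\<lbrakk>lie_cong R t t'; lie_cong R u u'\<rbrakk> \<Longrightarrow> lie_cong R (Add t u) (Add t' u')"
| Scale_cong: "lie_cong R t t' \<Longrightarrow> lie_cong R (Scale c t) (Scale c t')"
| Br_cong: "\<lbrakk>lie_cong R t t'; lie_cong R u u'\<rbrakk> \<Longrightarrow> lie_cong R (t \<cdot> u) (t' \<cdot> u')"
| Add_assoc: "lie_cong R (Add (Add t u) w) (Add t (Add u w))"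
| Add_comm: "lie_cong R (Add t u) (Add u t)"
| Add_Zero: "lie_cong R (Add t Zero) t"
| Add_inverse: "lie_cong R (Add t (Scale (-1) t)) Zero"
| Scale_Add: "lie_cong R (Scale c (Add t u)) (Add (Scale c t) (Scale c u))"
| Scale_add: "lie_cong R (Scale (c + d) t) (Add (Scale c t) (Scale d t))"
| Scale_Scale: "lie_cong R (Scale c (Scale d t)) (Scale (c * d) t)"
| Scale_one: "lie_cong R (Scale 1 t) t"
| Br_Add_left: "lie_cong R (Add t u \<cdot> w) (Add (t \<cdot> w) (u \<cdot> w))"
| Br_Add_right: "lie_cong R (t \<cdot> Add u w) (Add (t \<cdot> u) (t \<cdot> w))"
| Br_Scale_left: "lie_cong R (Scale c t \<cdot> u) (Scale c (t \<cdot> u))"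
| Br_Scale_right: "lie_cong R (t \<cdot> Scale c u) (Scale c (t \<cdot> u))"
| Br_self: "lie_cong R (t \<cdot> t) Zero"
| Br_jacobi: "lie_cong R (Add (Add (t \<cdot> u \<cdot> w) (u \<cdot> w \<cdot> t)) (w \<cdot> t \<cdot> u)) Zero"

definition lie_class ::
  "(('f::field, 'g) lie_term \<times> ('f, 'g) lie_term) set \<Rightarrow>
   ('f, 'g) lie_term \<Rightarrow> ('f, 'g) lie_term set" where
  "lie_class R t = {u. lie_cong R t u}"

definition presented_lie_algebra ::
  "(('f::field, 'g) lie_term \<times> ('f, 'g) lie_term) set \<Rightarrow> ('f, ('f, 'g) lie_term set) lie" where
  "presented_lie_algebra R =
    \<lparr>carrier = range (lie_class R), monoid.mult = undefined, one = undefined,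
     zero = lie_class R Zero,
     add = (\<lambda>A B. \<Union>a\<in>A. \<Union>b\<in>B. lie_class R (Add a b)),
     smult = (\<lambda>c A. \<Union>a\<in>A. lie_class R (Scale c a)),
     bracket = (\<lambda>A B. \<Union>a\<in>A. \<Union>b\<in>B. lie_class R (a \<cdot> b))\<rparr>"

inductive homogeneous :: "nat \<Rightarrow> ('f, 'g) lie_term \<Rightarrow> bool" where
  "homogeneous 1 (Gen g)"
| "homogeneous n Zero"
| "\<lbrakk>homogeneous n t; homogeneous n u\<rbrakk> \<Longrightarrow> homogeneous n (Add t u)"
| "homogeneous n t \<Longrightarrow> homogeneous n (Scale c t)"
| "\<lbrakk>homogeneous m t; homogeneous n u\<rbrakk> \<Longrightarrow> homogeneous (m + n) (t \<cdot> u)"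

definition presented_component ::
  "(('f::field, 'g) lie_term \<times> ('f, 'g) lie_term) set \<Rightarrow> nat \<Rightarrow> ('f, 'g) lie_term set set" where
  "presented_component R n = lie_class R ` {t. homogeneous n t}"


section \<open>The presentation\<close>

datatype gen = Gen_x | Gen_y

abbreviation xt :: "('f, gen) lie_term" where "xt \<equiv> Gen Gen_x"
abbreviation yt :: "('f, gen) lie_term" where "yt \<equiv> Gen Gen_y"

text \<open>Only indices at least 1 are used; the value at 0 is irrelevant.\<close>

fun vterm :: "nat \<Rightarrow> nat \<Rightarrow> ('f, gen) lie_term" where
  "vterm q 0 = Zero"
| "vterm q (Suc 0) = rpow (\<cdot>) yt xt (q - 2)"
| "vterm q (Suc (Suc k)) = rpow (\<cdot>) (vterm q (Suc k) \<cdot> xt \<cdot> yt) xt (q - 3)"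

definition nottingham_relations ::
  "nat \<Rightarrow> nat \<Rightarrow> nat \<Rightarrow> 'f::field \<Rightarrow> (('f, gen) lie_term \<times> ('f, gen) lie_term) set" where
  "nottingham_relations p q s lam =
     {(rpow (\<cdot>) yt xt i \<cdot> yt, Zero) |i. 0 < i \<and> i < q - 2} \<union>
     {(vterm q 1 \<cdot> xt \<cdot> xt, Zero), (vterm q 1 \<cdot> yt \<cdot> yt, Zero),
      (vterm q 1 \<cdot> yt \<cdot> xt, Scale (-2) (vterm q 1 \<cdot> xt \<cdot> yt))} \<union>
     {(rpow (\<cdot>) (vterm q 1 \<cdot> yt) xt i \<cdot> yt, Zero) |i. 0 < i \<and> i < q - 2} \<union>
     {(Add (vterm q k \<cdot> yt \<cdot> xt) (vterm q k \<cdot> xt \<cdot> yt), Zero) |k. 2 \<le> k \<and> k \<le> p ^ s \<and> even k} \<union>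
     {(Scale lam (vterm q (p ^ s + 1) \<cdot> yt \<cdot> xt), Scale (1 - lam) (vterm q (p ^ s + 1) \<cdot> xt \<cdot> yt))}"

end

theory Submission
  imports Defs
begin

text \<open>Working modulo the centre, each new component of \<open>N\<close> is computed from the preceding ones.
  Let \<open>u\<^sub>t\<close> span degree \<open>t(q - 1) + 2\<close> and \<open>w\<^sub>t\<close> degree \<open>t(q - 1)\<close>. The relations
  \<open>[y x\<^sup>i y] = 0\<close> propagate along the chain between two diamonds, because brackets with them
  give linear equations whose coefficients are binomials modulo \<open>p\<close>. The type of a diamond is
  forced by evaluating products \<open>[[w\<^sub>b x][w\<^sub>c y]]\<close> of two earlier diamonds and their brackets with
  \<open>v\<^sub>1\<close> in two ways. What this needs about structure constants, and that nothing collapses, is read off in a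
  model: a Lie algebra of divided power series in two variables with the Poisson bracket,
  in which \<open>w\<^sub>t\<close> and \<open>u\<^sub>t\<close> become explicit monomials.\<close>

section \<open>Lie algebras on whole types\<close>

text \<open>The common difference of the types is \<open>del = lam + 1\<close>. Diamonds of finite
  and of infinite type are treated alike through two scalars \<open>al\<close> and
  \<open>be\<close>, the coordinates of \<open>[w x y]\<close> and \<open>[w y x]\<close> along
  \<open>u\<close>; fake diamonds are the zeros of one of them. The obstacle is that the model gives
  information on \<open>N\<close> only up to central elements, and only in degrees whose spanning
  elements are already known; about the degree under construction it says nothing. The remedy is to
  identify products of earlier diamonds modulo \<open>Z\<close> in a known degree and then to
  bracket them with \<open>v\<close>: this kills the central error and lands in the new degree,
  where the Leibniz rule gives a linear equation for the unknown diamond. Two places resist. After a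
  diamond of type 1 the powers of \<open>ad x\<close> do not make \<open>[w x x]\<close> central by
  themselves; and right after a multiple of \<open>p ^ s\<close> the new type has to be extracted
  from two earlier diamonds of finite type.\<close>

locale total_lie = vector_space scale
  for scale :: "'f::field \<Rightarrow> 'a::ab_group_add \<Rightarrow> 'a" (infixr \<open>*s\<close> 75) +
  fixes br :: "'a \<Rightarrow> 'a \<Rightarrow> 'a" (infixl \<open>\<diamondop>\<close> 80)
  assumes br_add_left: "(a + b) \<diamondop> c = a \<diamondop> c + b \<diamondop> c"
    and br_add_right: "a \<diamondop> (b + c) = a \<diamondop> b + a \<diamondop> c"
    and br_scale_left: "(k *s a) \<diamondop> b = k *s (a \<diamondop> b)"
    and br_scale_right: "a \<diamondop> (k *s b) = k *s (a \<diamondop> b)"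
    and br_self: "a \<diamondop> a = 0"
    and br_jacobi: "a \<diamondop> b \<diamondop> c + b \<diamondop> c \<diamondop> a + c \<diamondop> a \<diamondop> b = 0"
begin

lemma br_zero_left [simp]: "0 \<diamondop> a = 0"
  using br_add_left[of 0 0 a] by simp

lemma br_zero_right [simp]: "a \<diamondop> 0 = 0"
  using br_add_right[of a 0 0] by simp

lemma br_minus_left: "(- a) \<diamondop> b = - (a \<diamondop> b)"
  using br_add_left[of a "- a" b] by (simp add: eq_neg_iff_add_eq_0 add.commute)

lemma br_minus_right: "a \<diamondop> (- b) = - (a \<diamondop> b)"
  using br_add_right[of a b "- b"] by (simp add: eq_neg_iff_add_eq_0 add.commute)

lemma br_diff_left: "(a - b) \<diamondop> c = a \<diamondop> c - b \<diamondop> c"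
  using br_add_left[of a "- b" c] by (simp add: br_minus_left)

lemma br_diff_right: "a \<diamondop> (b - c) = a \<diamondop> b - a \<diamondop> c"
  using br_add_right[of a b "- c"] by (simp add: br_minus_right)

lemmas br_linear = br_add_left br_add_right br_scale_left br_scale_right
  br_minus_left br_minus_right br_diff_left br_diff_right

lemma br_sum_left: "(\<Sum>i\<in>A. f i) \<diamondop> b = (\<Sum>i\<in>A. f i \<diamondop> b)"
  by (induction A rule: infinite_finite_induct) (auto simp: br_add_left)

lemma br_sum_right: "b \<diamondop> (\<Sum>i\<in>A. f i) = (\<Sum>i\<in>A. b \<diamondop> f i)"
  by (induction A rule: infinite_finite_induct) (auto simp: br_add_right)

lemma br_anti: "a \<diamondop> b = - (b \<diamondop> a)"
proof -
  have "a \<diamondop> b + b \<diamondop> a = 0"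
    using br_self[of "a + b"] br_self[of a] br_self[of b]
    by (simp add: br_add_left br_add_right add_ac)
  thus ?thesis by (simp add: eq_neg_iff_add_eq_0)
qed

lemma br_br: "a \<diamondop> (b \<diamondop> c) = a \<diamondop> b \<diamondop> c - a \<diamondop> c \<diamondop> b"
proof -
  have "b \<diamondop> c \<diamondop> a = - (a \<diamondop> (b \<diamondop> c))" by (rule br_anti)
  moreover have "c \<diamondop> a \<diamondop> b = - (a \<diamondop> c \<diamondop> b)"
    by (subst br_anti[of c a]) (simp add: br_linear)
  ultimately show ?thesis
    using br_jacobi[of a b c] by (simp add: algebra_simps)
qed

lemma br_deriv: "a \<diamondop> b \<diamondop> c = a \<diamondop> c \<diamondop> b + a \<diamondop> (b \<diamondop> c)"
  by (simp add: br_br)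

abbreviation pw :: "'a \<Rightarrow> 'a \<Rightarrow> nat \<Rightarrow> 'a" where "pw \<equiv> rpow (\<diamondop>)"

lemma pw_0 [simp]: "pw a b 0 = a"
  by (simp add: rpow_def)

lemma pw_Suc: "pw a b (Suc n) = pw a b n \<diamondop> b"
  by (simp add: rpow_def)

lemma pw_Suc_left: "pw a b (Suc n) = pw (a \<diamondop> b) b n"
  by (simp add: rpow_def funpow_Suc_right del: funpow.simps)

lemma pw_pw: "pw (pw a b m) b n = pw a b (m + n)"
  by (induction n) (auto simp: pw_Suc)

lemma pw_zero [simp]: "pw 0 b n = 0"
  by (induction n) (auto simp: pw_Suc)

lemma pw_scale: "pw (k *s a) b n = k *s pw a b n"
  by (induction n) (auto simp: pw_Suc br_linear)

lemma pw_diff: "pw (a - a') b n = pw a b n - pw a' b n"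
  by (induction n) (auto simp: pw_Suc br_linear)

text \<open>The binomial theorem for \<open>ad x\<close>: bracketing with \<open>[b x^n]\<close> is
  an iterated commutator, which unfolds into left-normed products. Later computations expand a
  bracket with \<open>[y x^i]\<close> or \<open>v\<close> in this way and show that few terms
  survive.\<close>

lemma br_pw:
  "a \<diamondop> pw b x n =
    (\<Sum>k\<le>n. ((-1) ^ k * of_nat (n choose k)) *s pw (pw a x k \<diamondop> b) x (n - k))"
proof (induction n arbitrary: a)
  case 0
  show ?case by simp
next
  case (Suc n)
  let ?c = "\<lambda>n k. (-1) ^ k * of_nat (n choose k) :: 'f"
  let ?g = "\<lambda>k. pw (pw a x k \<diamondop> b) x (Suc n - k)"
  have "a \<diamondop> pw b x (Suc n) = a \<diamondop> pw b x n \<diamondop> x - a \<diamondop> x \<diamondop> pw b x n"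
    by (simp add: pw_Suc br_br)
  also have "a \<diamondop> pw b x n \<diamondop> x = (\<Sum>k\<le>n. ?c n k *s ?g k)"
    unfolding Suc.IH[of a] br_sum_left
    by (intro sum.cong) (auto simp: br_linear pw_Suc Suc_diff_le)
  \<comment> \<open>The term added here has coefficient \<open>n choose Suc n = 0\<close>; both sums
    now run over the same range, ready for Pascal's rule.\<close>
  also have "\<dots> = (\<Sum>k\<le>Suc n. ?c n k *s ?g k)"
    by (simp add: binomial_eq_0)
  also have "a \<diamondop> x \<diamondop> pw b x n = (\<Sum>k\<le>n. ?c n k *s ?g (Suc k))"
    unfolding Suc.IH[of "a \<diamondop> x"] by (simp add: pw_Suc_left)
  also have "\<dots> = - (\<Sum>k\<in>{1..Suc n}. ((-1) ^ k * of_nat (n choose (k - 1))) *s ?g k)"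
    by (subst sum_negf[symmetric], rule sum.reindex_bij_witness[of _ "\<lambda>k. k - 1" Suc]) auto
  also have "(\<Sum>k\<in>{1..Suc n}. ((-1) ^ k * of_nat (n choose (k - 1))) *s ?g k) =
      (\<Sum>k\<le>Suc n. ((-1) ^ k * of_nat (if k = 0 then 0 else n choose (k - 1))) *s ?g k)"
    by (intro sum.mono_neutral_cong_left) auto
  also have "(\<Sum>k\<le>Suc n. ?c n k *s ?g k) - - \<dots> = (\<Sum>k\<le>Suc n. ?c (Suc n) k *s ?g k)"
    unfolding diff_minus_eq_add sum.distrib[symmetric]
  proof (rule sum.cong[OF HOL.refl])
    fix k assume "k \<in> {..Suc n}"
    show "?c n k *s ?g k + ((-1) ^ k * of_nat (if k = 0 then 0 else n choose (k - 1))) *s ?g k =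
      ?c (Suc n) k *s ?g k"
      by (cases k) (auto simp: scale_left_distrib[symmetric] algebra_simps)
  qed
  finally show ?case .
qed

end

section \<open>Binomial coefficients modulo the characteristic\<close>

text \<open>Since \<open>k * (p ^ n choose k) = p ^ n * ((p ^ n - 1) choose (k - 1))\<close>, a
  binomial prime to \<open>p\<close> would force \<open>p ^ n\<close> to divide the smaller number
  \<open>k\<close>.\<close>

lemma of_nat_choose_prime_power:
  assumes "prime p" "CHAR('f::field) = p" "0 < k" "k < p ^ n"
  shows "of_nat (p ^ n choose k) = (0::'f)"
proof -
  have "p dvd (p ^ n choose k)"
  proof (rule ccontr)
    assume "\<not> p dvd (p ^ n choose k)"
    hence cop: "coprime (p ^ n) (p ^ n choose k)"
      using assms(1) by (simp add: prime_imp_coprime coprime_power_left_iff)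
    have "k * (p ^ n choose k) = p ^ n * ((p ^ n - 1) choose (k - 1))"
      using times_binomial_minus1_eq[OF assms(3)] by simp
    hence "p ^ n dvd k * (p ^ n choose k)" by simp
    hence "p ^ n dvd k" using cop by (simp add: coprime_dvd_mult_left_iff)
    thus False using assms(3,4) by (auto dest: dvd_imp_le)
  qed
  thus ?thesis using assms(2) by (simp add: of_nat_eq_0_iff_char_dvd)
qed

text \<open>Both sides are the coefficient of \<open>X\<^sup>m\<close> in \<open>(1 - X)\<^bsup>-i\<^esup> = (1 - X)\<^bsup>q-i\<^esup> / (1 - X\<^sup>q)\<close>.\<close>

lemma of_nat_choose_neg:
  assumes "prime p" "CHAR('f::field) = p" "i \<le> p ^ n" "m < p ^ n"
  shows "of_nat ((i + m) - 1 choose m) = ((-1) ^ m * of_nat (p ^ n - i choose m) :: 'f)"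
  using assms(3,4)
proof (induction i arbitrary: m)
  case 0
  show ?case
  proof (cases "m = 0")
    case False
    thus ?thesis using of_nat_choose_prime_power[OF assms(1,2), of m n] 0
      by (simp add: binomial_eq_0)
  qed auto
next
  case (Suc i)
  note IH = Suc.IH
  show ?case using Suc.prems(2)
  proof (induction m)
    case 0
    show ?case by simp
  next
    case (Suc m)
    have A: "p ^ n - i = Suc (p ^ n - Suc i)" using \<open>Suc i \<le> p ^ n\<close> by simp
    have "of_nat (Suc i + Suc m - 1 choose Suc m) =
        (of_nat (i + Suc m - 1 choose Suc m) + of_nat (Suc i + m - 1 choose m) :: 'f)"
      by (simp add: add.commute)
    also have "of_nat (i + Suc m - 1 choose Suc m) =
        ((-1) ^ Suc m * of_nat (p ^ n - i choose Suc m) :: 'f)"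
      by (rule IH) (use Suc.prems \<open>Suc i \<le> p ^ n\<close> in simp_all)
    also have "of_nat (Suc i + m - 1 choose m) = ((-1) ^ m * of_nat (p ^ n - Suc i choose m) :: 'f)"
      by (rule Suc.IH) (use Suc.prems in simp)
    finally show ?case
      unfolding A by (simp add: algebra_simps)
  qed
qed

section \<open>Hurwitz series\<close>

text \<open>Divided power series: \<open>f\<close> stands for \<open>\<Sum>\<^sub>n f\<^sub>n z\<^bsup>(n)\<^esup>\<close>, where \<open>z\<^bsup>(n)\<^esup>\<close> plays the role of \<open>z\<^sup>n / n!\<close>.
  The product is defined by its derivatives at 0, which makes the ring laws plain inductions.\<close>

typedef 'a hurwitz = "UNIV :: (nat \<Rightarrow> 'a) set"
  morphisms hnth Hurwitz ..

setup_lifting type_definition_hurwitz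

fun hmul :: "nat \<Rightarrow> (nat \<Rightarrow> 'a::comm_ring_1) \<Rightarrow> (nat \<Rightarrow> 'a) \<Rightarrow> 'a" where
  "hmul 0 f g = f 0 * g 0"
| "hmul (Suc n) f g = hmul n (\<lambda>i. f (Suc i)) g + hmul n f (\<lambda>i. g (Suc i))"

lemma hmul_add_left: "hmul n (\<lambda>i. f i + f' i) g = hmul n f g + hmul n f' g"
proof (induction n arbitrary: f f' g)
  case (Suc n)
  show ?case unfolding hmul.simps Suc by (simp only: add_ac)
qed (simp add: distrib_right)

lemma hmul_commute: "hmul n f g = hmul n g f"
proof (induction n arbitrary: f g)
  case (Suc n)
  show ?case unfolding hmul.simps Suc[of _ g] Suc[of f] by (rule add.commute)
qed (simp add: mult.commute)

lemma hmul_add_right: "hmul n f (\<lambda>i. g i + g' i) = hmul n f g + hmul n f g'"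
  unfolding hmul_commute[of n f] by (rule hmul_add_left)

lemma hmul_assoc: "hmul n (\<lambda>i. hmul i f g) h = hmul n f (\<lambda>i. hmul i g h)"
proof (induction n arbitrary: f g h)
  case (Suc n)
  show ?case unfolding hmul.simps hmul_add_left hmul_add_right Suc by (rule add.assoc)
qed (simp add: mult.assoc)

lemma hmul_zero: "hmul n (\<lambda>i. 0) f = 0"
  by (induction n arbitrary: f) auto

lemma hmul_const: "hmul n (\<lambda>i. if i = 0 then c else 0) f = c * f n"
proof (induction n arbitrary: f)
  case (Suc n)
  thus ?case by (simp add: hmul_zero)
qed auto

instantiation hurwitz :: (comm_ring_1) comm_ring_1
begin

lift_definition zero_hurwitz :: "'a hurwitz" is "\<lambda>_. 0" .
lift_definition one_hurwitz :: "'a hurwitz" is "\<lambda>n. if n = 0 then 1 else 0" .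
lift_definition plus_hurwitz :: "'a hurwitz \<Rightarrow> 'a hurwitz \<Rightarrow> 'a hurwitz" is "\<lambda>f g n. f n + g n" .
lift_definition minus_hurwitz :: "'a hurwitz \<Rightarrow> 'a hurwitz \<Rightarrow> 'a hurwitz" is "\<lambda>f g n. f n - g n" .
lift_definition uminus_hurwitz :: "'a hurwitz \<Rightarrow> 'a hurwitz" is "\<lambda>f n. - f n" .
lift_definition times_hurwitz :: "'a hurwitz \<Rightarrow> 'a hurwitz \<Rightarrow> 'a hurwitz" is "\<lambda>f g n. hmul n f g" .

instance
proof
  fix a b c :: "'a hurwitz"
  show "a * b * c = a * (b * c)" by transfer (simp add: hmul_assoc)
  show "a * b = b * a" by transfer (simp add: hmul_commute)
  show "1 * a = a" by transfer (simp add: hmul_const)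
  show "(a + b) * c = a * c + b * c" by transfer (simp add: hmul_add_left)
  show "(0::'a hurwitz) \<noteq> 1" by transfer (auto simp: fun_eq_iff)
qed (transfer; simp add: algebra_simps)+

end

text \<open>Differentiation: on divided powers no factor \<open>n\<close> appears, so nothing is
  lost in characteristic \<open>p\<close>.\<close>

lift_definition hshift :: "'a hurwitz \<Rightarrow> 'a hurwitz" is "\<lambda>f n. f (Suc n)" .
lift_definition hconst :: "'a::comm_ring_1 \<Rightarrow> 'a hurwitz" is "\<lambda>c n. if n = 0 then c else 0" .
lift_definition hmon :: "nat \<Rightarrow> 'a::comm_ring_1 hurwitz" is "\<lambda>k n. if n = k then 1 else 0" .
lift_definition hmap :: "('a \<Rightarrow> 'a) \<Rightarrow> 'a hurwitz \<Rightarrow> 'a hurwitz" is "\<lambda>h f n. h (f n)" .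

section \<open>Derivations of commutative rings\<close>

definition derivation :: "('a::comm_ring_1 \<Rightarrow> 'a) \<Rightarrow> bool" where
  "derivation d \<longleftrightarrow> (\<forall>a b. d (a + b) = d a + d b) \<and> (\<forall>a b. d (a * b) = d a * b + a * d b)"

lemma derivation_add: "derivation d \<Longrightarrow> d (a + b) = d a + d b"
  and derivation_mult: "derivation d \<Longrightarrow> d (a * b) = d a * b + a * d b"
  by (auto simp: derivation_def)

lemma derivation_0:
  assumes "derivation d" shows "d 0 = 0"
  using derivation_add[OF assms, of 0 0] by simp

lemma derivation_1:
  assumes "derivation d" shows "d 1 = 0"
  using derivation_mult[OF assms, of 1 1] by simp

lemma derivation_minus:
  assumes "derivation d" shows "d (- a) = - d a"
proof -
  have "d (- a) + d a = 0"
    using derivation_add[OF assms, of "- a" a] derivation_0[OF assms] by simp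
  thus ?thesis by (simp add: eq_neg_iff_add_eq_0)
qed

lemma derivation_diff:
  assumes "derivation d" shows "d (a - b) = d a - d b"
  using derivation_add[OF assms, of a "- b"] derivation_minus[OF assms, of b] by simp

lemma derivation_power:
  assumes "derivation d"
  shows "d (a ^ n) = of_nat n * a ^ (n - 1) * d a"
proof (induction n)
  case (Suc n)
  thus ?case
    by (cases n) (auto simp: derivation_mult[OF assms] derivation_1[OF assms] algebra_simps)
qed (auto simp: derivation_1[OF assms])

lemma derivation_of_nat: 
  assumes "derivation d"
  shows "d (of_nat n) = 0"
  by (induction n)
    (auto simp: derivation_0[OF assms] derivation_1[OF assms] derivation_add[OF assms])

lemma derivation_combine: "derivation d \<Longrightarrow> derivation e \<Longrightarrow> derivation (\<lambda>a. d a + c * e a)"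
  by (auto simp: derivation_def algebra_simps)

lemma derivation_hshift: "derivation hshift"
  unfolding derivation_def by (auto; transfer; simp add: fun_eq_iff)

lemma hmul_derivation:
  assumes "derivation d"
  shows "d (hmul n f g) = hmul n (\<lambda>i. d (f i)) g + hmul n f (\<lambda>i. d (g i))"
proof (induction n arbitrary: f g)
  case (Suc n)
  note a = Suc[of "\<lambda>i. f (Suc i)" g] Suc[of f "\<lambda>i. g (Suc i)"]
  show ?case
    unfolding hmul.simps derivation_add[OF assms] a by (simp only: add_ac)
qed (simp add: derivation_mult[OF assms])

lemma derivation_hmap:
  assumes "derivation d" shows "derivation (hmap d)"
proof -
  have "hmap d (a + b) = hmap d a + hmap d b" for a b
    unfolding hnth_inject[symmetric] hmap.rep_eq plus_hurwitz.rep_eq derivation_add[OF assms] ..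
  moreover have "hmap d (a * b) = hmap d a * b + a * hmap d b" for a b
    unfolding hnth_inject[symmetric] hmap.rep_eq plus_hurwitz.rep_eq times_hurwitz.rep_eq
      hmul_derivation[OF assms] ..
  ultimately show ?thesis unfolding derivation_def by blast
qed

lemma hshift_hmap: "hshift (hmap d f) = hmap d (hshift f)"
  by transfer simp

text \<open>A constant term and a derivative determine a divided power series, unlike an ordinary
  power series in characteristic \<open>p\<close>. Identities can thus be proved by
  differentiating.\<close>

lemma hurwitz_eqI: "hnth f 0 = hnth g 0 \<Longrightarrow> hshift f = hshift g \<Longrightarrow> f = g"
proof (transfer, rule ext)
  fix f g :: "nat \<Rightarrow> 'a" and n
  assume "f 0 = g 0" "(\<lambda>n. f (Suc n)) = (\<lambda>n. g (Suc n))"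
  thus "f n = g n" by (cases n) (auto dest: fun_cong)
qed

lemma hshift_hconst [simp]: "hshift (hconst c) = 0"
  by transfer auto

lemma hshift_hmon_Suc [simp]: "hshift (hmon (Suc n)) = hmon n"
  by transfer (auto simp: fun_eq_iff)

lemma hmon_0 [simp]: "hmon 0 = 1"
  by transfer (auto simp: fun_eq_iff)

lemma hshift_1 [simp]: "hshift 1 = 0"
  by (rule derivation_1[OF derivation_hshift])

lemma hconst_simps [simp]:
  "hconst 0 = 0" "hconst 1 = 1" "hconst (a + b) = hconst a + hconst b"
  "hconst (a - b) = hconst a - hconst b" "hconst (- a) = - hconst a"
  by (transfer; auto simp: fun_eq_iff)+

lemma hconst_mult [simp]: "hconst (a * b) = hconst a * hconst b"
  by transfer (auto simp: hmul_const)

lemma hconst_of_nat [simp]: "hconst (of_nat n) = of_nat n"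
  by (induction n) auto

lemma hconst_power [simp]: "hconst (a ^ n) = hconst a ^ n"
  by (induction n) auto

lemma hmap_hconst: "d 0 = 0 \<Longrightarrow> hmap d (hconst c) = hconst (d c)"
  by transfer auto

lemma hmap_hmon: "d 0 = 0 \<Longrightarrow> d 1 = 0 \<Longrightarrow> hmap d (hmon n) = 0"
  by transfer auto

lemma hnth_0_mult: "hnth (f * g) 0 = hnth f 0 * hnth g 0"
  by transfer simp

lemma hnth_hconst_mult: "hnth (hconst c * f) n = c * hnth f n"
  by transfer (simp add: hmul_const)

lemma hnth_hmon: "hnth (hmon k) n = (if n = k then 1 else 0)"
  by transfer auto

lemma hnth_hmon_0: "hnth (hmon k) 0 = (if k = 0 then 1 else 0)"
  by (auto simp: hnth_hmon)

text \<open>The derivative of a product of two monomials consists of two products of total degree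
  one less, whose binomials add up by Pascal's rule; the constant terms on both sides
  vanish.\<close>

lemma hmon_hmon: "hmon i * hmon j = of_nat ((i + j) choose i) * hmon (i + j)"
proof (induction "i + j" arbitrary: i j)
  case 0
  thus ?case by simp
next
  case (Suc n)
  show ?case
  proof (cases "i = 0 \<or> j = 0")
    case True
    thus ?thesis by (elim disjE) simp_all
  next
    case False
    define i' j' where "i' = i - 1" "j' = j - 1"
    with False have ij: "i = Suc i'" "j = Suc j'" by simp_all
    have n: "n = i' + Suc j'" "n = Suc i' + j'" "i + j = Suc n"
      using Suc.hyps(2) ij by linarith+
    have 1: "hmon i' * hmon (Suc j') = (of_nat (n choose i') * hmon n :: 'a hurwitz)"
      using Suc.hyps(1)[OF n(1)] unfolding n(1)[symmetric] .
    have 2: "hmon (Suc i') * hmon j' = (of_nat (n choose Suc i') * hmon n :: 'a hurwitz)"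
      using Suc.hyps(1)[OF n(2)] unfolding n(2)[symmetric] .
    have "hshift (hmon i * hmon j :: 'a hurwitz) = hmon i' * hmon (Suc j') + hmon (Suc i') * hmon j'"
      unfolding ij derivation_mult[OF derivation_hshift] hshift_hmon_Suc ..
    also have "\<dots> = of_nat (Suc n choose Suc i') * hmon n"
      unfolding 1 2 by (simp add: distrib_right)
    also have "\<dots> = hshift (of_nat (Suc n choose Suc i') * hmon (Suc n))"
      unfolding derivation_mult[OF derivation_hshift] derivation_of_nat[OF derivation_hshift]
        hshift_hmon_Suc by simp
    finally have "hshift (hmon i * hmon j :: 'a hurwitz) = hshift (of_nat (i + j choose i) * hmon (i + j))"
      unfolding n(3) ij(1)[symmetric] .
    moreover have "hnth (hmon i * hmon j :: 'a hurwitz) 0 = hnth (of_nat (i + j choose i) * hmon (i + j)) 0"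
      unfolding ij hnth_0_mult hnth_hmon_0 add_Suc nat.distinct if_False by simp
    ultimately show ?thesis by (rule hurwitz_eqI[rotated])
  qed
qed

text \<open>Multiplication by the variable itself; with it the equations of \<open>us\<close> and
  \<open>gs\<close> can be checked coefficient by coefficient.\<close>

lemma hnth_hmon_1_mult: "hnth (hmon 1 * f) n = of_nat n * hnth f (n - 1)"
proof (induction n arbitrary: f)
  case (Suc n)
  have "hnth (hmon 1 * f) (Suc n) = hnth (hshift (hmon 1 * f)) n"
    unfolding hshift.rep_eq ..
  also have "hshift (hmon 1 * f) = f + hmon 1 * hshift f"
    unfolding derivation_mult[OF derivation_hshift] One_nat_def hshift_hmon_Suc by simp
  also have "hnth \<dots> n = hnth f n + of_nat n * hnth f n"
    unfolding plus_hurwitz.rep_eq Suc hshift.rep_eq by (cases n) auto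
  finally show ?case by (simp add: algebra_simps)
qed (simp add: hnth_0_mult hnth_hmon)

lemma hmon_mult_hconst_eq_0_iff: "hmon n * hconst c = 0 \<longleftrightarrow> c = 0"
proof
  assume "hmon n * hconst c = 0"
  hence "hnth (hconst c * hmon n) n = 0" by (simp add: mult.commute zero_hurwitz.rep_eq)
  thus "c = 0" by (simp add: hnth_hconst_mult hnth_hmon)
qed auto

section \<open>Poisson brackets\<close>

text \<open>For commuting derivations the Jacobi identity is a formal cancellation after the Leibniz
  rule; bilinearity holds because the image of \<open>\<kappa>\<close> consists of constants for
  both derivations.\<close>

lemma poisson_total_lie:
  fixes \<kappa> :: "'f::field \<Rightarrow> 'a::comm_ring_1"
  assumes d: "derivation d" and e: "derivation e" and comm: "\<And>a. d (e a) = e (d a)"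
    and \<kappa>: "\<kappa> 1 = 1" "\<And>a b. \<kappa> (a + b) = \<kappa> a + \<kappa> b" "\<And>a b. \<kappa> (a * b) = \<kappa> a * \<kappa> b"
      "\<And>a. d (\<kappa> a) = 0" "\<And>a. e (\<kappa> a) = 0"
  shows "total_lie (\<lambda>c a. \<kappa> c * a) (\<lambda>a b. d a * e b - e a * d b)"
proof -
  note der = derivation_mult[OF d] derivation_mult[OF e] derivation_add[OF d]
    derivation_add[OF e] derivation_diff[OF d] derivation_diff[OF e] \<kappa>(4,5) comm
  show ?thesis
  proof (rule total_lie.intro[OF vector_space.intro total_lie_axioms.intro])
    fix a b c :: 'a and k l :: 'f
    show "\<kappa> k * (a + b) = \<kappa> k * a + \<kappa> k * b" by (rule distrib_left)
    show "\<kappa> (k + l) * a = \<kappa> k * a + \<kappa> l * a" by (simp only: \<kappa>(2) distrib_right)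
    show "\<kappa> k * (\<kappa> l * a) = \<kappa> (k * l) * a" by (simp only: \<kappa>(3) mult.assoc)
    show "\<kappa> 1 * a = a" by (simp only: \<kappa>(1) mult_1)
    show "d (a + b) * e c - e (a + b) * d c = (d a * e c - e a * d c) + (d b * e c - e b * d c)"
      by (simp only: der) (simp only: algebra_simps)
    show "d a * e (b + c) - e a * d (b + c) = (d a * e b - e a * d b) + (d a * e c - e a * d c)"
      by (simp only: der) (simp only: algebra_simps)
    show "d (\<kappa> k * a) * e b - e (\<kappa> k * a) * d b = \<kappa> k * (d a * e b - e a * d b)"
      by (simp only: der mult_zero_left add_0) (simp only: algebra_simps)
    show "d a * e (\<kappa> k * b) - e a * d (\<kappa> k * b) = \<kappa> k * (d a * e b - e a * d b)"
      by (simp only: der mult_zero_left add_0) (simp only: algebra_simps)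
    show "d a * e a - e a * d a = 0" by (simp only: mult.commute[of "e a"] diff_self)
    show "d (d a * e b - e a * d b) * e c - e (d a * e b - e a * d b) * d c +
       (d (d b * e c - e b * d c) * e a - e (d b * e c - e b * d c) * d a) +
       (d (d c * e a - e c * d a) * e b - e (d c * e a - e c * d a) * d b) = 0"
      by (simp only: der) (simp add: algebra_simps)
  qed
qed

section \<open>The model\<close>

type_synonym 'f coef = "'f hurwitz hurwitz"

text \<open>The outer variable \<open>\<xi>\<close> and the middle variable \<open>\<zeta>\<close> are those of the Poisson bracket. The innermost
  variable \<open>z\<close> plays the role of \<open>\<zeta>\<^bsup>(n)\<^esup>\<close>: its derivative along \<open>\<zeta>\<close> is \<open>\<zeta>\<^bsup>(n-1)\<^esup>\<close>.\<close>

definition d1 :: "'f::field coef hurwitz \<Rightarrow> 'f coef hurwitz" where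
  "d1 = hshift"

text \<open>The series \<open>gs\<close> requires divided powers of \<open>\<zeta>^(n)\<close>.
  These exist for a new variable, whereas in characteristic \<open>p\<close> they are not
  polynomials in \<open>\<zeta>^(n)\<close>.\<close>

definition dz :: "nat \<Rightarrow> 'f::field coef \<Rightarrow> 'f coef" where
  "dz n c = hshift c + hmon (n - 1) * hmap hshift c"

definition d2 :: "nat \<Rightarrow> 'f::field coef hurwitz \<Rightarrow> 'f coef hurwitz" where
  "d2 n = hmap (dz n)"

definition mbr :: "nat \<Rightarrow> 'f::field coef hurwitz \<Rightarrow> 'f coef hurwitz \<Rightarrow> 'f coef hurwitz" where
  "mbr n a b = d1 a * d2 n b - d2 n a * d1 b"

abbreviation cst :: "'f::field \<Rightarrow> 'f coef" where "cst c \<equiv> hconst (hconst c)"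

definition mscale :: "'f::field \<Rightarrow> 'f coef hurwitz \<Rightarrow> 'f coef hurwitz" where
  "mscale c a = hconst (cst c) * a"

text \<open>The monomial \<open>\<xi>^(i) c\<close>, with coefficient \<open>c\<close> a series in
  the two inner variables.\<close>

definition me :: "nat \<Rightarrow> 'f::field coef \<Rightarrow> 'f coef hurwitz" where
  "me i c = hmon i * hconst c"

lemma derivation_dz: "derivation (dz n)"
  unfolding dz_def[abs_def] by (intro derivation_combine derivation_hshift derivation_hmap)

lemma derivation_d2: "derivation (d2 n)"
  unfolding d2_def by (intro derivation_hmap derivation_dz)

lemma derivation_d1: "derivation d1"
  unfolding d1_def by (rule derivation_hshift)

lemma dz_cst: "dz n (cst c) = 0"
  unfolding dz_def by (simp add: hmap_hconst derivation_0[OF derivation_hshift])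

lemma total_lie_model: "total_lie mscale (mbr n)"
proof -
  have "total_lie (\<lambda>c a. hconst (cst c) * a) (\<lambda>a b. d1 a * d2 n b - d2 n a * d1 b)"
    by (rule poisson_total_lie[OF derivation_d1 derivation_d2])
      (simp_all add: d1_def d2_def hshift_hmap hmap_hconst derivation_0[OF derivation_dz] dz_cst)
  thus ?thesis by (simp add: mscale_def[abs_def] mbr_def[abs_def])
qed

lemma d1_me: "d1 (me i c) = (if i = 0 then 0 else me (i - 1) c)"
  by (cases i) (simp_all add: me_def d1_def derivation_mult[OF derivation_hshift])

lemma d2_me: "d2 n (me i c) = me i (dz n c)"
  unfolding me_def derivation_mult[OF derivation_d2]
  by (simp add: d2_def hmap_hmon hmap_hconst derivation_0[OF derivation_dz] derivation_1[OF derivation_dz])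

lemma me_mult: "me i a * me k b = of_nat ((i + k) choose i) * me (i + k) (a * b)"
proof -
  have "me i a * me k b = (hmon i * hmon k) * hconst (a * b)" by (simp add: me_def mult_ac)
  thus ?thesis unfolding hmon_hmon by (simp add: me_def mult_ac)
qed

lemma me_add: "me i (a + b) = me i a + me i b"
  by (simp add: me_def algebra_simps)

lemma me_diff: "me i (a - b) = me i a - me i b"
  by (simp add: me_def algebra_simps)

lemma me_minus: "me i (- b) = - me i b"
  by (simp add: me_def)

lemma me_0 [simp]: "me i 0 = 0"
  by (simp add: me_def)

lemma me_of_nat: "of_nat n * me i c = me i (of_nat n * c)"
  by (simp add: me_def algebra_simps)

lemma me_eq_0_iff: "me i c = 0 \<longleftrightarrow> c = 0"
  unfolding me_def by (rule hmon_mult_hconst_eq_0_iff)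

lemma mscale_me: "mscale c (me i a) = me i (cst c * a)"
  by (simp add: mscale_def me_def algebra_simps)

lemma of_nat_coef_eq_0: "of_nat n = (0::'f::field) \<Longrightarrow> of_nat n = (0 :: 'f coef)"
  by (metis hconst_of_nat hconst_simps(1))

lemma of_nat_model_eq_0: "of_nat n = (0::'f::field) \<Longrightarrow> of_nat n = (0 :: 'f coef hurwitz)"
  by (metis hconst_of_nat hconst_simps(1))

text \<open>The parameter \<open>del\<close> is free here and becomes \<open>lam + 1\<close>, the
  common difference of the types.\<close>

locale model =
  fixes p q s e :: nat and del :: "'f::field"
  assumes prime: "prime p" and p3: "p > 3" and char: "CHAR('f) = p" and q5: "q > 5"
    and q: "q = p ^ e" and s0: "s > 0"
begin

definition ps :: nat where "ps = p ^ s"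

text \<open>The series \<open>(1 + del z)\<^sup>-\<^sup>1\<close> and \<open>(1 + del z)\<^bsup>1/del\<^esup>\<close>, the latter to be read as \<open>exp z\<close> if \<open>del = 0\<close>.\<close>

definition us :: "'f hurwitz" where
  "us = Hurwitz (\<lambda>n. (- del) ^ n * of_nat (fact n))"

definition gs :: "'f hurwitz" where
  "gs = Hurwitz (\<lambda>n. \<Prod>i<n. (1 - of_nat i * del))"

lemma us_inverse: "us * (1 + hconst del * hmon 1) = 1"
proof -
  have "hnth (us * (1 + hconst del * hmon 1)) n = hnth 1 n" for n
  proof -
    have "us * (1 + hconst del * hmon 1) = us + hconst del * (hmon 1 * us)"
      by (simp add: algebra_simps)
    hence "hnth (us * (1 + hconst del * hmon 1)) n =
        hnth us n + del * (of_nat n * hnth us (n - 1))"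
      by (simp only: plus_hurwitz.rep_eq hnth_hconst_mult hnth_hmon_1_mult)
    thus ?thesis
      by (cases n) (simp_all add: us_def Hurwitz_inverse one_hurwitz.rep_eq algebra_simps)
  qed
  thus ?thesis by (simp add: hnth_inject[symmetric] fun_eq_iff)
qed

lemma hshift_us: "hshift us = - (hconst del * us ^ 2)"
proof -
  let ?k = "1 + hconst del * hmon 1"
  have "hshift ?k = hconst del"
    unfolding derivation_add[OF derivation_hshift] derivation_mult[OF derivation_hshift] One_nat_def
      hshift_hmon_Suc by simp
  hence "hshift us * ?k + us * hconst del = 0"
    using arg_cong[OF us_inverse, of hshift] unfolding derivation_mult[OF derivation_hshift] by simp
  hence "(hshift us * ?k + us * hconst del) * us = 0" by simp
  hence "hshift us * (us * ?k) + hconst del * us ^ 2 = 0"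
    by (simp only: power2_eq_square algebra_simps)
  thus ?thesis unfolding us_inverse by (simp add: eq_neg_iff_add_eq_0)
qed

text \<open>The differential equation \<open>(1 + del z) g' = g\<close> is checked on coefficients
  and then divided by \<open>1 + del z\<close>; it includes \<open>del = 0\<close>, where the
  solution is the exponential.\<close>

lemma hshift_gs: "hshift gs = us * gs"
proof -
  let ?k = "1 + hconst del * hmon 1"
  have "hnth (hshift gs * ?k) n = hnth gs n" for n
  proof -
    have "hshift gs * ?k = hshift gs + hconst del * (hmon 1 * hshift gs)"
      by (simp add: algebra_simps)
    hence "hnth (hshift gs * ?k) n = hnth gs (Suc n) + del * (of_nat n * hnth (hshift gs) (n - 1))"
      by (simp only: plus_hurwitz.rep_eq hnth_hconst_mult hnth_hmon_1_mult hshift.rep_eq)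
    thus ?thesis
      by (cases n) (simp_all add: gs_def Hurwitz_inverse hshift.rep_eq algebra_simps)
  qed
  hence "hshift gs * ?k = gs" by (simp add: hnth_inject[symmetric] fun_eq_iff)
  hence "us * gs = hshift gs * (us * ?k)" by (simp add: mult_ac)
  thus ?thesis unfolding us_inverse by simp
qed

section \<open>The coefficient series, their products and derivatives\<close>

definition U :: "'f coef" where "U = hconst us"
definition gg :: "'f coef" where "gg = hconst gs"
definition zt :: "nat \<Rightarrow> 'f coef" where "zt i = hmon i"
abbreviation D :: "'f coef \<Rightarrow> 'f coef" where "D \<equiv> dz ps"

lemma ps_gt: "ps \<ge> p" "ps > 3"
proof -
  show "ps \<ge> p" unfolding ps_def using s0 p3 self_le_power[of p s] by simp
  thus "ps > 3" using p3 by simp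
qed

lemma ps_0: "of_nat ps = (0::'f)"
  unfolding ps_def using char s0 by (simp add: of_nat_eq_0_iff_char_dvd)

lemma q_0: "of_nat q = (0::'f)"
proof -
  have "e \<noteq> 0" using q q5 by (metis One_nat_def less_irrefl less_numeral_extra(4) not_numeral_less_one numeral_One power_0)
  thus ?thesis unfolding q using char by (simp add: of_nat_eq_0_iff_char_dvd)
qed

lemma D_U: "D U = - (cst del * zt (ps - 1) * U ^ 2)"
  by (simp add: dz_def U_def zt_def hmap_hconst derivation_0[OF derivation_hshift] hshift_us mult_ac)

lemma D_gg: "D gg = zt (ps - 1) * U * gg"
  by (simp add: dz_def gg_def U_def zt_def hmap_hconst derivation_0[OF derivation_hshift] hshift_gs mult_ac)

lemma D_zt: "D (zt i) = (if i = 0 then 0 else zt (i - 1))"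
proof (cases i)
  case 0
  thus ?thesis using derivation_1[OF derivation_dz[of ps]] by (simp add: zt_def)
next
  case (Suc i')
  thus ?thesis by (simp add: dz_def zt_def hmap_hmon derivation_0[OF derivation_hshift])
qed

lemma zt_0 [simp]: "zt 0 = 1"
  by (simp add: zt_def)

lemma zt_zt: "zt i * zt j = of_nat ((i + j) choose i) * zt (i + j)"
  unfolding zt_def by (rule hmon_hmon)

text \<open>The addition \<open>i + j\<close> carries in base \<open>p\<close>, so the binomial
  vanishes. This is read off from \<open>of_nat_choose_neg\<close>, which replaces it by a binomial
  whose lower index exceeds the upper one.\<close>

lemma zt_zt_0:
  assumes "i < ps" "j < ps" "ps \<le> i + j"
  shows "zt i * zt j = (0 :: 'f coef)"
proof -
  have "of_nat (Suc i + j - 1 choose j) = ((-1) ^ j * of_nat (p ^ s - Suc i choose j) :: 'f)"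
    by (rule of_nat_choose_neg[OF prime char]) (use assms in \<open>auto simp: ps_def\<close>)
  moreover have "p ^ s - Suc i < j" using assms by (simp add: ps_def)
  ultimately have "of_nat (i + j choose j) = (0::'f)" by (simp add: binomial_eq_0)
  hence "of_nat (i + j choose i) = (0::'f)"
    using binomial_symmetric[of i "i + j"] by simp
  thus ?thesis unfolding zt_zt by (simp add: of_nat_coef_eq_0)
qed

definition fin :: "nat \<Rightarrow> bool" where "fin t \<longleftrightarrow> t mod ps = 1"

text \<open>The coefficients in \<open>[w\<^sub>t x y] = al t u\<^sub>t\<close> and \<open>[w\<^sub>t y x] = be t u\<^sub>t\<close> modulo the centre, for the \<open>t\<close>-th diamond;
  \<open>al t\<close> is its type if that is finite.\<close>

definition al :: "nat \<Rightarrow> 'f" where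
  "al t = (if fin t then of_nat ((t - 1) div ps) * del - 1 else 1)"

definition be :: "nat \<Rightarrow> 'f" where
  "be t = (if fin t then 1 - al t else - 1)"

text \<open>The coefficient of \<open>w t\<close> in the model. A diamond of finite type
  (\<open>j = 0\<close>) carries no power of \<open>\<zeta>\<close>; after it the exponent of
  \<open>\<zeta>\<close> descends from \<open>ps - 1\<close> to \<open>0\<close>, which is reached
  at the next finite type. One factor \<open>gg\<close> is gained per diamond and one factor
  \<open>U\<close> per period.\<close>

definition ZZ :: "nat \<Rightarrow> 'f coef" where
  "ZZ t = (let r = (t - 1) div ps; j = (t - 1) mod ps in
     if j = 0 then U ^ r * gg ^ t else - ((-1) ^ j * zt (ps - j) * U ^ Suc r * gg ^ t))"

lemma fin_iff: "fin (r * ps + 1)" "0 < j \<Longrightarrow> j < ps \<Longrightarrow> \<not> fin (r * ps + 1 + j)"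
  using ps_gt(2) mod_mult_self3[of r ps "Suc j"]
  by (auto simp: fin_def mod_Suc split: if_splits)

lemma fin_cases:
  assumes "t \<ge> 1"
  obtains (fin) r where "t = r * ps + 1" | (inf) r j where "t = r * ps + 1 + j" "0 < j" "j < ps"
proof -
  have "t = ((t - 1) div ps) * ps + 1 + (t - 1) mod ps"
    using assms div_mult_mod_eq[of "t - 1" ps] by linarith
  moreover have "(t - 1) mod ps < ps" using ps_gt(2) by simp
  ultimately show ?thesis
    using that by (metis add.right_neutral gr0I)
qed

lemma al_fin: "al (r * ps + 1) = of_nat r * del - 1"
  using fin_iff(1)[of r] ps_gt(2) by (simp add: al_def)

lemma be_fin: "be (r * ps + 1) = 2 - of_nat r * del"
  using al_fin[of r] fin_iff(1)[of r] by (simp add: be_def)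

lemma al_be_inf: "\<not> fin t \<Longrightarrow> al t = 1" "\<not> fin t \<Longrightarrow> be t = - 1"
  by (auto simp: al_def be_def)

lemma al_be_1: "fin t \<Longrightarrow> al t + be t = 1"
  by (simp add: be_def)

lemma al_be_nz: "al t = 0 \<Longrightarrow> be t = 0 \<Longrightarrow> False"
  by (auto simp: al_def be_def split: if_splits)

lemma ZZ_fin: "ZZ (r * ps + 1) = U ^ r * gg ^ (r * ps + 1)"
  using ps_gt(2) by (simp add: ZZ_def)

lemma ZZ_inf: "0 < j \<Longrightarrow> j < ps \<Longrightarrow>
    ZZ (r * ps + 1 + j) = - ((-1) ^ j * zt (ps - j) * U ^ Suc r * gg ^ (r * ps + 1 + j))"
  by (simp add: ZZ_def)

lemma odd_ps: "odd ps"
  using prime p3 prime_odd_nat[of p] by (simp add: ps_def)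

text \<open>The case \<open>j = ps\<close> is the next diamond of finite type, and its sign is right
  because \<open>ps\<close> is odd.\<close>

lemma ZZ_inf': "0 < j \<Longrightarrow> j \<le> ps \<Longrightarrow>
    ZZ (r * ps + 1 + j) = - ((-1) ^ j * zt (ps - j) * U ^ Suc r * gg ^ (r * ps + 1 + j))"
  using ZZ_inf[of j r] ZZ_fin[of "Suc r"] odd_ps by (cases "j = ps") (auto simp: add_ac)

lemma zt_ps_0: "0 < i \<Longrightarrow> i < ps \<Longrightarrow> zt i * zt (ps - 1) = 0"
  by (rule zt_zt_0) auto

text \<open>A logarithmic derivative: \<open>gg\<close> contributes \<open>1\<close> and
  \<open>U\<close> contributes \<open>- del\<close>, each times \<open>zt (ps - 1) * U\<close>. The
  coefficient \<open>m - r del\<close> is the source of the arithmetic progression.\<close>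

lemma D_Ug: "D (U ^ r * gg ^ m) = (of_nat m - of_nat r * cst del) * zt (ps - 1) * U ^ Suc r * gg ^ m"
proof -
  have 1: "of_nat r * U ^ (r - 1) * (- (cst del * zt (ps - 1) * U ^ 2)) =
      - (of_nat r * cst del * zt (ps - 1) * U ^ Suc r)"
    by (cases r) (simp_all add: power2_eq_square mult_ac)
  have 2: "of_nat m * gg ^ (m - 1) * (zt (ps - 1) * U * gg) = of_nat m * zt (ps - 1) * U * gg ^ m"
    by (cases m) (simp_all add: mult_ac)
  show ?thesis
    unfolding derivation_mult[OF derivation_dz] derivation_power[OF derivation_dz] D_U D_gg 1 2
    by (simp add: algebra_simps)
qed

lemma of_nat_ps_coef: "of_nat ps = (0 :: 'f coef)"
  by (rule of_nat_coef_eq_0[OF ps_0])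

lemma D_ZZ_fin: "D (ZZ (r * ps + 1)) =
    cst (1 - of_nat r * del) * zt (ps - 1) * U ^ Suc r * gg ^ (r * ps + 1)"
  unfolding ZZ_fin D_Ug by (simp add: of_nat_ps_coef)

text \<open>Only the power of \<open>\<zeta>\<close> is effectively differentiated: the derivatives
  of the other factors contain \<open>zt (ps - 1)\<close>, and
  \<open>zt (ps - j) * zt (ps - 1) = 0\<close>.\<close>

lemma D_ZZ_inf:
  assumes "0 < j" "j < ps"
  shows "D (ZZ (r * ps + 1 + j)) = - ((-1) ^ j * zt (ps - Suc j) * U ^ Suc r * gg ^ (r * ps + 1 + j))"
proof -
  have c: "D ((-1) ^ j) = 0"
    by (cases "even j") (simp_all add: derivation_1[OF derivation_dz] derivation_minus[OF derivation_dz])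
  have z: "zt (ps - j) * zt (ps - 1) = 0" using assms by (intro zt_ps_0) auto
  have "D (zt (ps - j) * (U ^ Suc r * gg ^ (r * ps + 1 + j))) =
      zt (ps - Suc j) * (U ^ Suc r * gg ^ (r * ps + 1 + j)) + zt (ps - j) * D (U ^ Suc r * gg ^ (r * ps + 1 + j))"
    unfolding derivation_mult[OF derivation_dz] D_zt using assms by simp
  also have "zt (ps - j) * D (U ^ Suc r * gg ^ (r * ps + 1 + j)) = 0"
  proof -
    have "zt (ps - j) * D (U ^ Suc r * gg ^ (r * ps + 1 + j)) = (zt (ps - j) * zt (ps - 1)) *
      ((of_nat (r * ps + 1 + j) - of_nat (Suc r) * cst del) * U ^ Suc (Suc r) * gg ^ (r * ps + 1 + j))"
      unfolding D_Ug by (simp only: mult_ac)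
    thus ?thesis unfolding z by simp
  qed
  finally have 1: "D (zt (ps - j) * (U ^ Suc r * gg ^ (r * ps + 1 + j))) =
      zt (ps - Suc j) * (U ^ Suc r * gg ^ (r * ps + 1 + j))" by simp
  show ?thesis
    unfolding ZZ_inf[OF assms] derivation_minus[OF derivation_dz] mult.assoc
      derivation_mult[OF derivation_dz, of ps "(-1) ^ j"] c 1 by simp
qed

text \<open>This recursion and the next one are what \<open>al\<close> and \<open>be\<close> are
  made for: they describe the brackets of \<open>[w t x]\<close> and \<open>w t\<close> with
  \<open>y\<close> in the model.\<close>

lemma D_ZZ_gg:
  assumes "t \<ge> 1" shows "D (ZZ t) * gg = - (cst (al t) * ZZ (Suc t))"
  using assms
proof (cases rule: fin_cases)
  case (fin r)
  have "ZZ (Suc t) = zt (ps - 1) * U ^ Suc r * gg ^ (r * ps + 1) * gg"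
    using ZZ_inf[of 1 r] ps_gt(2) fin by (simp add: mult_ac)
  thus ?thesis unfolding fin D_ZZ_fin al_fin by (simp add: algebra_simps)
next
  case (inf r j)
  have "ZZ (Suc t) = (-1) ^ j * zt (ps - Suc j) * U ^ Suc r * gg ^ t * gg"
    using ZZ_inf'[of "Suc j" r] inf by (simp add: mult_ac)
  moreover have "al t = 1" using inf fin_iff(2) al_be_inf by simp
  ultimately show ?thesis using D_ZZ_inf[of j r] inf by simp
qed

lemma D_ZZ_gg':
  assumes "t \<ge> 1" shows "D (ZZ t * gg) = cst (be t) * ZZ (Suc t)"
  using assms
proof (cases rule: fin_cases)
  case (fin r)
  have "ZZ (Suc t) = zt (ps - 1) * U ^ Suc r * gg ^ (r * ps + 1) * gg"
    using ZZ_inf[of 1 r] ps_gt(2) fin by (simp add: mult_ac)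
  moreover have "ZZ t * D gg = zt (ps - 1) * U ^ Suc r * gg ^ (r * ps + 1) * gg"
    unfolding fin ZZ_fin D_gg by (simp add: mult_ac)
  ultimately have "ZZ t * D gg = ZZ (Suc t)" by simp
  moreover have "cst (be t) = 1 - cst (al t)" using fin fin_iff(1) by (simp add: be_def)
  ultimately show ?thesis
    unfolding derivation_mult[OF derivation_dz] D_ZZ_gg[OF assms]
      \<open>cst (be t) = 1 - cst (al t)\<close> \<open>ZZ t * D gg = ZZ (Suc t)\<close> by (simp add: left_diff_distrib)
next
  case (inf r j)
  have "ZZ t * D gg = - ((-1) ^ j * U ^ Suc r * gg ^ (r * ps + 1 + j) * U * gg * (zt (ps - j) * zt (ps - 1)))"
    unfolding inf ZZ_inf[OF inf(2,3)] D_gg by (simp only: mult_ac mult_minus_left mult_minus_right)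
  also have "\<dots> = 0" using inf zt_ps_0[of "ps - j"] by simp
  finally have "ZZ t * D gg = 0" .
  moreover have "al t = 1" "be t = - 1" using inf fin_iff(2) al_be_inf by simp_all
  ultimately show ?thesis
    unfolding derivation_mult[OF derivation_dz] D_ZZ_gg[OF assms] by simp
qed

text \<open>Both \<open>us\<close> and \<open>gs\<close> have constant term 1, hence so has every
  product of their powers.\<close>

lemma zt_Ug_nz: "zt i * U ^ r * gg ^ m \<noteq> 0"
proof -
  have "hnth us 0 = 1" "hnth gs 0 = 1" by (simp_all add: us_def gs_def Hurwitz_inverse)
  hence "hnth (us ^ r) 0 = 1" "hnth (gs ^ m) 0 = 1" for r m
    by (induction r, simp_all add: one_hurwitz.rep_eq hnth_0_mult) (induction m, simp_all add: one_hurwitz.rep_eq hnth_0_mult)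
  hence "hnth (us ^ r * gs ^ m) 0 = 1" by (simp add: hnth_0_mult)
  hence "us ^ r * gs ^ m \<noteq> 0" by (auto simp: zero_hurwitz.rep_eq)
  hence "zt i * hconst (us ^ r * gs ^ m) \<noteq> 0"
    unfolding zt_def by (simp only: hmon_mult_hconst_eq_0_iff not_False_eq_True)
  thus ?thesis by (simp add: U_def gg_def mult_ac)
qed

lemma ZZ_nz:
  assumes "t \<ge> 1" shows "ZZ t \<noteq> 0"
  using assms
proof (cases rule: fin_cases)
  case (fin r)
  thus ?thesis using zt_Ug_nz[of 0 r t] unfolding fin ZZ_fin by simp
next
  case (inf r j)
  have "((-1) ^ j :: 'f coef) = 1 \<or> ((-1) ^ j :: 'f coef) = - 1" by (cases "even j") auto
  thus ?thesis unfolding inf ZZ_inf[OF inf(2,3)] using zt_Ug_nz[of "ps - j" "Suc r" "r * ps + 1 + j"]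
    by auto
qed

section \<open>Brackets of monomials in the model\<close>

abbreviation mb (infixl \<open>\<oslash>\<close> 80) where "mb \<equiv> mbr ps"

text \<open>The generators are \<open>\<zeta>\<close> and \<open>\<xi>^(q-1) g\<close>. Bracketing
  with the first is differentiation along \<open>\<xi>\<close>, so each \<open>x\<close> lowers the
  exponent of \<open>\<xi>\<close> by one.\<close>

definition XX :: "'f coef hurwitz" where "XX = me 0 (zt 1)"
definition YY :: "'f coef hurwitz" where "YY = me (q - 1) gg"

lemma mb_me: "me i a \<oslash> me k b =
    (if i = 0 then 0 else me (i - 1) a * me k (D b)) - (if k = 0 then 0 else me i (D a) * me (k - 1) b)"
  by (simp add: mbr_def d1_me d2_me)

lemma mb_XX: "me i a \<oslash> XX = (if i = 0 then 0 else me (i - 1) a)"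
  unfolding XX_def mb_me D_zt by (simp add: me_mult)

lemma me_q1: "0 < i \<Longrightarrow> i < q \<Longrightarrow> me i a * me (q - 1) b = (0 :: 'f coef hurwitz)"
proof -
  assume i: "0 < i" "i < q"
  have "of_nat (Suc i + (q - 1) - 1 choose (q - 1)) = ((-1) ^ (q - 1) * of_nat (p ^ e - Suc i choose (q - 1)) :: 'f)"
    by (rule of_nat_choose_neg[OF prime char]) (use i in \<open>auto simp: q\<close>)
  hence "of_nat (i + (q - 1) choose (q - 1)) = (0::'f)" using i q by (simp add: binomial_eq_0)
  hence "of_nat (i + (q - 1) choose i) = (0::'f)"
    using binomial_symmetric[of i "i + (q - 1)"] by simp
  thus ?thesis unfolding me_mult by (simp only: of_nat_model_eq_0 mult_zero_left)
qed

text \<open>Differentiating the vanishing product of \<open>me_q1\<close> along \<open>\<xi>\<close>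
  spares another evaluation of binomials.\<close>

lemma me_q2: "0 < i \<Longrightarrow> i < q \<Longrightarrow>
    me i a * me (q - 2) b = (if i = 1 then - me (q - 1) (a * b) else 0 :: 'f coef hurwitz)"
proof -
  assume i: "0 < i" "i < q"
  have "d1 (me i a * me (q - 1) b) = 0"
    unfolding me_q1[OF i] by (rule derivation_0[OF derivation_d1])
  hence "me i a * me (q - 2) b = - (me (i - 1) a * me (q - 1) b)"
    unfolding derivation_mult[OF derivation_d1] d1_me using i q5
    by (simp add: eq_neg_iff_add_eq_0 add.commute numeral_2_eq_2)
  thus ?thesis using me_q1[of "i - 1" a b] i by (auto simp: me_mult)
qed

text \<open>Bracketing with \<open>y\<close> is nonzero only on the exponents \<open>1\<close> and
  \<open>0\<close> of \<open>\<xi>\<close>, those of \<open>w t\<close> and \<open>[w t x]\<close>;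
  everything along a chain is annihilated.\<close>

lemma mb_YY:
  assumes "i < q"
  shows "me i c \<oslash> YY =
    (if i = 0 then - me (q - 2) (D c * gg) else if i = 1 then me (q - 1) (D (c * gg)) else 0)"
proof -
  have "q - 1 \<noteq> 0" "q - 1 - 1 = q - 2" using q5 by simp_all
  thus ?thesis
    unfolding YY_def mb_me using assms me_q1[of "i - 1"] me_q2[of i]
    by (auto simp: me_mult derivation_mult[OF derivation_dz] me_add)
qed

lemma mb_W: "me i c \<oslash> me 1 b = me i (of_nat i * c * D b - D c * b)"
proof (cases i)
  case (Suc j)
  have "me j c * me 1 (D b) = me i (of_nat i * c * D b)"
    unfolding me_mult by (simp add: Suc me_of_nat mult_ac del: of_nat_Suc)
  moreover have "me i (D c) * me 0 b = me i (D c * b)"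
    by (simp add: me_mult)
  ultimately show ?thesis unfolding mb_me by (simp add: Suc me_diff del: of_nat_Suc)
qed (simp add: mb_me me_mult me_minus)

end

section \<open>Lie algebras generated by two elements\<close>

locale gen_lie = total_lie scale br
  for scale :: "'f::field \<Rightarrow> 'a::ab_group_add \<Rightarrow> 'a" (infixr \<open>*s\<close> 75)
    and br :: "'a \<Rightarrow> 'a \<Rightarrow> 'a" (infixl \<open>\<diamondop>\<close> 80) +
  fixes x y :: 'a
begin

lemma pw_split: "m \<le> n \<Longrightarrow> pw a b n = pw (pw a b m) b (n - m)"
  by (simp add: pw_pw)

primrec ev :: "('f, gen) lie_term \<Rightarrow> 'a" where
  "ev (Gen g) = (case g of Gen_x \<Rightarrow> x | Gen_y \<Rightarrow> y)"
| "ev Zero = 0"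
| "ev (Add t u) = ev t + ev u"
| "ev (Scale c t) = c *s ev t"
| "ev (Br t u) = ev t \<diamondop> ev u"

section \<open>The generated subalgebra and its centre\<close>

definition N :: "'a set" where "N = range ev"
definition comp :: "nat \<Rightarrow> 'a set" where "comp m = ev ` {t. homogeneous m t}"
text \<open>Annihilation by the two generators amounts to centrality inside \<open>N\<close>. Taking
  \<open>Z\<close> in the whole type spares membership conditions.\<close>

definition Z :: "'a set" where "Z = {z. z \<diamondop> x = 0 \<and> z \<diamondop> y = 0}"

lemma N_x [simp]: "x \<in> N" and N_y [simp]: "y \<in> N" and N_0 [simp]: "0 \<in> N"
  unfolding N_def
  by (rule range_eqI[of _ _ "Gen Gen_x"], simp) (rule range_eqI[of _ _ "Gen Gen_y"], simp,
      rule range_eqI[of _ _ "Zero"], simp)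

lemma N_add [simp]: "a \<in> N \<Longrightarrow> b \<in> N \<Longrightarrow> a + b \<in> N"
  unfolding N_def by (auto simp flip: ev.simps(3))

lemma N_scale [simp]: "a \<in> N \<Longrightarrow> c *s a \<in> N"
  unfolding N_def by (auto simp flip: ev.simps(4))

lemma N_br [simp]: "a \<in> N \<Longrightarrow> b \<in> N \<Longrightarrow> a \<diamondop> b \<in> N"
  unfolding N_def by (auto simp flip: ev.simps(5))

lemma N_minus [simp]: "a \<in> N \<Longrightarrow> - a \<in> N"
  using N_scale[of a "- 1"] by simp

lemma N_pw [simp]: "a \<in> N \<Longrightarrow> b \<in> N \<Longrightarrow> pw a b n \<in> N"
  by (induction n) (auto simp: pw_Suc)

lemma Z_0 [simp]: "0 \<in> Z"
  and Z_add [simp]: "a \<in> Z \<Longrightarrow> b \<in> Z \<Longrightarrow> a + b \<in> Z"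
  and Z_diff [simp]: "a \<in> Z \<Longrightarrow> b \<in> Z \<Longrightarrow> a - b \<in> Z"
  and Z_minus [simp]: "a \<in> Z \<Longrightarrow> - a \<in> Z"
  and Z_scale [simp]: "a \<in> Z \<Longrightarrow> c *s a \<in> Z"
  by (auto simp: Z_def br_linear)

lemma Z_br:
  assumes "z \<in> Z" "a \<in> N" shows "z \<diamondop> a = 0"
proof -
  have "z \<diamondop> ev t = 0" if "z \<in> Z" for z t
    using that
  proof (induction t arbitrary: z)
    case (Gen g)
    thus ?case by (cases g) (auto simp: Z_def)
  next
    case (Br t u)
    thus ?case by (simp add: br_br)
  qed (auto simp: br_linear)
  thus ?thesis using assms by (auto simp: N_def)
qed

lemma Z_br': "z \<in> Z \<Longrightarrow> a \<in> N \<Longrightarrow> a \<diamondop> z = 0"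
  using Z_br br_anti[of a z] by simp

lemma Z_x [simp]: "z \<in> Z \<Longrightarrow> z \<diamondop> x = 0" and Z_y [simp]: "z \<in> Z \<Longrightarrow> z \<diamondop> y = 0"
  by (auto simp: Z_def)

lemma Z_pw: "z \<in> Z \<Longrightarrow> 0 < n \<Longrightarrow> pw z x n = 0"
  by (cases n) (auto simp: pw_Suc_left)

lemma Z_cong: "a - b \<in> Z \<Longrightarrow> c \<in> N \<Longrightarrow> a \<diamondop> c = b \<diamondop> c"
  using Z_br[of "a - b" c] by (simp add: br_linear)

lemma Z_cong': "a - b \<in> Z \<Longrightarrow> c \<in> N \<Longrightarrow> c \<diamondop> a = c \<diamondop> b"
  using Z_br'[of "a - b" c] by (simp add: br_linear)

lemma Z_cong_pw: "a - b \<in> Z \<Longrightarrow> 0 < n \<Longrightarrow> pw a x n = pw b x n"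
  using Z_pw[of "a - b" n] by (simp add: pw_diff)

section \<open>Homogeneous components\<close>

lemma comp_N: "a \<in> comp m \<Longrightarrow> a \<in> N"
  by (auto simp: comp_def N_def)

lemma comp_x: "x \<in> comp 1" and comp_y: "y \<in> comp 1" and comp_zero [simp]: "0 \<in> comp m"
  unfolding comp_def
  by (rule image_eqI[of _ _ "Gen Gen_x"], simp, simp add: homogeneous.intros del: One_nat_def)
    (rule image_eqI[of _ _ "Gen Gen_y"], simp, simp add: homogeneous.intros del: One_nat_def,
     rule image_eqI[of _ _ "Zero"], simp, simp add: homogeneous.intros)

lemma comp_add: "a \<in> comp m \<Longrightarrow> b \<in> comp m \<Longrightarrow> a + b \<in> comp m"
  unfolding comp_def by (auto intro!: image_eqI[of _ _ "Add _ _"] homogeneous.intros)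

lemma comp_scale: "a \<in> comp m \<Longrightarrow> c *s a \<in> comp m"
  unfolding comp_def by (auto intro!: image_eqI[of _ _ "Scale _ _"] homogeneous.intros)

lemma comp_minus: "a \<in> comp m \<Longrightarrow> - a \<in> comp m"
  using comp_scale[of a m "- 1"] by simp

lemma comp_diff: "a \<in> comp m \<Longrightarrow> b \<in> comp m \<Longrightarrow> a - b \<in> comp m"
  using comp_add[of a m "- b"] comp_minus by simp

lemma comp_br: "a \<in> comp m \<Longrightarrow> b \<in> comp n \<Longrightarrow> a \<diamondop> b \<in> comp (m + n)"
  unfolding comp_def by (auto intro!: image_eqI[of _ _ "Br _ _"] homogeneous.intros)

lemma comp_br_x: "a \<in> comp m \<Longrightarrow> a \<diamondop> x \<in> comp (Suc m)"
  and comp_br_y: "a \<in> comp m \<Longrightarrow> a \<diamondop> y \<in> comp (Suc m)"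
  using comp_br[OF _ comp_x, of a m] comp_br[OF _ comp_y, of a m] by simp_all

lemma comp_pw: "a \<in> comp m \<Longrightarrow> pw a x n \<in> comp (m + n)"
  by (induction n) (auto simp: pw_Suc comp_br_x)

text \<open>\<open>Zero\<close> is homogeneous of every degree, so there are terms of degree 0; but
  all of them are built from \<open>Zero\<close> in every branch that matters, since a generator has
  degree 1.\<close>

lemma homogeneous_0: "homogeneous m t \<Longrightarrow> m = 0 \<Longrightarrow> ev t = 0"
  by (induction rule: homogeneous.induct) auto

lemma comp_0: "a \<in> comp 0 \<Longrightarrow> a = 0"
  using homogeneous_0 by (auto simp: comp_def)

lemma homogeneous_1: "homogeneous m t \<Longrightarrow> m = 1 \<Longrightarrow> \<exists>c d. ev t = c *s x + d *s y"
proof (induction rule: homogeneous.induct)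
  case (1 g)
  have "x = 1 *s x + 0 *s y" "y = 0 *s x + 1 *s y" by simp_all
  thus ?case by (cases g) (metis ev.simps(1) gen.case)+
next
  case (2 n)
  have "0 = 0 *s x + 0 *s y" by simp
  thus ?case by (metis ev.simps(2))
next
  case (3 n t u)
  then obtain c d c' d' where "ev t = c *s x + d *s y" "ev u = c' *s x + d' *s y" by auto
  hence "ev (Add t u) = (c + c') *s x + (d + d') *s y"
    by (simp add: scale_left_distrib)
  thus ?case by blast
next
  case (4 n t c)
  then obtain a b where "ev t = a *s x + b *s y" by auto
  hence "ev (Scale c t) = (c * a) *s x + (c * b) *s y" by (simp add: scale_right_distrib)
  thus ?case by blast
next
  case (5 m t n u)
  hence "m = 0 \<or> n = 0" by auto
  hence "ev (t \<cdot> u) = 0 *s x + 0 *s y"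
    using 5 homogeneous_0 by auto
  thus ?case by blast
qed

lemma comp_1: "a \<in> comp 1 \<Longrightarrow> \<exists>c d. a = c *s x + d *s y"
  using homogeneous_1 by (auto simp: comp_def)

section \<open>Each degree obtained from the previous one\<close>

definition dec :: "nat \<Rightarrow> 'a set" where
  "dec m = {b \<diamondop> x + c \<diamondop> y |b c. b \<in> comp m \<and> c \<in> comp m}"

lemma dec_add: "a \<in> dec m \<Longrightarrow> b \<in> dec m \<Longrightarrow> a + b \<in> dec m"
proof -
  assume "a \<in> dec m" "b \<in> dec m"
  then obtain a1 a2 b1 b2 where "a1 \<in> comp m" "a2 \<in> comp m" "b1 \<in> comp m" "b2 \<in> comp m"
    "a = a1 \<diamondop> x + a2 \<diamondop> y" "b = b1 \<diamondop> x + b2 \<diamondop> y" by (auto simp: dec_def)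
  moreover from this have "a + b = (a1 + b1) \<diamondop> x + (a2 + b2) \<diamondop> y" by (simp add: br_linear)
  ultimately show ?thesis using comp_add unfolding dec_def by blast
qed

lemma dec_scale: "a \<in> dec m \<Longrightarrow> k *s a \<in> dec m"
proof -
  assume "a \<in> dec m"
  then obtain a1 a2 where "a1 \<in> comp m" "a2 \<in> comp m" "a = a1 \<diamondop> x + a2 \<diamondop> y"
    by (auto simp: dec_def)
  moreover from this have "k *s a = (k *s a1) \<diamondop> x + (k *s a2) \<diamondop> y"
    by (simp add: br_linear scale_right_distrib)
  ultimately show ?thesis using comp_scale unfolding dec_def by blast
qed

lemma dec_diff: "a \<in> dec m \<Longrightarrow> b \<in> dec m \<Longrightarrow> a - b \<in> dec m"
  using dec_add[of a m "- b"] dec_scale[of b m "- 1"] by simp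

lemma dec_x: "a \<in> comp m \<Longrightarrow> a \<diamondop> x \<in> dec m"
  unfolding dec_def by (rule CollectI, rule exI[of _ a], rule exI[of _ 0]) simp

lemma dec_y: "a \<in> comp m \<Longrightarrow> a \<diamondop> y \<in> dec m"
  unfolding dec_def by (rule CollectI, rule exI[of _ 0], rule exI[of _ a]) simp

text \<open>The right factor is shortened by \<open>[a [b x]] = [a b x] - [a x b]\<close>, which
  moves a generator to the end or into the left factor.\<close>

lemma comp_dec_br:
  assumes "\<And>j b. j < n \<Longrightarrow> b \<in> comp (Suc (Suc j)) \<Longrightarrow> b \<in> dec (Suc j)"
  shows "a \<in> comp m \<Longrightarrow> b \<in> comp (Suc n) \<Longrightarrow> a \<diamondop> b \<in> dec (m + n)"
  using assms
proof (induction n arbitrary: a b m)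
  case 0
  then obtain c d where "b = c *s x + d *s y" using comp_1[of b] by auto
  hence "a \<diamondop> b = c *s (a \<diamondop> x) + d *s (a \<diamondop> y)" by (simp add: br_linear)
  thus ?case using 0 by (simp add: dec_add dec_scale dec_x dec_y)
next
  case (Suc n)
  have "b \<in> dec (Suc n)" using Suc.prems(2,3) by blast
  then obtain b1 b2 where b: "b1 \<in> comp (Suc n)" "b2 \<in> comp (Suc n)" "b = b1 \<diamondop> x + b2 \<diamondop> y"
    by (auto simp: dec_def)
  have e: "a \<diamondop> b = (a \<diamondop> b1 \<diamondop> x - a \<diamondop> x \<diamondop> b1) + (a \<diamondop> b2 \<diamondop> y - a \<diamondop> y \<diamondop> b2)"
    unfolding b(3) by (simp add: br_linear br_br)
  have "a \<diamondop> b1 \<in> comp (m + Suc n)" "a \<diamondop> b2 \<in> comp (m + Suc n)"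
    using comp_br[OF Suc.prems(1) b(1)] comp_br[OF Suc.prems(1) b(2)] by simp_all
  moreover have "a \<diamondop> x \<diamondop> b1 \<in> dec (Suc m + n)" "a \<diamondop> y \<diamondop> b2 \<in> dec (Suc m + n)"
    by (rule Suc.IH; use Suc.prems b comp_br_x comp_br_y in auto)+
  ultimately show ?case unfolding e by (auto intro!: dec_add dec_diff dec_x dec_y)
qed

text \<open>An algebra generated in degree 1 is spanned by left-normed products of the
  generators.\<close>

lemma comp_dec: "a \<in> comp (Suc (Suc m)) \<Longrightarrow> a \<in> dec (Suc m)"
proof (induction m arbitrary: a rule: less_induct)
  case (less m)
  have "ev t \<in> dec (Suc m)" if "homogeneous k t" "k = Suc (Suc m)" for k t
    using that
  proof (induction rule: homogeneous.induct)
    case (2 n)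
    thus ?case using dec_x[of 0] by simp
  next
    case (5 i t j u)
    show ?case
    proof (cases "i = 0 \<or> j = 0")
      case True
      thus ?thesis using 5 homogeneous_0 dec_x[of 0] by auto
    next
      case False
      then obtain j' where j: "j = Suc j'" using not0_implies_Suc by blast
      have "ev t \<diamondop> ev u \<in> dec (i + j')"
      proof (rule comp_dec_br)
        show "ev t \<in> comp i" "ev u \<in> comp (Suc j')" using 5 j by (auto simp: comp_def)
        show "b \<in> dec (Suc k)" if "k < j'" "b \<in> comp (Suc (Suc k))" for k b
          using less(1)[of k b] that 5(5) False j by auto
      qed
      thus ?thesis using 5(5) j by simp
    qed
  qed (auto intro: dec_add dec_scale)
  thus ?case using less(2) by (auto simp: comp_def)
qed

end

section \<open>Expansions along chains\<close>

text \<open>Here \<open>vv k\<close> stands for \<open>v_k\<close> of the presentation, and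
  \<open>ph\<close> is a homomorphism into the model, which is supplied at the end by evaluating
  terms there.\<close>

locale nott = gen_lie scale br x y + model p q s e del
  for scale :: "'f::field \<Rightarrow> 'a::ab_group_add \<Rightarrow> 'a" (infixr \<open>*s\<close> 75)
    and br :: "'a \<Rightarrow> 'a \<Rightarrow> 'a" (infixl \<open>\<diamondop>\<close> 80) and x y and p q s e :: nat and del :: 'f +
  fixes lam :: 'f and vv :: "nat \<Rightarrow> 'a" and ph :: "'a \<Rightarrow> 'f coef hurwitz"
  assumes del: "del = lam + 1" and lam: "lam \<noteq> 0"
    and vv: "vv 1 = pw y x (q - 2)" "\<And>k. vv (Suc (Suc k)) = pw (vv (Suc k) \<diamondop> x \<diamondop> y) x (q - 3)"
    and rel_y: "\<And>i. 0 < i \<Longrightarrow> i < q - 2 \<Longrightarrow> pw y x i \<diamondop> y = 0"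
    and rel_v: "vv 1 \<diamondop> x \<diamondop> x = 0" "vv 1 \<diamondop> y \<diamondop> y = 0" "vv 1 \<diamondop> y \<diamondop> x = (- 2) *s (vv 1 \<diamondop> x \<diamondop> y)"
    and rel_vy: "\<And>i. 0 < i \<Longrightarrow> i < q - 2 \<Longrightarrow> pw (vv 1 \<diamondop> y) x i \<diamondop> y = 0"
    and rel_even: "\<And>k. 2 \<le> k \<Longrightarrow> k \<le> p ^ s \<Longrightarrow> even k \<Longrightarrow> vv k \<diamondop> y \<diamondop> x + vv k \<diamondop> x \<diamondop> y = 0"
    and rel_lam: "lam *s (vv (p ^ s + 1) \<diamondop> y \<diamondop> x) = (1 - lam) *s (vv (p ^ s + 1) \<diamondop> x \<diamondop> y)"
    and ph_x: "ph x = XX" and ph_y: "ph y = YY"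
    and ph_add: "\<And>a b. ph (a + b) = ph a + ph b"
    and ph_scale: "\<And>c a. ph (c *s a) = mscale c (ph a)"
    and ph_br: "\<And>a b. ph (a \<diamondop> b) = mbr ps (ph a) (ph b)"
begin

text \<open>The \<open>w t\<close> agree with the \<open>vv t\<close> of the presentation up to sign as long as the latter are
  constrained; for diamonds of finite type a different \<open>u t\<close> is needed, since \<open>[w\<^sub>t x y]\<close> may vanish.\<close>

definition v :: 'a where v_eq: "v = pw y x (q - 2)"

lemma vv_1: "vv 1 = v"
  using vv(1) by (simp add: v_eq)

lemmas v_rel = rel_v[unfolded vv_1]
lemmas vy_rel = rel_vy[unfolded vv_1]

definition uf :: "nat \<Rightarrow> 'a \<Rightarrow> 'a" where
  "uf t a = (if t = 0 then y \<diamondop> x else if fin t then a \<diamondop> x \<diamondop> y + a \<diamondop> y \<diamondop> x else a \<diamondop> x \<diamondop> y)"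

text \<open>The recursion starts from \<open>u 0 = [y x]\<close>, since \<open>uf 0\<close> ignores
  its second argument, and so gives \<open>w 1 = v\<close>.\<close>

primrec w :: "nat \<Rightarrow> 'a" where
  "w 0 = 0"
| "w (Suc t) = pw (uf t (w t)) x (q - 3)"

definition u :: "nat \<Rightarrow> 'a" where "u t = uf t (w t)"

lemma w_Suc: "w (Suc t) = pw (u t) x (q - 3)"
  by (simp add: u_def)

lemma N_w [simp]: "w t \<in> N"
  by (induction t) (auto simp: uf_def)

lemma N_u [simp]: "u t \<in> N"
  by (auto simp: u_def uf_def)

lemma w_1: "w 1 = v"
proof -
  have "q - 2 = Suc (q - 3)" using q5 by simp
  thus ?thesis by (simp add: uf_def pw_Suc_left v_eq)
qed

declare w.simps(2) [simp del]

lemma N_v [simp]: "v \<in> N"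
  using N_w[of 1] unfolding w_1 .

lemma odd_q: "odd q"
  using prime p3 prime_odd_nat[of p] by (simp add: q)

lemma sgn_q: "(- 1) ^ (q - 2) = (- 1 :: 'f)" "(- 1) ^ (q - 3) = (1 :: 'f)" "(- 1) ^ (q - 4) = (- 1 :: 'f)"
proof -
  obtain k where "q = 2 * k + 1" using odd_q oddE by blast
  then obtain k where "q = 2 * k + 7" using q5 by (intro that[of "k - 3"]) simp
  hence "q - 2 = Suc (2 * (k + 2))" "q - 3 = 2 * (k + 2)" "q - 4 = Suc (2 * (k + 1))" by simp_all
  thus "(- 1) ^ (q - 2) = (- 1 :: 'f)" "(- 1) ^ (q - 3) = (1 :: 'f)" "(- 1) ^ (q - 4) = (- 1 :: 'f)"
    by (simp_all only: power_Suc power_mult power2_minus) simp_all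
qed

lemma of_nat_q2: "of_nat (q - 2) = (- 2 :: 'f)"
  using q5 q_0 of_nat_diff[of 2 q, where 'a = 'f] by simp

text \<open>This is \<open>(-2)(-3)/2\<close>, as \<open>q\<close> vanishes in the field.\<close>

lemma choose_q2_2: "of_nat (q - 2 choose 2) = (3 :: 'f)"
proof -
  have "of_nat (2 + 2 - 1 choose 2) = ((-1) ^ 2 * of_nat (p ^ e - 2 choose 2) :: 'f)"
    by (rule of_nat_choose_neg[OF prime char]) (use q5 in \<open>auto simp: q\<close>)
  thus ?thesis by (simp add: q numeral_3_eq_3 numeral_2_eq_2)
qed

lemma choose_q2: "(q - 2 choose (q - 3)) = q - 2" "(q - 2 choose (q - 4)) = (q - 2 choose 2)"
proof -
  have e: "q - 2 = Suc (q - 3)" "q - 4 = q - 2 - 2" "2 \<le> q - 2" using q5 by simp_all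
  show "(q - 2 choose (q - 3)) = q - 2" unfolding e(1) by (rule binomial_Suc_n)
  show "(q - 2 choose (q - 4)) = (q - 2 choose 2)"
    unfolding e(2) by (rule binomial_symmetric[OF e(3), symmetric])
qed

lemma two_nz: "(2::'f) \<noteq> 0" and three_nz: "(3::'f) \<noteq> 0"
proof -
  have "\<not> p dvd 2" "\<not> p dvd 3" using p3 by (auto dest: dvd_imp_le)
  hence "of_nat 2 \<noteq> (0::'f)" "of_nat 3 \<noteq> (0::'f)"
    using char by (simp_all only: of_nat_eq_0_iff_char_dvd not_False_eq_True)
  thus "(2::'f) \<noteq> 0" "(3::'f) \<noteq> 0" by simp_all
qed

lemma scale_numeral: "2 *s a = a + a" "3 *s a = a + a + a" "(2 * c) *s a = c *s a + c *s a"
  using scale_left_distrib[of 1 1 a] scale_left_distrib[of 2 1 a] scale_left_distrib[of c c a]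
  by simp_all

lemmas lin = br_linear scale_left_distrib scale_left_diff_distrib scale_right_distrib
  scale_right_diff_distrib scale_numeral

text \<open>The bound \<open>q - 3\<close> marks the next \<open>w\<close>: for
  \<open>a = u t\<close> the element \<open>[a x^(q-3)]\<close> is \<open>w (Suc t)\<close>, just
  below the next diamond.\<close>

definition chain :: "'a \<Rightarrow> bool" where
  "chain a \<longleftrightarrow> a \<in> N \<and> (\<forall>i<q - 3. pw a x i \<diamondop> y \<in> Z)"

text \<open>In the expansion \<open>br_pw\<close> every term below the top of the chain contains a
  central \<open>[a x^i y]\<close> followed by at least one \<open>x\<close>, and so
  vanishes.\<close>

lemma chain_br:
  assumes "chain a" "l + n = q - 3" "n \<le> k"
  shows "pw a x l \<diamondop> pw y x k =
    (\<Sum>j\<in>{n..k}. ((-1) ^ j * of_nat (k choose j)) *s pw (pw (pw a x (q - 3)) x (j - n) \<diamondop> y) x (k - j))"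
proof -
  have "pw a x l \<diamondop> pw y x k =
    (\<Sum>j\<le>k. ((-1) ^ j * of_nat (k choose j)) *s pw (pw (pw a x l) x j \<diamondop> y) x (k - j))"
    by (rule br_pw)
  also have "\<dots> = (\<Sum>j\<in>{n..k}. ((-1) ^ j * of_nat (k choose j)) *s pw (pw (pw a x l) x j \<diamondop> y) x (k - j))"
  proof (intro sum.mono_neutral_right ballI)
    fix j assume j: "j \<in> {..k} - {n..k}"
    hence "pw (pw a x l) x j \<diamondop> y \<in> Z" using assms unfolding pw_pw chain_def by auto
    moreover have "0 < k - j" using j assms(3) by auto
    ultimately show "((-1) ^ j * of_nat (k choose j)) *s pw (pw (pw a x l) x j \<diamondop> y) x (k - j) = 0"
      using Z_pw by simp
  qed auto
  also have "\<dots> = (\<Sum>j\<in>{n..k}. ((-1) ^ j * of_nat (k choose j)) *s pw (pw (pw a x (q - 3)) x (j - n) \<diamondop> y) x (k - j))"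
  proof (rule sum.cong[OF HOL.refl])
    fix j assume j: "j \<in> {n..k}"
    hence "l + j = q - 3 + (j - n)" using assms by auto
    thus "((-1) ^ j * of_nat (k choose j)) *s pw (pw (pw a x l) x j \<diamondop> y) x (k - j) =
      ((-1) ^ j * of_nat (k choose j)) *s pw (pw (pw a x (q - 3)) x (j - n) \<diamondop> y) x (k - j)"
      by (simp only: pw_pw)
  qed
  finally show ?thesis .
qed

text \<open>Two terms remain if \<open>[w x x]\<close> is central, or if the sum has just two terms,
  for \<open>k = Suc n\<close>; the second alternative is available before \<open>[w x x]\<close> is
  understood.\<close>

lemma chain_br2:
  assumes "chain a" "l + n = q - 3" "n < k" "k = Suc n \<or> pw a x (q - 3) \<diamondop> x \<diamondop> x \<in> Z"
  shows "pw a x l \<diamondop> pw y x k =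
    ((-1) ^ n * of_nat (k choose n)) *s pw (pw a x (q - 3) \<diamondop> y) x (k - n) -
    ((-1) ^ n * of_nat (k choose Suc n)) *s pw (pw a x (q - 3) \<diamondop> x \<diamondop> y) x (k - Suc n)"
proof -
  let ?b = "pw a x (q - 3)"
  have "a \<in> N" using assms by (simp add: chain_def)
  have "pw a x l \<diamondop> pw y x k =
    (\<Sum>j\<in>{n..k}. ((-1) ^ j * of_nat (k choose j)) *s pw (pw ?b x (j - n) \<diamondop> y) x (k - j))"
    using assms by (intro chain_br) auto
  also have "\<dots> = (\<Sum>j\<in>{n, Suc n}. ((-1) ^ j * of_nat (k choose j)) *s pw (pw ?b x (j - n) \<diamondop> y) x (k - j))"
  proof (intro sum.mono_neutral_right ballI)
    fix j assume j: "j \<in> {n..k} - {n, Suc n}"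
    then obtain i where i: "j - n = Suc (Suc i)" by (cases "j - n"; cases "j - n - 1") auto
    have "?b \<diamondop> x \<diamondop> x \<in> Z" using assms(4) j by auto
    hence "pw ?b x (j - n) \<diamondop> y = 0"
      unfolding i pw_Suc_left by (cases "i = 0") (auto simp: Z_pw)
    thus "((-1) ^ j * of_nat (k choose j)) *s pw (pw ?b x (j - n) \<diamondop> y) x (k - j) = 0" by simp
  qed (use assms in auto)
  finally show ?thesis by (simp add: pw_Suc)
qed

lemma chain_wyy:
  assumes "chain a" shows "pw a x (q - 3) \<diamondop> y \<diamondop> y = 0"
proof -
  have a: "a \<in> N" "a \<diamondop> y \<in> Z" using assms q5 by (auto simp: chain_def dest: spec[of _ 0])
  have "pw a x 0 \<diamondop> pw y x (q - 3) = (\<Sum>j\<in>{q - 3..q - 3}. ((-1) ^ j * of_nat (q - 3 choose j)) *s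
      pw (pw (pw a x (q - 3)) x (j - (q - 3)) \<diamondop> y) x (q - 3 - j))"
    using assms by (intro chain_br) auto
  hence 1: "a \<diamondop> pw y x (q - 3) = pw a x (q - 3) \<diamondop> y" using sgn_q(2) by simp
  have "0 = a \<diamondop> (pw y x (q - 3) \<diamondop> y)" using rel_y[of "q - 3"] q5 by simp
  also have "\<dots> = a \<diamondop> pw y x (q - 3) \<diamondop> y - a \<diamondop> y \<diamondop> pw y x (q - 3)" by (rule br_br)
  also have "a \<diamondop> y \<diamondop> pw y x (q - 3) = 0" using a by (intro Z_br) auto
  finally show ?thesis unfolding 1 by simp
qed

text \<open>An inner element of the chain is bracketed with the relation
  \<open>[y x^k y] = 0\<close>. Varying \<open>n\<close> while \<open>k - n\<close> is fixed gives
  many equations for the same two products, with different binomials.\<close>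

lemma chain_rel:
  assumes "chain a" "l + n = q - 3" "0 < n" "n < k" "k < q - 2"
    "k = Suc n \<or> pw a x (q - 3) \<diamondop> x \<diamondop> x \<in> Z"
  shows "of_nat (k choose n) *s (pw (pw a x (q - 3) \<diamondop> y) x (k - n) \<diamondop> y) =
    of_nat (k choose Suc n) *s (pw (pw a x (q - 3) \<diamondop> x \<diamondop> y) x (k - Suc n) \<diamondop> y)"
proof -
  have "l < q - 3" using assms by auto
  hence a: "a \<in> N" "pw a x l \<diamondop> y \<in> Z" using assms by (auto simp: chain_def)
  have "0 = pw a x l \<diamondop> (pw y x k \<diamondop> y)" using rel_y[of k] assms by simp
  also have "\<dots> = pw a x l \<diamondop> pw y x k \<diamondop> y - pw a x l \<diamondop> y \<diamondop> pw y x k" by (rule br_br)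
  also have "pw a x l \<diamondop> y \<diamondop> pw y x k = 0" using a by (intro Z_br) auto
  also have "pw a x l \<diamondop> pw y x k = (-1) ^ n *s
    (of_nat (k choose n) *s pw (pw a x (q - 3) \<diamondop> y) x (k - n) -
     of_nat (k choose Suc n) *s pw (pw a x (q - 3) \<diamondop> x \<diamondop> y) x (k - Suc n))"
    unfolding chain_br2[OF assms(1,2,4,6)] by (simp add: scale_right_diff_distrib)
  finally show ?thesis by (simp add: br_linear)
qed

text \<open>The cases \<open>k = 2, n = 1\<close> and \<open>k = 3, n = 2\<close> read
  \<open>2 Q = P\<close> and \<open>3 Q = P\<close>. The second requires \<open>3 < q - 2\<close>,
  that is \<open>q > 5\<close>.\<close>

lemma chain_wxyy:
  assumes "chain a"
  shows "pw a x (q - 3) \<diamondop> y \<diamondop> x \<diamondop> y = 0" "pw a x (q - 3) \<diamondop> x \<diamondop> y \<diamondop> y = 0"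
proof -
  let ?P = "pw a x (q - 3) \<diamondop> x \<diamondop> y \<diamondop> y" and ?Q = "pw a x (q - 3) \<diamondop> y \<diamondop> x \<diamondop> y"
  have "of_nat (2 choose 1) *s ?Q = of_nat (2 choose 2) *s ?P"
    using chain_rel[OF assms, of "q - 4" 1 2] q5 by (simp add: pw_Suc numeral_2_eq_2)
  moreover have "of_nat (3 choose 2) *s ?Q = of_nat (3 choose 3) *s ?P"
    using chain_rel[OF assms, of "q - 5" 2 3] q5 odd_q by (simp add: pw_Suc numeral_2_eq_2 numeral_3_eq_3)
  ultimately have "2 *s ?Q = ?P" "3 *s ?Q = ?P"
    by (simp_all add: numeral_2_eq_2 numeral_3_eq_3)
  moreover have "3 *s ?Q = 2 *s ?Q + ?Q"
    using scale_left_distrib[of 2 1 ?Q] by simp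
  ultimately show "?Q = 0" "?P = 0" by simp_all
qed

section \<open>Diamonds and the action of v\<close>

definition A :: "nat \<Rightarrow> 'a" where "A t = w t \<diamondop> x \<diamondop> x"
definition P :: "nat \<Rightarrow> 'a" where "P t = w t \<diamondop> x \<diamondop> y"
definition Q :: "nat \<Rightarrow> 'a" where "Q t = w t \<diamondop> y \<diamondop> x"
definition Sg :: "nat \<Rightarrow> 'a" where "Sg t = P t + Q t"

text \<open>The induction hypothesis on the \<open>t\<close>-th diamond. For finite types the
  coordinates along \<open>u t\<close> are exact and not only modulo \<open>Z\<close>; from this a
  fake diamond gets its central \<open>[w x]\<close> or \<open>[w y]\<close>.\<close>

definition good :: "nat \<Rightarrow> bool" where
  "good t \<longleftrightarrow> t \<ge> 1 \<and> A t \<in> Z \<and> w t \<diamondop> y \<diamondop> y = 0 \<and> P t - al t *s u t \<in> Z \<and> Q t - be t *s u t \<in> Z \<and>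
     (fin t \<longrightarrow> P t = al t *s u t \<and> Q t = be t *s u t) \<and>
     (al t = 0 \<longrightarrow> w t \<diamondop> x \<in> Z) \<and> (be t = 0 \<longrightarrow> w t \<diamondop> y \<in> Z) \<and> chain (u t)"

lemma N_PQ [simp]: "A t \<in> N" "P t \<in> N" "Q t \<in> N" "Sg t \<in> N"
  by (auto simp: A_def P_def Q_def Sg_def)

lemma goodD:
  assumes "good t"
  shows "t \<ge> 1" "A t \<in> Z" "w t \<diamondop> y \<diamondop> y = 0" "P t - al t *s u t \<in> Z" "Q t - be t *s u t \<in> Z"
    "fin t \<Longrightarrow> P t = al t *s u t" "fin t \<Longrightarrow> Q t = be t *s u t"
    "al t = 0 \<Longrightarrow> w t \<diamondop> x \<in> Z" "be t = 0 \<Longrightarrow> w t \<diamondop> y \<in> Z" "chain (u t)"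
  using assms by (auto simp: good_def)

lemma u_inf: "t \<ge> 1 \<Longrightarrow> \<not> fin t \<Longrightarrow> u t = P t"
  by (simp add: u_def uf_def P_def)

lemma u_fin: "t \<ge> 1 \<Longrightarrow> fin t \<Longrightarrow> u t = Sg t"
  by (simp add: u_def uf_def P_def Q_def Sg_def)

lemma P_br: "good t \<Longrightarrow> a \<in> N \<Longrightarrow> P t \<diamondop> a = al t *s (u t \<diamondop> a)"
  using Z_cong[OF goodD(4)] by (simp add: br_linear)

lemma Q_br: "good t \<Longrightarrow> a \<in> N \<Longrightarrow> Q t \<diamondop> a = be t *s (u t \<diamondop> a)"
  using Z_cong[OF goodD(5)] by (simp add: br_linear)

lemma P_pw: "good t \<Longrightarrow> 0 < n \<Longrightarrow> pw (P t) x n = al t *s pw (u t) x n"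
  using Z_cong_pw[OF goodD(4)] by (simp add: pw_scale)

lemma Q_pw: "good t \<Longrightarrow> 0 < n \<Longrightarrow> pw (Q t) x n = be t *s pw (u t) x n"
  using Z_cong_pw[OF goodD(5)] by (simp add: pw_scale)

text \<open>The counterpart of \<open>chain_br\<close> at the other end of the sum: if
  \<open>[a x x]\<close> is central, only the first two terms of the expansion survive.\<close>

lemma head_br:
  assumes "a \<in> N" "a \<diamondop> x \<diamondop> x \<in> Z" "b \<in> N" "0 < k"
  shows "a \<diamondop> pw b x k = pw (a \<diamondop> b) x k - of_nat k *s pw (a \<diamondop> x \<diamondop> b) x (k - 1)"
proof -
  have "a \<diamondop> pw b x k = (\<Sum>j\<in>{0, 1}. ((-1) ^ j * of_nat (k choose j)) *s pw (pw a x j \<diamondop> b) x (k - j))"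
    unfolding br_pw
  proof (intro sum.mono_neutral_right ballI)
    fix j assume j: "j \<in> {..k} - {0, 1}"
    then obtain i where i: "j = Suc (Suc i)" by (cases j; cases "j - 1") auto
    have "pw a x j \<diamondop> b = 0"
      unfolding i pw_Suc_left using assms by (cases "i = 0") (auto simp: Z_pw Z_br)
    thus "((-1) ^ j * of_nat (k choose j)) *s pw (pw a x j \<diamondop> b) x (k - j) = 0" by simp
  qed (use assms in auto)
  thus ?thesis by (simp add: pw_Suc)
qed

lemma head_br_Z:
  assumes "a \<in> N" "a \<diamondop> x \<in> Z" "b \<in> N"
  shows "a \<diamondop> pw b x k = pw (a \<diamondop> b) x k"
proof (cases "k = 0")
  case False
  have "a \<diamondop> x \<diamondop> b = 0" using assms by (intro Z_br) auto
  thus ?thesis using head_br[of a b k] False assms by simp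
qed simp

section \<open>The action of \<open>v\<close> and \<open>[v x]\<close> at a good diamond\<close>

context
  fixes t assumes g: "good t"
begin

text \<open>The coefficient is \<open>be t - (q - 2) * al t\<close>, with \<open>q = 0\<close> in
  the field.\<close>

lemma w_v: "w t \<diamondop> v = (2 * al t + be t) *s w (Suc t)"
proof -
  have e: "pw (w t \<diamondop> y) x (q - 2) = pw (Q t) x (q - 3)"
    using q5 pw_Suc_left[of "w t \<diamondop> y" x "q - 3"] by (simp add: Q_def numeral_3_eq_3 numeral_2_eq_2 Suc_diff_Suc)
  have "w t \<diamondop> v = pw (w t \<diamondop> y) x (q - 2) - of_nat (q - 2) *s pw (P t) x (q - 2 - 1)"
    unfolding v_eq P_def using goodD(2)[OF g] q5 by (intro head_br) (auto simp: A_def)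
  also have "q - 2 - 1 = q - 3" by simp
  finally show ?thesis
    unfolding e using q5 by (simp add: P_pw[OF g] Q_pw[OF g] of_nat_q2 w_Suc scale_left_distrib add.commute)
qed

lemma wx_v: "w t \<diamondop> x \<diamondop> v = al t *s (w (Suc t) \<diamondop> x)"
proof -
  have "w t \<diamondop> x \<diamondop> v = pw (P t) x (q - 2)"
    unfolding v_eq P_def using goodD(2)[OF g] by (intro head_br_Z) (auto simp: A_def)
  also have "\<dots> = al t *s pw (u t) x (Suc (q - 3))" using q5 by (simp add: P_pw[OF g] Suc_diff_Suc numeral_3_eq_3 numeral_2_eq_2)
  finally show ?thesis by (simp add: pw_Suc w_Suc)
qed

lemma wyy': "w (Suc t) \<diamondop> y \<diamondop> y = 0"
  using chain_wyy[OF goodD(10)[OF g]] by (simp add: w_Suc)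

text \<open>Only the last term of the expansion survives: by goodness the inner products
  \<open>[w y x^k y]\<close> are central, and another \<open>x\<close> follows them.\<close>

lemma wy_v: "w t \<diamondop> y \<diamondop> v = - be t *s (w (Suc t) \<diamondop> y)"
proof -
  let ?f = "\<lambda>k. ((-1) ^ k * of_nat (q - 2 choose k)) *s pw (pw (w t \<diamondop> y) x k \<diamondop> y) x (q - 2 - k)"
  have Qk: "pw (w t \<diamondop> y) x (Suc j) \<diamondop> y = be t *s (pw (u t) x j \<diamondop> y)" for j
    unfolding pw_Suc_left Q_def[symmetric]
    by (cases "j = 0") (simp_all add: Q_br[OF g] Q_pw[OF g] br_linear)
  have "w t \<diamondop> y \<diamondop> v = (\<Sum>k\<in>{..q - 2}. ?f k)" unfolding v_eq by (rule br_pw)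
  also have "\<dots> = (\<Sum>k\<in>{q - 2}. ?f k)"
  proof (intro sum.mono_neutral_right ballI)
    fix k assume k: "k \<in> {..q - 2} - {q - 2}"
    show "?f k = 0"
    proof (cases k)
      case 0
      thus ?thesis using goodD(3)[OF g] by simp
    next
      case (Suc j)
      have "pw (u t) x j \<diamondop> y \<in> Z" using goodD(10)[OF g] k Suc by (auto simp: chain_def)
      moreover have "0 < q - 2 - k" using k by auto
      ultimately show ?thesis unfolding Suc Qk by (simp add: Z_pw pw_scale)
    qed
  qed auto
  also have "\<dots> = - (pw (w t \<diamondop> y) x (Suc (q - 3)) \<diamondop> y)"
    using q5 sgn_q(1) Suc_diff_Suc[of 2 q] by simp
  finally show ?thesis unfolding Qk by (simp add: w_Suc)
qed

lemma w_vx: "w t \<diamondop> (v \<diamondop> x) = (al t + be t) *s (w (Suc t) \<diamondop> x)"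
  unfolding br_br w_v wx_v by (simp add: lin)

lemma wx_vx: "w t \<diamondop> x \<diamondop> (v \<diamondop> x) = al t *s A (Suc t)"
proof -
  have "w t \<diamondop> x \<diamondop> x \<diamondop> v = 0" using goodD(2)[OF g] by (intro Z_br) (auto simp: A_def)
  thus ?thesis unfolding br_br[of "w t \<diamondop> x"] wx_v A_def by (simp add: br_linear)
qed

end

lemma uv_gen:
  assumes c: "chain (u t)"
  shows "u t \<diamondop> v = - (2 *s Q (Suc t)) - P (Suc t)"
proof -
  have "pw (u t) x 0 \<diamondop> pw y x (q - 2) =
    ((-1) ^ (q - 3) * of_nat (q - 2 choose (q - 3))) *s pw (pw (u t) x (q - 3) \<diamondop> y) x (q - 2 - (q - 3)) -
    ((-1) ^ (q - 3) * of_nat (q - 2 choose Suc (q - 3))) *s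
      pw (pw (u t) x (q - 3) \<diamondop> x \<diamondop> y) x (q - 2 - Suc (q - 3))"
    by (rule chain_br2[OF c]) (use q5 in auto)
  moreover have "Suc (q - 3) = q - 2" "q - 2 - (q - 3) = 1" using q5 by auto
  moreover note choose_q2(1)
  ultimately show ?thesis
    unfolding v_eq by (simp add: of_nat_q2 pw_Suc P_def Q_def w_Suc sgn_q)
qed

lemma uxv_gen:
  assumes c: "chain (u t)"
  shows "u t \<diamondop> x \<diamondop> v = - (3 *s (Q (Suc t) \<diamondop> x)) - 2 *s (P (Suc t) \<diamondop> x) - A (Suc t) \<diamondop> y"
proof -
  let ?n = "q - 4"
  let ?f = "\<lambda>j. ((-1) ^ j * of_nat (q - 2 choose j)) *s pw (pw (pw (u t) x (q - 3)) x (j - ?n) \<diamondop> y) x (q - 2 - j)"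
  have "pw (u t) x 1 \<diamondop> pw y x (q - 2) = (\<Sum>j\<in>{?n..q - 2}. ?f j)"
    by (rule chain_br[OF c]) (use q5 in auto)
  also have "{?n..q - 2} = {?n, Suc ?n, Suc (Suc ?n)}" using q5 by auto
  finally have 1: "u t \<diamondop> x \<diamondop> v = ?f ?n + (?f (Suc ?n) + ?f (Suc (Suc ?n)))"
    by (simp add: v_eq pw_Suc)
  have b: "(q - 2 choose ?n) = (q - 2 choose 2)" "(q - 2 choose Suc ?n) = q - 2" "Suc (Suc ?n) = q - 2"
    using q5 choose_q2 Suc_diff_Suc[of 3 q] Suc_diff_Suc[of 2 q] by simp_all
  have d: "q - 2 - ?n = Suc 1" "q - 2 - Suc ?n = 1" "Suc ?n - ?n = 1" "q - 2 - ?n = 2" using q5 by auto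
  have sg: "(-1) ^ ?n = (- 1 :: 'f)" by (rule sgn_q)
  have f1: "?f ?n = - (3 *s (Q (Suc t) \<diamondop> x))"
    unfolding b d(1) using sg by (simp add: choose_q2_2 pw_Suc w_Suc Q_def)
  have f2: "?f (Suc ?n) = - (2 *s (P (Suc t) \<diamondop> x))"
    unfolding b d(2,3) using sg by (simp add: of_nat_q2 pw_Suc w_Suc P_def)
  have f3: "?f (Suc (Suc ?n)) = - (A (Suc t) \<diamondop> y)"
    unfolding b using sgn_q(1) d(4) by (simp add: pw_Suc w_Suc A_def numeral_2_eq_2)
  show ?thesis unfolding 1 f1 f2 f3 by simp
qed

text \<open>The multiples of \<open>P\<close> and \<open>Q\<close> combine to the symmetric sum
  \<open>Sg\<close>. Hence \<open>[u [v x]] = 0\<close> makes \<open>Sg (Suc t)\<close> central once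
  \<open>A (Suc t)\<close> is central and \<open>[Sg y] = 0\<close>; this is how infinite type
  arises beyond the first period.\<close>

lemma u_vx_gen:
  assumes c: "chain (u t)"
  shows "u t \<diamondop> (v \<diamondop> x) = Sg (Suc t) \<diamondop> x + A (Suc t) \<diamondop> y"
proof -
  show ?thesis
    unfolding br_br[of "u t"] uv_gen[OF c] uxv_gen[OF c] Sg_def by (simp add: lin)
qed

context
  fixes t assumes g: "good t"
begin

lemmas uv = uv_gen[OF goodD(10)[OF g]]
lemmas u_vx = u_vx_gen[OF goodD(10)[OF g]]

lemma wy_vx: "w t \<diamondop> y \<diamondop> (v \<diamondop> x) = be t *s Sg (Suc t)"
proof -
  have "w t \<diamondop> y \<diamondop> x \<diamondop> v = be t *s (- (2 *s Q (Suc t)) - P (Suc t))"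
    unfolding Q_def[of t, symmetric] Q_br[OF g N_v] uv ..
  thus ?thesis
    unfolding br_br[of "w t \<diamondop> y"] wy_v[OF g] Sg_def by (simp add: lin Q_def[symmetric])
qed

lemma w_vy: "w t \<diamondop> (v \<diamondop> y) = (2 * (al t + be t)) *s (w (Suc t) \<diamondop> y)"
  unfolding br_br w_v[OF g] wy_v[OF g] by (simp add: lin)

lemma wx_vy: "w t \<diamondop> x \<diamondop> (v \<diamondop> y) = (2 * al t) *s Sg (Suc t)"
proof -
  have "w t \<diamondop> x \<diamondop> y \<diamondop> v = al t *s (- (2 *s Q (Suc t)) - P (Suc t))"
    unfolding P_def[of t, symmetric] P_br[OF g N_v] uv ..
  thus ?thesis
    unfolding br_br[of "w t \<diamondop> x"] wx_v[OF g] Sg_def by (simp add: lin P_def[symmetric])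
qed

lemma wy_vy: "w t \<diamondop> y \<diamondop> (v \<diamondop> y) = 0"
  unfolding br_br[of "w t \<diamondop> y"] wy_v[OF g] using goodD(3)[OF g] wyy'[OF g] by (simp add: br_linear)

lemma Sg_y: "P (Suc t) \<diamondop> y = 0" "Q (Suc t) \<diamondop> y = 0" "Sg (Suc t) \<diamondop> y = 0"
  using chain_wxyy[OF goodD(10)[OF g]] by (simp_all add: P_def Q_def Sg_def w_Suc br_linear)

section \<open>Powers of \<open>ad x\<close>\<close>

lemma yxq: "pw y x q = 0"
proof -
  have "q = Suc (Suc (q - 2))" using q5 by simp
  hence "pw y x q = v \<diamondop> x \<diamondop> x" unfolding v_eq by (metis pw_Suc)
  thus ?thesis using v_rel(1) by simp
qed

text \<open>In characteristic \<open>p\<close> the power \<open>(ad x)^q\<close> is a derivation,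
  and it kills \<open>y\<close>; hence it commutes with \<open>ad y\<close>.\<close>

lemma br_pw_q: "pw (a \<diamondop> y) x q = pw a x q \<diamondop> y"
proof -
  let ?f = "\<lambda>k. ((-1) ^ k * of_nat (q choose k)) *s pw (pw a x k \<diamondop> y) x (q - k)"
  have "0 = a \<diamondop> pw y x q" by (simp add: yxq)
  also have "\<dots> = (\<Sum>k\<in>{..q}. ?f k)" by (rule br_pw)
  also have "\<dots> = (\<Sum>k\<in>{0, q}. ?f k)"
    using of_nat_choose_prime_power[OF prime char] by (intro sum.mono_neutral_right) (auto simp: q)
  also have "\<dots> = pw (a \<diamondop> y) x q - pw a x q \<diamondop> y" using q5 odd_q by simp
  finally show ?thesis by simp
qed

text \<open>As \<open>[w x^q]\<close> vanishes, so does \<open>[w y x^q]\<close>, which is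
  \<open>be t\<close> times \<open>[u x^(q-1)]\<close>, that is, times \<open>A (Suc t)\<close>. At
  type 1, where \<open>be t = 0\<close>, only the bracket of \<open>A (Suc t)\<close> with
  \<open>x\<close> is controlled.\<close>

lemma A_Suc: "be t *s A (Suc t) = 0" "al t *s (A (Suc t) \<diamondop> x) = 0"
proof -
  have xx: "pw a x 2 = a \<diamondop> x \<diamondop> x" "pw a x 3 = a \<diamondop> x \<diamondop> x \<diamondop> x" for a
    by (simp_all add: pw_Suc numeral_2_eq_2 numeral_3_eq_3)
  have z: "pw (w t) x q = 0" "pw (w t \<diamondop> x) x q = 0"
  proof -
    have "pw (A t) x (q - 2) = 0" "pw (A t) x (q - 1) = 0"
      using goodD(2)[OF g] q5 by (simp_all add: Z_pw)
    thus "pw (w t) x q = 0" "pw (w t \<diamondop> x) x q = 0"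
      using pw_split[of 2 q "w t" x] pw_split[of 1 q "w t \<diamondop> x" x] q5
      by (simp_all add: xx pw_Suc A_def)
  qed
  have "pw (w t \<diamondop> y) x q = 0" using br_pw_q[of "w t"] z by simp
  moreover have "pw (w t \<diamondop> y) x q = pw (Q t) x (q - 1)"
    using pw_split[of 1 q "w t \<diamondop> y" x] q5 by (simp add: pw_Suc Q_def)
  moreover have "pw (u t) x (q - 1) = A (Suc t)" "pw (u t) x q = A (Suc t) \<diamondop> x"
    using pw_split[of "q - 3" "q - 1" "u t" x] pw_split[of "q - 3" q "u t" x] q5
    by (simp_all add: A_def w_Suc xx)
  ultimately show "be t *s A (Suc t) = 0" using Q_pw[OF g, of "q - 1"] q5 by simp
  have "pw (P t) x q = 0" using br_pw_q[of "w t \<diamondop> x"] z by (simp add: P_def)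
  thus "al t *s (A (Suc t) \<diamondop> x) = 0"
    using P_pw[OF g, of q] q5 \<open>pw (u t) x q = A (Suc t) \<diamondop> x\<close> by simp
qed

end

end

context nott
begin

section \<open>The chain after a diamond\<close>

lemma pw_1 [simp]: "pw a b (Suc 0) = a \<diamondop> b"
  by (simp add: pw_Suc)

lemma zero_neg: "(0::'a) = - a - b \<Longrightarrow> a + b = 0"
proof -
  assume e: "0 = - a - b"
  have "a + b = - (- a - b)" by simp
  thus ?thesis unfolding e[symmetric] by simp
qed

text \<open>Modulo \<open>p\<close> these are the coefficients of
  \<open>(1 + X)^(-2)\<close>.\<close>

lemma choose_q2_F: "m < q - 1 \<Longrightarrow> of_nat (q - 2 choose m) = ((-1) ^ m * of_nat (m + 1) :: 'f)"
proof -
  assume m: "m < q - 1"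
  have "of_nat (2 + m - 1 choose m) = ((-1) ^ m * of_nat (p ^ e - 2 choose m) :: 'f)"
    by (rule of_nat_choose_neg[OF prime char]) (use q5 m in \<open>auto simp: q\<close>)
  moreover have "(2 + m - 1 choose m) = m + 1" using binomial_Suc_n[of m] by simp
  ultimately have "of_nat (m + 1) = ((-1) ^ m * of_nat (q - 2 choose m) :: 'f)" by (simp only: q)
  hence "(-1) ^ m * of_nat (m + 1) = ((-1) ^ m * (-1) ^ m) * (of_nat (q - 2 choose m) :: 'f)"
    by (simp only: mult.assoc)
  thus ?thesis by (simp add: power_mult_distrib[symmetric])
qed

lemma fin_adjacent: "fin t \<Longrightarrow> fin (Suc t) \<Longrightarrow> False"
  using ps_gt(2) by (auto simp: fin_def mod_Suc split: if_splits)

context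
  fixes t assumes g: "good t" and A': "A (Suc t) \<in> Z"
    and P': "P (Suc t) - al (Suc t) *s u (Suc t) \<in> Z" and Q': "Q (Suc t) - be (Suc t) *s u (Suc t) \<in> Z"
begin

text \<open>The obstructions to the chain condition after the new diamond. The index is chosen so
  that \<open>DD i\<close> lies in the degree of \<open>[w y x^i y]\<close>, with
  \<open>w = w (Suc t)\<close>.\<close>

definition DD :: "nat \<Rightarrow> 'a" where "DD i = pw (u (Suc t)) x (i - 1) \<diamondop> y"

lemma ch: "chain (u t)" using goodD(10)[OF g] .

lemma N_DD [simp]: "DD i \<in> N" by (simp add: DD_def)

lemma DD_P: "pw (P (Suc t)) x k \<diamondop> y = al (Suc t) *s DD (Suc k)"
proof (cases "k = 0")
  case True
  thus ?thesis using Z_cong[OF P', of y] by (simp add: DD_def br_linear)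
next
  case False
  thus ?thesis using Z_cong_pw[OF P', of k] by (simp add: DD_def br_linear pw_scale)
qed

lemma DD_Q: "pw (w (Suc t) \<diamondop> y) x (Suc k) \<diamondop> y = be (Suc t) *s DD (Suc k)"
proof (cases "k = 0")
  case True
  thus ?thesis using Z_cong[OF Q', of y] by (simp add: DD_def br_linear pw_Suc Q_def)
next
  case False
  thus ?thesis using Z_cong_pw[OF Q', of k] by (simp add: DD_def br_linear pw_scale pw_Suc_left Q_def)
qed

text \<open>Both \<open>P\<close> and \<open>Q\<close> are annihilated by \<open>y\<close>, and they
  are multiples of \<open>u\<close> modulo \<open>Z\<close> with coefficients that are not both
  zero.\<close>

lemma DD_1: "DD 1 = 0"
  using Sg_y(1,2)[OF g] Z_cong[OF P', of y] Z_cong[OF Q', of y] al_be_nz[of "Suc t"]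
  by (auto simp: DD_def br_linear)

lemma DD_n:
  assumes "1 \<le> i" "0 < n" "i + n < q - 2"
  shows "(of_nat (i + n choose n) * be (Suc t)) *s DD i = (of_nat (i + n choose Suc n) * al (Suc t)) *s DD i"
proof -
  obtain j where j: "i = Suc j" using assms by (cases i) auto
  have e: "i + n - n = Suc j" "i + n - Suc n = j" using j by auto
  have "of_nat (i + n choose n) *s (pw (pw (u t) x (q - 3) \<diamondop> y) x (i + n - n) \<diamondop> y) =
    of_nat (i + n choose Suc n) *s (pw (pw (u t) x (q - 3) \<diamondop> x \<diamondop> y) x (i + n - Suc n) \<diamondop> y)"
    by (rule chain_rel[OF ch, of "q - 3 - n"]) (use assms A' in \<open>auto simp: A_def w_Suc\<close>)
  thus ?thesis
    unfolding w_Suc[symmetric] e DD_Q P_def[symmetric] DD_P by (simp add: j)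
qed

lemma br_pw_single:
  assumes "\<And>k. k < n \<Longrightarrow> pw c x k \<diamondop> b \<in> Z"
  shows "c \<diamondop> pw b x n = (-1) ^ n *s (pw c x n \<diamondop> b)"
proof -
  have "c \<diamondop> pw b x n = (\<Sum>k\<in>{n}. ((-1) ^ k * of_nat (n choose k)) *s pw (pw c x k \<diamondop> b) x (n - k))"
    unfolding br_pw by (intro sum.mono_neutral_right) (auto simp: Z_pw assms)
  thus ?thesis by simp
qed

context
  fixes i assumes lower: "\<And>j. 1 \<le> j \<Longrightarrow> j < i \<Longrightarrow> DD j \<in> Z"
begin

text \<open>The relation \<open>[y x^i y] = 0\<close> is bracketed with \<open>w\<close> itself. The
  second Leibniz term no longer vanishes, but by induction only its last summand survives.\<close>

lemma DD_0:
  assumes "1 \<le> i" "i < q - 2"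
  shows "(be (Suc t) - of_nat i * al (Suc t) - (-1) ^ i * be (Suc t)) *s DD i = 0"
proof -
  let ?w = "w (Suc t)"
  obtain j where j: "i = Suc j" using assms by (cases i) auto
  have "0 = ?w \<diamondop> (pw y x i \<diamondop> y)" using rel_y[of i] assms by simp
  also have "\<dots> = ?w \<diamondop> pw y x i \<diamondop> y - ?w \<diamondop> y \<diamondop> pw y x i" by (rule br_br)
  also have "?w \<diamondop> pw y x i = pw (?w \<diamondop> y) x i - of_nat i *s pw (P (Suc t)) x (i - 1)"
    unfolding P_def using A' assms by (intro head_br) (auto simp: A_def)
  also have "?w \<diamondop> y \<diamondop> pw y x i = (-1) ^ i *s (pw (?w \<diamondop> y) x i \<diamondop> y)"
  proof (rule br_pw_single)
    fix k assume "k < i"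
    thus "pw (?w \<diamondop> y) x k \<diamondop> y \<in> Z"
      using wyy'[OF g] lower[of k] by (cases k) (auto simp: DD_Q)
  qed
  finally show ?thesis unfolding j by (simp add: DD_Q DD_P lin distrib_right)
qed

text \<open>The same with \<open>[w x]\<close> in place of \<open>w\<close>; this settles even
  \<open>i\<close> unless the type is 0.\<close>

lemma DD_wx:
  assumes "2 \<le> i" "i \<le> q - 2"
  shows "(al (Suc t) * (1 + (-1) ^ i)) *s DD i = 0"
proof -
  obtain j where j: "i = Suc j" "0 < j" using assms by (cases i) auto
  have "0 = w (Suc t) \<diamondop> x \<diamondop> (pw y x j \<diamondop> y)" using rel_y[of j] assms j by simp
  also have "\<dots> = w (Suc t) \<diamondop> x \<diamondop> pw y x j \<diamondop> y - P (Suc t) \<diamondop> pw y x j"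
    unfolding P_def by (rule br_br)
  also have "w (Suc t) \<diamondop> x \<diamondop> pw y x j = pw (P (Suc t)) x j"
    unfolding P_def using A' by (intro head_br_Z) (auto simp: A_def)
  also have "P (Suc t) \<diamondop> pw y x j = (-1) ^ j *s (pw (P (Suc t)) x j \<diamondop> y)"
    using lower j by (intro br_pw_single) (auto simp: DD_P)
  finally show ?thesis unfolding j by (simp add: DD_P lin algebra_simps)
qed

text \<open>With one more \<open>x\<close> in the relation the last two summands survive. The
  resulting link from \<open>DD (Suc i)\<close> to \<open>[DD i x]\<close> yields centrality of
  \<open>DD i\<close> when its vanishing is out of reach.\<close>

lemma DD_wx_Suc:
  assumes "1 \<le> i" "i < q - 2"
  shows "(al (Suc t) * (1 - (-1) ^ i)) *s DD (Suc i) = (- ((-1) ^ i) * of_nat i * al (Suc t)) *s (DD i \<diamondop> x)"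
proof -
  obtain j where j: "i = Suc j" using assms by (cases i) auto
  let ?f = "\<lambda>k. ((-1) ^ k * of_nat (i choose k)) *s pw (pw (P (Suc t)) x k \<diamondop> y) x (i - k)"
  have "0 = w (Suc t) \<diamondop> x \<diamondop> (pw y x i \<diamondop> y)" using rel_y[of i] assms by simp
  also have "\<dots> = w (Suc t) \<diamondop> x \<diamondop> pw y x i \<diamondop> y - P (Suc t) \<diamondop> pw y x i"
    unfolding P_def by (rule br_br)
  also have "w (Suc t) \<diamondop> x \<diamondop> pw y x i = pw (P (Suc t)) x i"
    unfolding P_def using A' by (intro head_br_Z) (auto simp: A_def)
  also have "P (Suc t) \<diamondop> pw y x i = (\<Sum>k\<in>{..i}. ?f k)" by (rule br_pw)
  also have "\<dots> = (\<Sum>k\<in>{j, Suc j}. ?f k)"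
  proof (intro sum.mono_neutral_right ballI)
    fix k assume k: "k \<in> {..i} - {j, Suc j}"
    hence "DD (Suc k) \<in> Z" using lower j by auto
    thus "?f k = 0" using k j by (auto simp: DD_P Z_pw pw_scale)
  qed (use j in auto)
  finally show ?thesis unfolding j by (simp add: DD_P lin algebra_simps binomial_Suc_n)
qed

lemma DD_y:
  assumes "2 \<le> i" shows "DD i \<diamondop> y = 0"
proof -
  obtain j where j: "i = Suc (Suc j)" using assms by (metis add_2_eq_Suc le_Suc_ex)
  let ?c = "pw (u (Suc t)) x j"
  have c: "?c \<diamondop> y \<in> Z" using lower[of "Suc j"] j by (simp add: DD_def)
  have "0 = ?c \<diamondop> (y \<diamondop> x \<diamondop> y)" using rel_y[of 1] q5 by (simp add: pw_Suc)
  also have "\<dots> = ?c \<diamondop> (y \<diamondop> x) \<diamondop> y - ?c \<diamondop> y \<diamondop> (y \<diamondop> x)" by (rule br_br)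
  also have "?c \<diamondop> y \<diamondop> (y \<diamondop> x) = 0" using c by (intro Z_br) auto
  also have "?c \<diamondop> (y \<diamondop> x) = - (?c \<diamondop> x \<diamondop> y)" unfolding br_br using c by simp
  also have "?c \<diamondop> x \<diamondop> y = DD i" by (simp add: DD_def j pw_Suc)
  finally show ?thesis by (simp add: br_linear)
qed

lemma u_pw_vy:
  assumes "l < q - 3"
  shows "pw (u t) x l \<diamondop> (v \<diamondop> y) =
    - (of_nat (l + 2) * be (Suc t) + of_nat (l + 1) * al (Suc t)) *s DD (Suc l)"
proof -
  let ?n = "q - 3 - l"
  have "pw (u t) x l \<diamondop> y \<diamondop> v = 0" using ch assms by (intro Z_br) (auto simp: chain_def)
  hence 1: "pw (u t) x l \<diamondop> (v \<diamondop> y) = pw (u t) x l \<diamondop> v \<diamondop> y" unfolding br_br by simp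
  have "pw (u t) x l \<diamondop> v =
    ((-1) ^ ?n * of_nat (q - 2 choose ?n)) *s pw (pw (u t) x (q - 3) \<diamondop> y) x (q - 2 - ?n) -
    ((-1) ^ ?n * of_nat (q - 2 choose Suc ?n)) *s pw (pw (u t) x (q - 3) \<diamondop> x \<diamondop> y) x (q - 2 - Suc ?n)"
    unfolding v_eq by (rule chain_br2[OF ch]) (use assms q5 A' in \<open>auto simp: A_def w_Suc\<close>)
  moreover have "q - 2 - ?n = Suc l" "q - 2 - Suc ?n = l" using assms q5 by auto
  ultimately have 2: "pw (u t) x l \<diamondop> v \<diamondop> y =
    ((-1) ^ ?n * of_nat (q - 2 choose ?n)) *s (be (Suc t) *s DD (Suc l)) -
    ((-1) ^ ?n * of_nat (q - 2 choose Suc ?n)) *s (al (Suc t) *s DD (Suc l))"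
    by (simp add: w_Suc[symmetric] P_def[symmetric] br_linear DD_P DD_Q)
  have n: "of_nat (?n + 1) = (- of_nat (l + 2) :: 'f)" "of_nat (Suc ?n + 1) = (- of_nat (l + 1) :: 'f)"
  proof -
    have "?n + 1 + (l + 2) = q" "Suc ?n + 1 + (l + 1) = q" using assms q5 by auto
    hence "of_nat (?n + 1) + of_nat (l + 2) = (0::'f)" "of_nat (Suc ?n + 1) + of_nat (l + 1) = (0::'f)"
      using q_0 by (metis of_nat_add)+
    thus "of_nat (?n + 1) = (- of_nat (l + 2) :: 'f)" "of_nat (Suc ?n + 1) = (- of_nat (l + 1) :: 'f)"
      by (simp_all only: eq_neg_iff_add_eq_0)
  qed
  have sq: "(-1) ^ ?n * ((-1) ^ ?n * c) = (c::'f)" for c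
    unfolding mult.assoc[symmetric] power_mult_distrib[symmetric] by simp
  have c: "(-1) ^ ?n * of_nat (q - 2 choose ?n) = (- of_nat (l + 2) :: 'f)"
    "(-1) ^ ?n * of_nat (q - 2 choose Suc ?n) = (of_nat (l + 1) :: 'f)"
    using choose_q2_F[of ?n] choose_q2_F[of "Suc ?n"] assms q5 n sq by simp_all
  show ?thesis
    unfolding 1 2 c scale_scale scale_left_diff_distrib[symmetric]
    by (rule arg_cong[of _ _ "\<lambda>c. c *s DD (Suc l)"]) (simp add: algebra_simps)
qed

text \<open>The relations \<open>[v y x^i y] = 0\<close>, bracketed with \<open>w t\<close>, give a
  further equation at a diamond of finite type preceded by one of infinite type.\<close>

lemma DD_v:
  assumes "\<not> fin t" "fin (Suc t)" "1 \<le> i" "i < q - 2"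
  shows "(2 * of_nat i + (-1) ^ i * (of_nat i + be (Suc t))) *s DD i = 0"
proof -
  obtain j where j: "i = Suc j" using assms by (cases i) auto
  let ?f = "pw (v \<diamondop> y) x i"
  have ab: "al t = 1" "be t = - 1" using al_be_inf assms by auto
  have N: "v \<diamondop> y \<in> N" by simp
  have "0 = w t \<diamondop> (?f \<diamondop> y)" using vy_rel[of i] assms by simp
  also have "\<dots> = w t \<diamondop> ?f \<diamondop> y - w t \<diamondop> y \<diamondop> ?f" by (rule br_br)
  also have "w t \<diamondop> ?f = pw (w t \<diamondop> (v \<diamondop> y)) x i - of_nat i *s pw (w t \<diamondop> x \<diamondop> (v \<diamondop> y)) x (i - 1)"
    using goodD(2)[OF g] assms by (intro head_br) (auto simp: A_def)
  also have "w t \<diamondop> (v \<diamondop> y) = 0" unfolding w_vy[OF g] ab by simp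
  also have "w t \<diamondop> x \<diamondop> (v \<diamondop> y) = 2 *s u (Suc t)"
    unfolding wx_vy[OF g] ab u_fin[of "Suc t", OF _ assms(2), simplified] by simp
  also have "w t \<diamondop> y \<diamondop> ?f = (-1) ^ i *s (pw (w t \<diamondop> y) x i \<diamondop> (v \<diamondop> y))"
  proof (rule br_pw_single)
    fix k assume k: "k < i"
    show "pw (w t \<diamondop> y) x k \<diamondop> (v \<diamondop> y) \<in> Z"
    proof (cases k)
      case (Suc l)
      have "pw (w t \<diamondop> y) x k \<diamondop> (v \<diamondop> y) = be t *s (pw (u t) x l \<diamondop> (v \<diamondop> y))"
        unfolding Suc pw_Suc_left Q_def[symmetric]
        by (cases "l = 0") (simp_all add: Q_br[OF g] Q_pw[OF g] br_linear)
      thus ?thesis using u_pw_vy[of l] lower[of "Suc l"] k Suc assms(4) by auto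
    qed (use wy_vy[OF g] in simp)
  qed
  also have "pw (w t \<diamondop> y) x i \<diamondop> (v \<diamondop> y) = - (pw (u t) x j \<diamondop> (v \<diamondop> y))"
    unfolding j pw_Suc_left Q_def[symmetric]
    by (cases "j = 0") (simp_all add: Q_br[OF g] Q_pw[OF g] br_linear ab)
  also have "pw (u t) x j \<diamondop> (v \<diamondop> y) =
    - (of_nat (j + 2) * be (Suc t) + of_nat (j + 1) * al (Suc t)) *s DD (Suc j)"
    using assms j by (intro u_pw_vy) auto
  finally have f: "0 = (pw 0 x i - of_nat i *s pw (2 *s u (Suc t)) x (i - 1)) \<diamondop> y -
    (-1) ^ i *s - (- (of_nat (j + 2) * be (Suc t) + of_nat (j + 1) * al (Suc t)) *s DD (Suc j))" .
  have e1: "pw (2 *s u (Suc t)) x (i - 1) \<diamondop> y = 2 *s DD i"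
    by (simp add: pw_scale br_linear DD_def)
  have "0 = - (of_nat i *s (2 *s DD i)) -
    (-1) ^ i *s ((of_nat (j + 2) * be (Suc t) + of_nat (j + 1) * al (Suc t)) *s DD i)"
    using f unfolding br_linear e1 j[symmetric]
    by (simp only: pw_zero br_zero_left scale_minus_left minus_minus diff_0)
  hence "((of_nat i * 2) + (-1) ^ i * (of_nat (j + 2) * be (Suc t) + of_nat (j + 1) * al (Suc t))) *s DD i = 0"
    unfolding scale_left_distrib[of "of_nat i * 2"] scale_scale[symmetric] by (rule zero_neg)
  hence "(2 * of_nat i + (-1) ^ i * (of_nat (j + 2) * be (Suc t) + of_nat (j + 1) * al (Suc t))) *s DD i = 0"
    by (simp only: mult.commute[of _ 2])
  moreover have "of_nat (j + 2) * be (Suc t) + of_nat (j + 1) * al (Suc t) = of_nat i + be (Suc t)"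
  proof -
    have "of_nat (j + 2) * be (Suc t) + of_nat (j + 1) * al (Suc t) =
        of_nat (j + 1) * (al (Suc t) + be (Suc t)) + be (Suc t)"
      by (simp add: algebra_simps)
    thus ?thesis unfolding al_be_1[OF assms(2)] j by simp
  qed
  ultimately show ?thesis by simp
qed

lemma DD_even:
  assumes i: "2 \<le> i" "i < q - 2" "even i"
  shows "DD i = 0"
proof (cases "al (Suc t) = 0")
  case False
  have "(al (Suc t) * (1 + (-1) ^ i)) *s DD i = 0" using DD_wx i by simp
  thus ?thesis using False i two_nz by simp
next
  case True
  hence f: "fin (Suc t)" using al_be_inf(1)[of "Suc t"] by force
  hence nf: "\<not> fin t" using fin_adjacent by blast
  have b: "be (Suc t) = 1" using al_be_1[OF f] True by simp
  have V: "(3 * of_nat i + 1) *s DD i = 0"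
  proof -
    have "2 * of_nat i + (of_nat i + 1) = (3 * of_nat i + 1 :: 'f)" by (simp add: algebra_simps)
    thus ?thesis using DD_v[OF nf f] i b by simp
  qed
  \<comment> \<open>At type 0 this factor is \<open>-8\<close> for \<open>i = q - 3\<close>.
    Otherwise \<open>DD_n\<close> with \<open>n = 1\<close> leaves only \<open>i = -1\<close> in the
    field, where the factor is \<open>-2\<close>.\<close>
  have "(3 * of_nat i + 1 :: 'f) \<noteq> 0 \<or> DD i = 0"
  proof (cases "i = q - 3")
    case True
    hence "of_nat i = (- 3 :: 'f)" using q5 q_0 of_nat_diff[of 3 q, where 'a = 'f] by simp
    hence "3 * of_nat i + 1 = (- (2 * (2 * 2)) :: 'f)" by simp
    thus ?thesis using two_nz by (metis mult_eq_0_iff neg_equal_0_iff_equal)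
  next
    case False
    have "(of_nat (i + 1 choose 1) * be (Suc t)) *s DD i = (of_nat (i + 1 choose Suc 1) * al (Suc t)) *s DD i"
      by (rule DD_n) (use i False in auto)
    hence "of_nat (i + 1) *s DD i = 0" using b True by simp
    hence "of_nat i = (- 1 :: 'f) \<or> DD i = 0"
      by (simp only: scale_eq_0_iff eq_neg_iff_add_eq_0 of_nat_add of_nat_1)
    moreover have "3 * (- 1) + 1 = (- 2 :: 'f)" by simp
    ultimately show ?thesis using two_nz by (metis neg_equal_0_iff_equal)
  qed
  thus ?thesis using V by auto
qed

text \<open>\<open>DD_0\<close> gives the factor \<open>i + 2\<close>, and \<open>DD_n\<close> with
  the largest possible \<open>n\<close> gives \<open>q - 2 choose i = - (i + 1)\<close>; the factors
  \<open>i + 2\<close> and \<open>i + 1\<close> differ by 1.\<close>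

lemma DD_odd_inf:
  assumes i: "2 \<le> i" "i < q - 2" "odd i" and nf: "\<not> fin (Suc t)"
  shows "DD i = 0"
proof -
  have ab: "al (Suc t) = 1" "be (Suc t) = - 1" using al_be_inf nf by auto
  have "i \<noteq> q - 3" using i odd_q q5 by auto
  hence i3: "i < q - 3" using i by auto
  define n where "n = q - 3 - i"
  have n: "0 < n" "i + n = q - 3" "Suc n = q - 2 - i" using i3 by (auto simp: n_def)
  have "(be (Suc t) - of_nat i * al (Suc t) - (-1) ^ i * be (Suc t)) *s DD i = 0"
    by (rule DD_0) (use i in auto)
  moreover have "be (Suc t) - of_nat i * al (Suc t) - (-1) ^ i * be (Suc t) = - (of_nat i + 2)"
    using ab i by simp
  ultimately have "(- (of_nat i + 2)) *s DD i = 0" by (simp only:)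
  hence 1: "(of_nat i + 2) *s DD i = 0" by (simp only: scale_minus_left neg_equal_0_iff_equal)
  have "(of_nat (i + n choose n) * be (Suc t)) *s DD i = (of_nat (i + n choose Suc n) * al (Suc t)) *s DD i"
    by (rule DD_n) (use i n in auto)
  hence "- (of_nat (q - 3 choose n) *s DD i) = of_nat (q - 3 choose Suc n) *s DD i"
    unfolding ab n(2) by simp
  hence "(of_nat (q - 3 choose n) + of_nat (q - 3 choose Suc n)) *s DD i = 0"
    unfolding scale_left_distrib by (metis add.right_inverse)
  moreover have "(q - 3 choose n) + (q - 3 choose Suc n) = (q - 2 choose i)"
  proof -
    have "(q - 3 choose n) + (q - 3 choose Suc n) = (Suc (q - 3) choose Suc n)" by simp
    also have "Suc (q - 3) = q - 2" using q5 by simp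
    finally show ?thesis using binomial_symmetric[of i "q - 2"] i n by simp
  qed
  moreover have "of_nat (q - 2 choose i) = (- of_nat (i + 1) :: 'f)" using choose_q2_F[of i] i by simp
  ultimately have "(- of_nat (i + 1)) *s DD i = 0" by (metis of_nat_add)
  hence 2: "(of_nat i + 1) *s DD i = 0"
    by (simp only: scale_minus_left neg_equal_0_iff_equal of_nat_add of_nat_1)
  have "DD i = (of_nat i + 2) *s DD i - (of_nat i + 1) *s DD i"
    unfolding scale_left_diff_distrib[symmetric] by simp
  thus ?thesis using 1 2 by simp
qed

text \<open>If \<open>DD i\<close> is nonzero, \<open>DD_0\<close> and \<open>DD_v\<close> force
  \<open>be = i\<close> and \<open>i (i + 1) = 0\<close> in the field. The root \<open>0\<close> is
  excluded by binomials. At the root \<open>-1\<close>, which is type 2, \<open>DD (Suc i)\<close>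
  vanishes and \<open>DD i\<close> is still central.\<close>

lemma DD_odd_fin:
  assumes i: "2 \<le> i" "i < q - 2" "odd i" and f: "fin (Suc t)"
  shows "DD i \<in> Z"
proof (rule ccontr)
  assume nZ: "DD i \<notin> Z"
  hence nz: "DD i \<noteq> 0" by auto
  have nf: "\<not> fin t" using fin_adjacent f by blast
  have "i \<noteq> q - 3" using i odd_q q5 by auto
  hence i3: "i \<le> q - 4" using i by auto
  have ab: "al (Suc t) = 1 - be (Suc t)" using al_be_1[OF f] by (simp add: eq_diff_eq)
  have "(be (Suc t) - of_nat i * al (Suc t) - (-1) ^ i * be (Suc t)) *s DD i = 0"
    by (rule DD_0) (use i in auto)
  hence 1: "2 * be (Suc t) = of_nat i * al (Suc t)" using i nz by simp
  have "(2 * of_nat i + (-1) ^ i * (of_nat i + be (Suc t))) *s DD i = 0"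
    by (rule DD_v[OF nf f]) (use i in auto)
  hence b: "be (Suc t) = of_nat i" using nz i by simp
  have "of_nat i * (of_nat i + 1) = (0::'f)" using 1 unfolding ab b by (simp add: algebra_simps)
  hence "of_nat i = (0::'f) \<or> of_nat i = (- 1 :: 'f)"
    by (simp only: mult_eq_0_iff eq_neg_iff_add_eq_0)
  thus False
  proof
    assume i0: "of_nat i = (0::'f)"
    hence ab': "be (Suc t) = 0" "al (Suc t) = 1" using b ab by auto
    \<comment> \<open>If all middle binomials of \<open>(1 - X)^(q - i)\<close> vanish, its value 0
      at \<open>X = 1\<close> equals \<open>1 + (-1)^(q - i)\<close>; but \<open>q - i\<close> is
      even, so this is 2.\<close>
    have ch0: "of_nat (q - i choose m) = (0::'f)" if m: "1 \<le> m" "m < q - i" for m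
    proof (cases "m \<le> q - 2 - i")
      case True
      have "of_nat (i + m - 1 choose m) = (0::'f)"
      proof (cases "m = 1")
        case False
        then obtain n where n: "m = Suc n" "0 < n" using m by (cases m) auto
        have "(of_nat (i + n choose n) * be (Suc t)) *s DD i = (of_nat (i + n choose Suc n) * al (Suc t)) *s DD i"
          by (rule DD_n) (use i n True in auto)
        thus ?thesis using ab' nz n by simp
      qed (use i0 in simp)
      moreover have "of_nat (i + m - 1 choose m) = ((-1) ^ m * of_nat (p ^ e - i choose m) :: 'f)"
        by (rule of_nat_choose_neg[OF prime char]) (use i m in \<open>auto simp: q\<close>)
      ultimately show ?thesis by (simp add: q)
    next
      case False
      hence "m = q - i - 1" using m by auto
      hence "(q - i choose m) = q - i"
        using binomial_Suc_n[of m] m by (metis Suc_diff_1 bot_nat_0.extremum_strict gr_zeroI)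
      moreover have "of_nat (q - i) = (0::'f)" using i0 q_0 i by (simp add: of_nat_diff)
      ultimately show ?thesis by simp
    qed
    have qi: "0 < q - i" using i by auto
    have "(\<Sum>m\<le>q - i. (-1) ^ m * of_nat (q - i choose m)) = (0::'f)"
      using choose_alternating_sum[OF qi, where 'a = 'f] by simp
    moreover have "(\<Sum>m\<in>{..q - i}. (-1) ^ m * of_nat (q - i choose m)) =
        (\<Sum>m\<in>{0, q - i}. (-1) ^ m * of_nat (q - i choose m) :: 'f)"
      using ch0 by (intro sum.mono_neutral_right) auto
    moreover have "even (q - i)" using i odd_q by auto
    ultimately show False using qi two_nz by simp
  next
    assume i1: "of_nat i = (- 1 :: 'f)"
    hence ab': "be (Suc t) = - 1" "al (Suc t) = 2" using b ab by auto
    \<comment> \<open>\<open>i = q - 4\<close> would mean \<open>-4 = -1\<close>, and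
      \<open>q - 5\<close> is even. This leaves room for \<open>DD_n\<close> at \<open>Suc i\<close>
      with \<open>n = 1\<close>.\<close>
    have "i \<noteq> q - 4"
    proof
      assume "i = q - 4"
      hence "of_nat i = (- 4 :: 'f)" using q5 q_0 of_nat_diff[of 4 q, where 'a = 'f] by simp
      hence "(4::'f) = 1" using i1 by simp
      moreover have "(4::'f) - 1 = 3" by simp
      ultimately show False using three_nz by (metis diff_self)
    qed
    moreover have "i \<noteq> q - 5" using i odd_q q5 by auto
    ultimately have i5: "Suc i + 1 < q - 2" using i3 by auto
    have "2 * of_nat (Suc i + 1 choose Suc 1) = (of_nat ((Suc i + 1) * Suc i) :: 'f)"
    proof -
      have "2 * (Suc i + 1 choose Suc 1) = (Suc i + 1) * Suc i"
        using Suc_times_binomial_eq[of "Suc i" 1] by (simp add: numeral_2_eq_2)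
      thus ?thesis by (metis of_nat_mult of_nat_numeral)
    qed
    hence c: "of_nat (Suc i + 1 choose Suc 1) = (0::'f)" using two_nz i1 by simp
    have "(of_nat (Suc i + 1 choose 1) * be (Suc t)) *s DD (Suc i) = (of_nat (Suc i + 1 choose Suc 1) * al (Suc t)) *s DD (Suc i)"
      by (rule DD_n) (use i5 in auto)
    hence "DD (Suc i) = 0" unfolding c ab' using i1 by simp
    moreover have "(al (Suc t) * (1 - (-1) ^ i)) *s DD (Suc i) = (- ((-1) ^ i) * of_nat i * al (Suc t)) *s (DD i \<diamondop> x)"
      by (rule DD_wx_Suc) (use i in auto)
    ultimately have "DD i \<diamondop> x = 0" using i i1 ab' two_nz by simp
    moreover have "DD i \<diamondop> y = 0" by (rule DD_y[OF i(1)])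
    ultimately have "DD i \<in> Z" unfolding Z_def by blast
    thus False using nZ by simp
  qed
qed

end

lemma DD_Z: "1 \<le> i \<Longrightarrow> i < q - 2 \<Longrightarrow> DD i \<in> Z"
proof (induction i rule: less_induct)
  case (less i)
  hence lower: "\<And>j. 1 \<le> j \<Longrightarrow> j < i \<Longrightarrow> DD j \<in> Z" by auto
  show ?case
  proof (cases "i = 1")
    case False
    hence i: "2 \<le> i" using less by auto
    show ?thesis
      using DD_even[OF lower i less(3)] DD_odd_inf[OF lower i less(3)] DD_odd_fin[OF lower i less(3)]
      by (cases "even i"; cases "fin (Suc t)") auto
  qed (simp add: DD_1[unfolded One_nat_def])
qed

lemma chain_Suc: "chain (u (Suc t))"
  unfolding chain_def
proof (intro conjI allI impI)
  fix i assume "i < q - 3"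
  thus "pw (u (Suc t)) x i \<diamondop> y \<in> Z" using DD_Z[of "Suc i"] by (simp add: DD_def)
qed simp

end

end

context nott
begin

section \<open>Spanning sets and detection by the model\<close>

lemma comp_u: "u t \<in> comp (t * (q - 1) + 2)"
proof (induction t)
  case 0
  thus ?case using comp_br_x[OF comp_y] by (simp add: u_def uf_def numeral_2_eq_2)
next
  case (Suc t)
  have "w (Suc t) \<in> comp (t * (q - 1) + 2 + (q - 3))"
    unfolding w_Suc by (rule comp_pw[OF Suc])
  also have "t * (q - 1) + 2 + (q - 3) = Suc t * (q - 1)" using q5 by simp
  finally have "w (Suc t) \<in> comp (Suc t * (q - 1))" .
  hence "w (Suc t) \<diamondop> x \<diamondop> y \<in> comp (Suc t * (q - 1) + 2)" "w (Suc t) \<diamondop> y \<diamondop> x \<in> comp (Suc t * (q - 1) + 2)"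
    using comp_br_x comp_br_y by fastforce+
  thus ?case by (simp add: u_def uf_def comp_add)
qed

lemma comp_w: "t \<ge> 1 \<Longrightarrow> w t \<in> comp (t * (q - 1))"
proof (cases t)
  case (Suc k)
  have "w (Suc k) \<in> comp (k * (q - 1) + 2 + (q - 3))"
    unfolding w_Suc by (rule comp_pw[OF comp_u])
  moreover have "k * (q - 1) + 2 + (q - 3) = Suc k * (q - 1)" using q5 by simp
  ultimately show ?thesis using Suc by metis
qed simp

lemma comp_w_Suc: "t \<ge> 1 \<Longrightarrow> w t \<diamondop> x \<in> comp (t * (q - 1) + 1)" "t \<ge> 1 \<Longrightarrow> w t \<diamondop> y \<in> comp (t * (q - 1) + 1)"
  using comp_br_x[OF comp_w] comp_br_y[OF comp_w] by auto

lemma ph_0 [simp]: "ph 0 = 0"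
  using ph_add[of 0 0] by simp

lemma ph_minus: "ph (- a) = - ph a"
  using ph_add[of "- a" a] by (simp add: eq_neg_iff_add_eq_0)

lemma ph_diff: "ph (a - b) = ph a - ph b"
  using ph_add[of a "- b"] ph_minus by simp

lemma ph_brx: "ph (a \<diamondop> x) = ph a \<oslash> XX" and ph_bry: "ph (a \<diamondop> y) = ph a \<oslash> YY"
  by (simp_all add: ph_br ph_x ph_y)

lemma ph_pw_me: "ph a = me i c \<Longrightarrow> j \<le> i \<Longrightarrow> ph (pw a x j) = me (i - j) c"
proof (induction j)
  case (Suc j)
  hence "i - j \<noteq> 0" "i - j - 1 = i - Suc j" by auto
  thus ?case using Suc by (simp add: pw_Suc ph_brx mb_XX)
qed simp

lemma q23: "q - 2 - (q - 3) = 1" "q - 3 \<le> q - 2"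
  using q5 by auto

text \<open>The images are single monomials for every type. The coefficient is 1 by the choice of
  \<open>uf\<close>: \<open>al t + be t = 1\<close> at finite types and \<open>al t = 1\<close> at
  infinite ones.\<close>

lemma ph_u_w: "ph (u t) = me (q - 2) (ZZ (Suc t)) \<and> ph (w (Suc t)) = me 1 (ZZ (Suc t))"
proof (induction t)
  case 0
  have "ph (u 0) = me (q - 2) (ZZ 1)"
    using ZZ_fin[of 0] q5 by (simp add: u_def uf_def ph_brx ph_y YY_def mb_XX numeral_2_eq_2)
  moreover from ph_pw_me[OF this q23(2), unfolded q23] have "ph (w (Suc 0)) = me 1 (ZZ 1)"
    by (simp add: w_Suc)
  ultimately show ?case by simp
next
  case (Suc t)
  have wx: "ph (w (Suc t) \<diamondop> x) = me 0 (ZZ (Suc t))"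
    using Suc by (simp add: ph_brx mb_XX)
  have wy: "ph (w (Suc t) \<diamondop> y) = me (q - 1) (cst (be (Suc t)) * ZZ (Suc (Suc t)))"
    using Suc mb_YY[of 1 "ZZ (Suc t)"] q5 D_ZZ_gg'[of "Suc t"] by (simp add: ph_bry)
  have Pt: "ph (P (Suc t)) = me (q - 2) (cst (al (Suc t)) * ZZ (Suc (Suc t)))"
    using wx mb_YY[of 0 "ZZ (Suc t)"] q5 D_ZZ_gg[of "Suc t"] by (simp add: ph_bry P_def me_minus)
  have Qt: "ph (Q (Suc t)) = me (q - 2) (cst (be (Suc t)) * ZZ (Suc (Suc t)))"
    using wy q5 by (simp add: ph_brx Q_def mb_XX numeral_2_eq_2)
  have u: "ph (u (Suc t)) = me (q - 2) (ZZ (Suc (Suc t)))"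
  proof (cases "fin (Suc t)")
    case True
    have "cst (al (Suc t)) + cst (be (Suc t)) = 1"
      using al_be_1[OF True] by (metis hconst_simps(2,3))
    thus ?thesis using Pt Qt u_fin[of "Suc t"] True
      by (simp add: Sg_def ph_add me_add[symmetric] distrib_right[symmetric])
  next
    case False
    thus ?thesis using Pt u_inf[of "Suc t"] al_be_inf(1)[of "Suc t"] by simp
  qed
  moreover from ph_pw_me[OF this q23(2), unfolded q23] have "ph (w (Suc (Suc t))) = me 1 (ZZ (Suc (Suc t)))"
    by (simp add: w_Suc)
  ultimately show ?case by simp
qed

lemma ph_u: "ph (u t) = me (q - 2) (ZZ (Suc t))"
  using ph_u_w by blast

lemma ph_w: "t \<ge> 1 \<Longrightarrow> ph (w t) = me 1 (ZZ t)"
  using ph_u_w[of "t - 1"] by simp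

lemma ph_wx: "t \<ge> 1 \<Longrightarrow> ph (w t \<diamondop> x) = me 0 (ZZ t)"
  by (simp add: ph_brx ph_w mb_XX)

lemma ph_wy: "t \<ge> 1 \<Longrightarrow> ph (w t \<diamondop> y) = me (q - 1) (cst (be t) * ZZ (Suc t))"
  using mb_YY[of 1 "ZZ t"] q5 D_ZZ_gg'[of t] by (simp add: ph_bry ph_w)

lemma ph_pw_u: "j \<le> q - 2 \<Longrightarrow> ph (pw (u t) x j) = me (q - 2 - j) (ZZ (Suc t))"
  by (rule ph_pw_me[OF ph_u])

lemma cst_ZZ: "t \<ge> 1 \<Longrightarrow> cst c * ZZ t = 0 \<longleftrightarrow> c = 0"
proof
  assume t: "t \<ge> 1" and z: "cst c * ZZ t = 0"
  show "c = 0"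
  proof (rule ccontr)
    assume "c \<noteq> 0"
    hence "cst (inverse c) * cst c = 1"
      unfolding hconst_mult[symmetric] by simp
    hence "ZZ t = cst (inverse c) * (cst c * ZZ t)" by (simp add: mult.assoc[symmetric])
    thus False using z ZZ_nz[OF t] by simp
  qed
qed simp

lemma ph_Z: "z \<in> Z \<Longrightarrow> ph z \<oslash> XX = 0" "z \<in> Z \<Longrightarrow> ph z \<oslash> YY = 0"
  using ph_brx[of z] ph_bry[of z] by simp_all

lemma mb_add: "(f + f') \<oslash> h = f \<oslash> h + f' \<oslash> h" and mb_scale: "mscale c f \<oslash> h = mscale c (f \<oslash> h)"
  using total_lie.br_add_left[OF total_lie_model] total_lie.br_scale_left[OF total_lie_model] by blast+

section \<open>Spanning elements and tests for centrality\<close>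

definition goods :: "nat \<Rightarrow> bool" where "goods T \<longleftrightarrow> (\<forall>k. 1 \<le> k \<and> k \<le> T \<longrightarrow> good k)"

lemma goodsD: "goods T \<Longrightarrow> 1 \<le> k \<Longrightarrow> k \<le> T \<Longrightarrow> good k"
  by (simp add: goods_def)

lemma chain_0: "chain (u 0)"
  unfolding chain_def
proof (intro conjI allI impI)
  fix i assume i: "i < q - 3"
  have "pw (u 0) x i \<diamondop> y = pw y x (Suc i) \<diamondop> y" by (simp add: u_def uf_def pw_Suc_left)
  also have "\<dots> = 0" using rel_y[of "Suc i"] i by simp
  finally show "pw (u 0) x i \<diamondop> y \<in> Z" by simp
qed simp

lemma goods_chain: "goods T \<Longrightarrow> t \<le> T \<Longrightarrow> chain (u t)"
  using chain_0 goodsD[of T t] goodD(10) by (cases "t = 0") auto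

text \<open>Along a chain, bracketing with \<open>y\<close> contributes only central elements, so
  \<open>x\<close> alone produces the next degree modulo \<open>Z\<close>.\<close>

lemma span_chain:
  assumes "chain (u t)" "\<And>a. a \<in> comp (t * (q - 1) + 2) \<Longrightarrow> \<exists>c. a - c *s u t \<in> Z"
  shows "j \<le> q - 3 \<Longrightarrow> a \<in> comp (t * (q - 1) + 2 + j) \<Longrightarrow> \<exists>c. a - c *s pw (u t) x j \<in> Z"
proof (induction j arbitrary: a)
  case 0
  thus ?case using assms(2) by simp
next
  case (Suc j)
  have "a \<in> dec (t * (q - 1) + 2 + j)" using comp_dec[of a "t * (q - 1) + 1 + j"] Suc.prems by simp
  then obtain b c where bc: "b \<in> comp (t * (q - 1) + 2 + j)" "c \<in> comp (t * (q - 1) + 2 + j)"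
    "a = b \<diamondop> x + c \<diamondop> y" by (auto simp: dec_def)
  obtain k l where k: "b - k *s pw (u t) x j \<in> Z" and l: "c - l *s pw (u t) x j \<in> Z"
    using Suc.IH[OF _ bc(1)] Suc.IH[OF _ bc(2)] Suc.prems by auto
  have "pw (u t) x j \<diamondop> y \<in> Z" using assms(1) Suc.prems by (simp add: chain_def)
  moreover have "a = k *s pw (u t) x (Suc j) + l *s (pw (u t) x j \<diamondop> y)"
    using Z_cong[OF k N_x] Z_cong[OF l N_y] bc(3) by (simp add: br_linear pw_Suc)
  ultimately have "a - k *s pw (u t) x (Suc j) \<in> Z" by simp
  thus ?case by blast
qed

lemma span_diamond_gen:
  assumes "\<And>a. a \<in> comp (t * (q - 1) + 2 + (q - 3)) \<Longrightarrow> \<exists>c. a - c *s pw (u t) x (q - 3) \<in> Z"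
    and a: "a \<in> comp (Suc t * (q - 1) + 1)"
  shows "\<exists>c d. a = c *s (w (Suc t) \<diamondop> x) + d *s (w (Suc t) \<diamondop> y)"
proof -
  have e: "Suc t * (q - 1) + 1 = Suc (Suc (t * (q - 1) + 1 + (q - 3)))"
    "Suc (t * (q - 1) + 1 + (q - 3)) = t * (q - 1) + 2 + (q - 3)" using q5 by simp_all
  have "a \<in> dec (t * (q - 1) + 2 + (q - 3))" using comp_dec[of a "t * (q - 1) + 1 + (q - 3)"] a unfolding e by simp
  then obtain b c where bc: "b \<in> comp (t * (q - 1) + 2 + (q - 3))" "c \<in> comp (t * (q - 1) + 2 + (q - 3))"
    "a = b \<diamondop> x + c \<diamondop> y" by (auto simp: dec_def)
  obtain k l where k: "b - k *s w (Suc t) \<in> Z" and l: "c - l *s w (Suc t) \<in> Z"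
    using assms(1)[OF bc(1)] assms(1)[OF bc(2)] unfolding w_Suc by auto
  have "a = k *s (w (Suc t) \<diamondop> x) + l *s (w (Suc t) \<diamondop> y)"
    using Z_cong[OF k N_x] Z_cong[OF l N_y] bc(3) by (simp add: br_linear)
  thus ?thesis by blast
qed

text \<open>A diamond is spanned by \<open>[w x]\<close> and \<open>[w y]\<close>; goodness turns
  all their products with the generators into multiples of \<open>u\<close>, modulo
  \<open>Z\<close>.\<close>

lemma span_u_0:
  assumes "goods T" "t \<le> T" "a \<in> comp (t * (q - 1) + 2)"
  shows "\<exists>c. a - c *s u t \<in> Z"
  using assms(2,3)
proof (induction t arbitrary: a)
  case 0
  have "a \<in> dec 1" using comp_dec[of a 0] 0 by (simp add: numeral_2_eq_2)
  then obtain b c where bc: "b \<in> comp 1" "c \<in> comp 1" "a = b \<diamondop> x + c \<diamondop> y" by (auto simp: dec_def)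
  obtain k l k' l' where "b = k *s x + l *s y" "c = k' *s x + l' *s y"
    using comp_1[OF bc(1)] comp_1[OF bc(2)] by blast
  hence "a = l *s (y \<diamondop> x) + k' *s (x \<diamondop> y)" using bc(3) by (simp add: br_linear br_self)
  also have "x \<diamondop> y = - (y \<diamondop> x)" by (rule br_anti)
  finally have "a - (l - k') *s u 0 = 0" by (simp add: u_def uf_def scale_left_diff_distrib)
  thus ?case by (metis Z_0)
next
  case (Suc t)
  have g: "good (Suc t)" using goodsD[OF assms(1)] Suc.prems by simp
  have sc: "\<exists>c. b - c *s pw (u t) x (q - 3) \<in> Z" if "b \<in> comp (t * (q - 1) + 2 + (q - 3))" for b
    using span_chain[OF goods_chain[OF assms(1), of t], of "q - 3" b] Suc.IH Suc.prems that by auto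
  have sp: "\<exists>c d. b = c *s (w (Suc t) \<diamondop> x) + d *s (w (Suc t) \<diamondop> y)"
    if "b \<in> comp (Suc t * (q - 1) + 1)" for b
    by (rule span_diamond_gen[OF _ that]) (rule sc)
  have "a \<in> dec (Suc t * (q - 1) + 1)" using comp_dec[of a "Suc t * (q - 1)"] Suc.prems by simp
  then obtain b c where bc: "b \<in> comp (Suc t * (q - 1) + 1)" "c \<in> comp (Suc t * (q - 1) + 1)"
    "a = b \<diamondop> x + c \<diamondop> y" by (auto simp: dec_def)
  obtain k l k' l' where kl: "b = k *s (w (Suc t) \<diamondop> x) + l *s (w (Suc t) \<diamondop> y)"
     "c = k' *s (w (Suc t) \<diamondop> x) + l' *s (w (Suc t) \<diamondop> y)"
    using sp[OF bc(1)] sp[OF bc(2)] by blast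
  have "a = k *s A (Suc t) + l *s Q (Suc t) + k' *s P (Suc t)"
    unfolding bc(3) kl using goodD(3)[OF g] by (simp add: br_linear A_def P_def Q_def)
  hence "a - (l * be (Suc t) + k' * al (Suc t)) *s u (Suc t) = k *s A (Suc t) +
    l *s (Q (Suc t) - be (Suc t) *s u (Suc t)) + k' *s (P (Suc t) - al (Suc t) *s u (Suc t))"
    by (simp add: scale_left_distrib scale_right_diff_distrib)
  moreover have "\<dots> \<in> Z" using goodD(2,4,5)[OF g] by simp
  ultimately show ?case by metis
qed

lemma span_u:
  assumes "goods T" "t \<le> T" "j \<le> q - 3" "a \<in> comp (t * (q - 1) + 2 + j)"
  shows "\<exists>c. a - c *s pw (u t) x j \<in> Z"
  using span_chain[OF goods_chain[OF assms(1,2)], of j a] span_u_0[OF assms(1,2)] assms by auto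

lemma span_d:
  assumes "goods T" "1 \<le> t" "t \<le> Suc T" "a \<in> comp (t * (q - 1) + 1)"
  shows "\<exists>c d. a = c *s (w t \<diamondop> x) + d *s (w t \<diamondop> y)"
proof -
  obtain k where k: "t = Suc k" using assms by (cases t) auto
  have sc: "\<exists>c. b - c *s pw (u k) x (q - 3) \<in> Z" if "b \<in> comp (k * (q - 1) + 2 + (q - 3))" for b
    using span_u[OF assms(1) _ _ that] k assms(3) by simp
  show ?thesis using assms(4) unfolding k by (rule span_diamond_gen[rotated]) (rule sc)
qed

text \<open>In a degree spanned modulo \<open>Z\<close> by one element whose image is not killed by
  \<open>x\<close>, the model decides centrality. In this way identities of the model are lifted to
  \<open>N\<close> up to central terms.\<close>

lemma det_u:
  assumes "goods T" "t \<le> T" "j \<le> q - 3" "a \<in> comp (t * (q - 1) + 2 + j)" "ph a \<oslash> XX = 0"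
  shows "a \<in> Z"
proof -
  obtain c where c: "a - c *s pw (u t) x j \<in> Z" using span_u[OF assms(1-4)] by blast
  have "ph a = ph (a - c *s pw (u t) x j) + mscale c (ph (pw (u t) x j))"
    unfolding ph_scale[symmetric] ph_add[symmetric] by simp
  hence "mscale c (ph (pw (u t) x j) \<oslash> XX) = 0"
    using assms(5) ph_Z(1)[OF c] by (simp add: mb_add mb_scale)
  moreover have "ph (pw (u t) x j) \<oslash> XX = me (q - 2 - j - 1) (ZZ (Suc t))"
    using ph_pw_u[of j t] assms(3) q5 by (simp add: mb_XX)
  ultimately have "c = 0" by (simp add: mscale_me me_eq_0_iff cst_ZZ)
  thus ?thesis using c by simp
qed

text \<open>The coordinate of \<open>[w x]\<close> is tested by \<open>y\<close> and that of
  \<open>[w y]\<close> by \<open>x\<close>. A test is blind only if \<open>al t\<close> or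
  \<open>be t\<close> vanishes, and then the element in question is central anyway.\<close>

lemma det_d:
  assumes "goods T" "1 \<le> t" "t \<le> T" "a \<in> comp (t * (q - 1) + 1)" "ph a \<oslash> XX = 0" "ph a \<oslash> YY = 0"
  shows "a \<in> Z"
proof -
  have g: "good t" using goodsD assms by blast
  obtain c d where a: "a = c *s (w t \<diamondop> x) + d *s (w t \<diamondop> y)" using span_d[OF assms(1,2) _ assms(4)] assms(3) by auto
  have pa: "ph a = mscale c (me 0 (ZZ t)) + mscale d (me (q - 1) (cst (be t) * ZZ (Suc t)))"
    unfolding a ph_add ph_scale ph_wx[OF assms(2)] ph_wy[OF assms(2)] ..
  have "me (q - 1) (cst (be t) * ZZ (Suc t)) \<oslash> YY = 0" using mb_YY[of "q - 1"] q5 by simp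
  hence "mscale c (me (q - 2) (cst (al t) * ZZ (Suc t))) = 0"
    using assms(6) mb_YY[of 0 "ZZ t"] q5 D_ZZ_gg[OF assms(2)]
    unfolding pa mb_add mb_scale by (simp add: me_minus mscale_def)
  hence "cst (c * al t) * ZZ (Suc t) = 0" by (simp add: mscale_me me_eq_0_iff mult.assoc)
  hence c: "c = 0 \<or> al t = 0" by (subst (asm) cst_ZZ) auto
  have "mscale d (me (q - 2) (cst (be t) * ZZ (Suc t))) = 0"
    using assms(5) q5 unfolding pa mb_add mb_scale by (simp add: mb_XX mscale_def numeral_2_eq_2)
  hence "cst (d * be t) * ZZ (Suc t) = 0" by (simp add: mscale_me me_eq_0_iff mult.assoc)
  hence d: "d = 0 \<or> be t = 0" by (subst (asm) cst_ZZ) auto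
  have "c *s (w t \<diamondop> x) \<in> Z" "d *s (w t \<diamondop> y) \<in> Z" using c d goodD(8,9)[OF g] by auto
  thus ?thesis unfolding a by simp
qed

lemma det_eq:
  assumes "goods T" "t \<le> T" "j \<le> q - 3" "a \<in> comp (t * (q - 1) + 2 + j)"
    "ph a = mscale c (me (q - 2 - j) (ZZ (Suc t)))"
  shows "a - c *s pw (u t) x j \<in> Z"
proof (rule det_u[OF assms(1-3)])
  show "a - c *s pw (u t) x j \<in> comp (t * (q - 1) + 2 + j)"
    using comp_diff[OF assms(4) comp_scale[OF comp_pw[OF comp_u]]] .
  show "ph (a - c *s pw (u t) x j) \<oslash> XX = 0"
    using ph_pw_u[of j t] assms(3,5) total_lie.br_zero_left[OF total_lie_model]
    by (simp add: ph_diff ph_scale)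
qed

end

context nott
begin

section \<open>Products of diamonds\<close>

text \<open>Products of two diamonds, in the degree of \<open>u (b + c)\<close>;
  \<open>Yp k c\<close> lies one degree above \<open>u (k + c)\<close>. Bracketing with
  \<open>v\<close> raises either index by one, so values can be transported along the line of all
  products of a given degree.\<close>

definition Xp :: "nat \<Rightarrow> nat \<Rightarrow> 'a" where "Xp b c = w b \<diamondop> x \<diamondop> (w c \<diamondop> y)"
definition Yp :: "nat \<Rightarrow> nat \<Rightarrow> 'a" where "Yp k c = u k \<diamondop> (w c \<diamondop> x)"

text \<open>Carried along in the induction over the diamonds; it starts the recursion
  \<open>Xp_v\<close> in each degree of the first period.\<close>

definition FP :: "nat \<Rightarrow> bool" where
  "FP m \<longleftrightarrow> (\<forall>b c. 1 \<le> b \<longrightarrow> 1 \<le> c \<longrightarrow> b + c \<le> m \<longrightarrow> b + c \<le> ps \<longrightarrow> Xp b c = 0)"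


lemma N_Xp [simp]: "Xp b c \<in> N" "Yp b c \<in> N"
  by (simp_all add: Xp_def Yp_def)

lemma Xp_v: "good b \<Longrightarrow> good c \<Longrightarrow> Xp b c \<diamondop> v = al b *s Xp (Suc b) c - be c *s Xp b (Suc c)"
  unfolding Xp_def br_deriv[of "w b \<diamondop> x" "w c \<diamondop> y" v] by (simp add: wx_v wy_v br_linear)

lemma Xp_1: "good t \<Longrightarrow> Xp t 1 = (2 * al t) *s Sg (Suc t)"
  using wx_vy[of t] unfolding Xp_def w_1 .

lemma Xp_1': "good t \<Longrightarrow> Xp 1 t = - (be t *s Sg (Suc t))"
  using wy_vx[of t] br_anti[of "v \<diamondop> x"] unfolding Xp_def w_1 by simp

lemma comp_Xp: "1 \<le> b \<Longrightarrow> 1 \<le> c \<Longrightarrow> Xp b c \<in> comp ((b + c) * (q - 1) + 2)"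
proof -
  assume "1 \<le> b" "1 \<le> c"
  moreover have "(b + c) * (q - 1) + 2 = (b * (q - 1) + 1) + (c * (q - 1) + 1)"
    by (simp add: add_mult_distrib)
  ultimately show ?thesis unfolding Xp_def by (metis comp_br comp_w_Suc)
qed

lemma comp_Yp: "1 \<le> c \<Longrightarrow> Yp k c \<in> comp ((k + c) * (q - 1) + 2 + 1)"
proof -
  assume "1 \<le> c"
  moreover have "(k + c) * (q - 1) + 2 + 1 = (k * (q - 1) + 2) + (c * (q - 1) + 1)"
    by (simp add: add_mult_distrib)
  ultimately show ?thesis unfolding Yp_def by (metis comp_br comp_u comp_w_Suc(1))
qed

lemma Yp_v:
  assumes "chain (u k)" "good (Suc k)" "good c"
  shows "Yp k c \<diamondop> v = - (2 * be (Suc k) + al (Suc k)) *s Yp (Suc k) c + al c *s Yp k (Suc c)"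
proof -
  have "u k \<diamondop> v \<diamondop> (w c \<diamondop> x) = - (2 * be (Suc k) + al (Suc k)) *s Yp (Suc k) c"
    unfolding uv_gen[OF assms(1)] Yp_def by (simp add: br_linear P_br[OF assms(2)] Q_br[OF assms(2)] lin)
  thus ?thesis unfolding Yp_def br_deriv[of "u k" "w c \<diamondop> x" v] using assms(3) by (simp add: wx_v br_linear)
qed

lemma fin_1: "fin 1" "al 1 = - 1" "be 1 = 2"
  using fin_iff(1)[of 0] al_fin[of 0] be_fin[of 0] by simp_all

lemma not_fin: "1 < k \<Longrightarrow> k \<le> ps \<Longrightarrow> \<not> fin k"
  using ps_gt(2) by (cases "k = ps") (auto simp: fin_def)

lemma not_fin': "r * ps + 1 < k \<Longrightarrow> k \<le> r * ps + ps \<Longrightarrow> \<not> fin k"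
  using fin_iff(2)[of "k - (r * ps + 1)" r] by simp

lemma Sg_Z: "good k \<Longrightarrow> \<not> fin k \<Longrightarrow> Sg k \<in> Z"
proof -
  assume g: "good k" and n: "\<not> fin k"
  have "Sg k = (P k - al k *s u k) + (Q k - be k *s u k)"
    using al_be_inf[OF n] by (simp add: Sg_def)
  thus ?thesis using goodD(4,5)[OF g] by simp
qed

lemma Sg_u: "good k \<Longrightarrow> fin k \<Longrightarrow> Sg k = u k"
  using u_fin goodD(1) by simp

lemma Yp_1: "good t \<Longrightarrow> good 1 \<Longrightarrow> Yp 1 t = - (al t *s (Sg (Suc t) \<diamondop> x))"
proof -
  assume g: "good t" and g1: "good 1"
  have "v \<diamondop> y \<diamondop> x = 2 *s u 1" using goodD(7)[OF g1 fin_1(1)] fin_1(3) unfolding Q_def w_1 by simp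
  hence "2 *s (w t \<diamondop> x \<diamondop> u 1) = w t \<diamondop> x \<diamondop> (v \<diamondop> y \<diamondop> x)" by (simp add: br_linear)
  also have "\<dots> = w t \<diamondop> x \<diamondop> (v \<diamondop> y) \<diamondop> x - A t \<diamondop> (v \<diamondop> y)" unfolding A_def by (rule br_br)
  also have "A t \<diamondop> (v \<diamondop> y) = 0" using goodD(2)[OF g] by (intro Z_br) auto
  also have "w t \<diamondop> x \<diamondop> (v \<diamondop> y) \<diamondop> x = 2 *s (al t *s (Sg (Suc t) \<diamondop> x))"
    unfolding wx_vy[OF g] by (simp add: br_linear)
  finally have "2 *s (w t \<diamondop> x \<diamondop> u 1) = 2 *s (al t *s (Sg (Suc t) \<diamondop> x))" by (simp only: diff_zero)
  hence "w t \<diamondop> x \<diamondop> u 1 = al t *s (Sg (Suc t) \<diamondop> x)" using two_nz by (simp only: scale_cancel_left) simp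
  thus ?thesis unfolding Yp_def using br_anti[of "u 1"] by simp
qed

lemma ph_Xp: "1 \<le> b \<Longrightarrow> 1 \<le> c \<Longrightarrow> ph (Xp b c) = - me (q - 2) (cst (be c) * (D (ZZ b) * ZZ (Suc c)))"
proof -
  assume bc: "1 \<le> b" "1 \<le> c"
  have "q - 1 - 1 = q - 2" "q - 1 \<noteq> 0" using q5 by simp_all
  thus ?thesis
    unfolding Xp_def ph_br[of "w b \<diamondop> x" "w c \<diamondop> y"] ph_wx[OF bc(1)] ph_wy[OF bc(2)] mb_me
    by (simp add: me_mult) (simp add: mult_ac)
qed

lemma ph_Yp: "1 \<le> c \<Longrightarrow> ph (Yp k c) = me (q - 3) (ZZ (Suc k) * D (ZZ c))"
proof -
  assume c: "1 \<le> c"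
  have "q - 2 - 1 = q - 3" "q - 2 \<noteq> 0" using q5 by simp_all
  thus ?thesis unfolding Yp_def ph_br[of "u k" "w c \<diamondop> x"] ph_wx[OF c] ph_u mb_me by (simp add: me_mult)
qed

text \<open>The exponents of \<open>\<zeta>\<close> are \<open>ps - 1 - j\<close> and
  \<open>ps - j'\<close>, both below \<open>ps\<close>, and they add up to at least
  \<open>ps\<close> as \<open>j + j' < ps\<close>.\<close>

lemma DZ0: "0 < j' \<Longrightarrow> j + j' < ps \<Longrightarrow> D (ZZ (r * ps + 1 + j)) * ZZ (r' * ps + 1 + j') = 0"
proof -
  assume j: "0 < j'" "j + j' < ps"
  have z: "zt (ps - Suc j) * zt (ps - j') = 0" using j by (intro zt_zt_0) auto
  have Z': "ZZ (r' * ps + 1 + j') = - ((-1) ^ j' * zt (ps - j') * U ^ Suc r' * gg ^ (r' * ps + 1 + j'))"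
    using j by (intro ZZ_inf) auto
  show ?thesis
  proof (cases "j = 0")
    case True
    hence D': "D (ZZ (r * ps + 1 + j)) = cst (1 - of_nat r * del) * zt (ps - Suc j) * U ^ Suc r * gg ^ (r * ps + 1 + j)"
      using D_ZZ_fin[of r] by simp
    have "D (ZZ (r * ps + 1 + j)) * ZZ (r' * ps + 1 + j') = zt (ps - Suc j) * zt (ps - j') *
      (- (cst (1 - of_nat r * del) * U ^ Suc r * gg ^ (r * ps + 1 + j) * ((-1) ^ j' * U ^ Suc r' * gg ^ (r' * ps + 1 + j'))))"
      unfolding D' Z' by (simp only: mult_ac mult_minus_left mult_minus_right)
    thus ?thesis unfolding z by simp
  next
    case False
    hence D': "D (ZZ (r * ps + 1 + j)) = - ((-1) ^ j * zt (ps - Suc j) * U ^ Suc r * gg ^ (r * ps + 1 + j))"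
      using j by (intro D_ZZ_inf) auto
    have "D (ZZ (r * ps + 1 + j)) * ZZ (r' * ps + 1 + j') = zt (ps - Suc j) * zt (ps - j') *
      ((-1) ^ j * U ^ Suc r * gg ^ (r * ps + 1 + j) * ((-1) ^ j' * U ^ Suc r' * gg ^ (r' * ps + 1 + j')))"
      unfolding D' Z' by (simp only: mult_ac mult_minus_left mult_minus_right minus_minus)
    thus ?thesis unfolding z by simp
  qed
qed

lemma low_Xp:
  assumes "goods (b + c)" "1 \<le> b" "1 \<le> c" "D (ZZ b) * ZZ (Suc c) = 0"
  shows "Xp b c \<in> Z"
proof (rule det_u[OF assms(1), of "b + c" 0])
  show "ph (Xp b c) \<oslash> XX = 0"
    using assms total_lie.br_zero_left[OF total_lie_model] by (simp add: ph_Xp)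
qed (use comp_Xp assms in auto)

lemma ZZ_ps: "ZZ (Suc r * ps) = - (zt 1 * U ^ Suc r * gg ^ (Suc r * ps))"
  and D_ZZ_ps: "D (ZZ (Suc r * ps)) = - (U ^ Suc r * gg ^ (Suc r * ps))"
proof -
  have e: "Suc r * ps = r * ps + 1 + (ps - 1)" "0 < ps - 1" "ps - 1 < ps" using ps_gt(2) by auto
  have s: "(-1) ^ (ps - 1) = (1 :: 'f coef)" using odd_ps by simp
  have d: "ps - (ps - 1) = 1" "ps - Suc (ps - 1) = 0" using ps_gt(2) by auto
  show "ZZ (Suc r * ps) = - (zt 1 * U ^ Suc r * gg ^ (Suc r * ps))"
    using ZZ_inf[OF e(2,3), of r] unfolding e(1)[symmetric] s d by simp
  show "D (ZZ (Suc r * ps)) = - (U ^ Suc r * gg ^ (Suc r * ps))"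
    using D_ZZ_inf[OF e(2,3), of r] unfolding e(1)[symmetric] s d by simp
qed

lemma zt_1_ps2: "zt (ps - 2) * zt 1 = - zt (ps - 1)"
proof -
  have e: "ps - 2 + 1 = ps - 1" using ps_gt(2) by simp
  have "(ps - 2 + 1 choose (ps - 2)) = ps - 1"
    using binomial_Suc_n[of "ps - 2"] ps_gt(2) by simp
  moreover have "of_nat (ps - 1) = (- 1 :: 'f coef)"
    using of_nat_ps_coef ps_gt(2) of_nat_diff[of 1 ps, where 'a = "'f coef"] by simp
  ultimately show ?thesis unfolding zt_zt e by simp
qed

section \<open>The type of the next diamond\<close>

context
  fixes t assumes gs: "goods t" and t1: "1 \<le> t"
begin

lemma g1: "good 1" using goodsD[OF gs] t1 by simp
lemma gt: "good t" using goodsD[OF gs] t1 by simp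
lemma gk: "1 \<le> k \<Longrightarrow> k \<le> t \<Longrightarrow> good k" using goodsD[OF gs] .
text \<open>The sign is the type \<open>-1\<close> of the second diamond; the diamonds of infinite
  type up to the next finite one add no further factor.\<close>

lemma vv_w: "Suc (Suc k) \<le> Suc t \<Longrightarrow> Suc (Suc k) \<le> Suc ps \<Longrightarrow> vv (Suc (Suc k)) = - w (Suc (Suc k))"
proof (induction k)
  case 0
  have "vv (Suc (Suc 0)) = pw (P 1) x (q - 3)"
    unfolding vv(2) vv_1[unfolded One_nat_def] P_def w_1 ..
  also have "\<dots> = - w (Suc (Suc 0))"
    using P_pw[OF g1, of "q - 3"] fin_1(2) q5 by (simp add: w_Suc)
  finally show ?case .
next
  case (Suc k)
  have g: "good (Suc (Suc k))" using gk Suc.prems by simp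
  have "vv (Suc (Suc (Suc k))) = pw (vv (Suc (Suc k)) \<diamondop> x \<diamondop> y) x (q - 3)" by (rule vv(2))
  also have "vv (Suc (Suc k)) = (- 1) *s w (Suc (Suc k))" using Suc by simp
  also have "pw (((- 1) *s w (Suc (Suc k))) \<diamondop> x \<diamondop> y) x (q - 3) = (- 1) *s pw (P (Suc (Suc k))) x (q - 3)"
    unfolding P_def br_scale_left pw_scale ..
  also have "al (Suc (Suc k)) = 1" using Suc.prems by (intro al_be_inf not_fin) auto
  hence "pw (P (Suc (Suc k))) x (q - 3) = w (Suc (Suc (Suc k)))"
    using P_pw[OF g, of "q - 3"] q5 by (simp add: w_Suc)
  finally show ?case by simp
qed

text \<open>For even \<open>Suc t\<close> the presentation gives the claim. For odd
  \<open>Suc t\<close> the line \<open>b + c = Suc t\<close> of products is computed from both ends: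
  from \<open>b = 1\<close> it consists of alternating multiples of \<open>Sg (Suc t)\<close>, and
  the end \<open>c = 1\<close> agrees with this only if \<open>4 Sg (Suc t) = 0\<close>.\<close>

lemma first_period:
  assumes fp: "FP t" and tp: "Suc t \<le> ps"
  shows "Sg (Suc t) = 0" "FP (Suc t)"
proof -
  have X0: "Xp b c = 0" if "1 \<le> b" "1 \<le> c" "b + c = t" for b c
    using fp that tp by (auto simp: FP_def)
  have ab: "al k = 1" "be k = - 1" if "1 < k" "k \<le> t" for k
    using al_be_inf[OF not_fin[of k]] that tp by auto
  have ch: "Xp b (Suc t - b) = (-1) ^ b *s Sg (Suc t)" if "2 \<le> b" "b < t" for b
    using that
  proof (induction b rule: nat_induct_at_least)
    case base
    have "0 = Xp 1 (t - 1) \<diamondop> v" using X0[of 1 "t - 1"] base by simp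
    also have "\<dots> = al 1 *s Xp 2 (t - 1) - be (t - 1) *s Xp 1 t"
      using Xp_v[OF g1 gk[of "t - 1"]] base by (simp add: numeral_2_eq_2)
    finally show ?case
      using Xp_1'[OF gt] ab[of t] ab[of "t - 1"] base fin_1(2) by (simp add: Suc_diff_Suc numeral_2_eq_2)
  next
    case (Suc b)
    define c where "c = t - b"
    have c: "1 < c" "c \<le> t" "Suc t - b = Suc c" "Suc t - Suc b = c" "b + c = t" using Suc by (auto simp: c_def)
    have "0 = Xp b c \<diamondop> v" using X0[of b c] Suc c by simp
    also have "\<dots> = al b *s Xp (Suc b) c - be c *s Xp b (Suc c)"
      using Suc c by (intro Xp_v gk) auto
    finally have "0 = Xp (Suc b) c + Xp b (Suc c)" using ab[of b] ab[of c] Suc c by simp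
    hence "Xp (Suc b) c = - Xp b (Suc c)" by (simp add: eq_neg_iff_add_eq_0)
    thus ?case using Suc c by simp
  qed
  show S: "Sg (Suc t) = 0"
  proof (cases "even (Suc t)")
    case True
    then obtain k where k: "Suc t = Suc (Suc k)" using t1 by (cases t) auto
    have "vv (Suc t) \<diamondop> y \<diamondop> x + vv (Suc t) \<diamondop> x \<diamondop> y = 0"
      using rel_even[of "Suc t"] True tp t1 by (simp add: ps_def)
    moreover have "vv (Suc t) = - w (Suc t)" using vv_w[of k] k tp by simp
    ultimately have "- Sg (Suc t) = 0" by (simp add: Sg_def P_def Q_def br_linear add.commute)
    thus ?thesis by simp
  next
    case False
    have "Sg (Suc t) + Sg (Suc t) = - (Sg (Suc t) + Sg (Suc t))"
    \<comment> \<open>For \<open>t = 2\<close> a single bracket, that of \<open>Xp 1 1\<close> with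
      \<open>v\<close>, reaches both ends at once.\<close>
    proof (cases "t = 2")
      case True
      have "0 = Xp 1 1 \<diamondop> v" using X0[of 1 1] True by simp
      also have "\<dots> = al 1 *s Xp t 1 - be 1 *s Xp 1 t"
        using Xp_v[OF g1 g1] True by (simp add: numeral_2_eq_2)
      finally have "0 = - (Sg (Suc t) + Sg (Suc t)) - (Sg (Suc t) + Sg (Suc t))"
        unfolding Xp_1[OF gt] Xp_1'[OF gt] fin_1 using ab[of t] True by (simp add: scale_numeral)
      thus ?thesis using zero_neg eq_neg_iff_add_eq_0 by blast
    next
      case False
      with \<open>\<not> even (Suc t)\<close> t1 have t3: "t > 3" "odd (t - 1)" by (presburger, simp)
      have "0 = Xp (t - 1) 1 \<diamondop> v" using X0[of "t - 1" 1] t3 by simp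
      also have "\<dots> = al (t - 1) *s Xp t 1 - be 1 *s Xp (t - 1) 2"
        using Xp_v[OF gk[of "t - 1"] g1] t3 by (simp add: numeral_2_eq_2)
      finally have "Xp t 1 = 2 *s Xp (t - 1) 2" using ab[of "t - 1"] fin_1 t3 by simp
      moreover have "Xp (t - 1) 2 = - Sg (Suc t)" using ch[of "t - 1"] t3 by simp
      ultimately show ?thesis using Xp_1[OF gt] ab[of t] t3 by (simp add: lin)
    qed
    hence "2 *s (2 *s Sg (Suc t)) = 0" unfolding scale_numeral(1) by (metis add.right_inverse)
    thus ?thesis using two_nz by (simp only: scale_eq_0_iff simp_thms)
  qed
  show "FP (Suc t)"
    unfolding FP_def
  proof (intro allI impI)
    fix b c assume bc: "1 \<le> b" "1 \<le> c" "b + c \<le> Suc t" "b + c \<le> ps"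
    show "Xp b c = 0"
    proof (cases "b + c = Suc t")
      case False
      thus ?thesis using fp bc by (auto simp: FP_def)
    next
      case True
      consider "b = 1" "c = t" | "b = t" "c = 1" | "2 \<le> b" "b < t" "c = Suc t - b" using True bc by linarith
      thus ?thesis using Xp_1[OF gt] Xp_1'[OF gt] ch[of b] S by cases auto
    qed
  qed
qed

text \<open>Here the relation with \<open>lam\<close> enters; all later finite types follow from
  it.\<close>

lemma first_finite:
  assumes tp: "t = ps"
  shows "P (Suc t) = al (Suc t) *s Sg (Suc t)" "Q (Suc t) = be (Suc t) *s Sg (Suc t)"
proof -
  obtain k where k: "t = Suc k" using t1 by (cases t) auto
  have f: "Suc t = 1 * ps + 1" using tp by simp
  have ab: "al (Suc t) = lam" "be (Suc t) = 1 - lam" unfolding f al_fin be_fin using del by simp_all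
  have "vv (Suc t) = - w (Suc t)" using vv_w[of k] k tp by simp
  hence "lam *s Q (Suc t) = (1 - lam) *s P (Suc t)"
    using rel_lam tp by (simp add: P_def Q_def br_linear ps_def[symmetric])
  hence e: "lam *s Q (Suc t) = P (Suc t) - lam *s P (Suc t)" by (simp add: scale_left_diff_distrib)
  show "P (Suc t) = al (Suc t) *s Sg (Suc t)"
    unfolding ab Sg_def scale_right_distrib e by simp
  thus "Q (Suc t) = be (Suc t) *s Sg (Suc t)"
    unfolding ab by (simp add: Sg_def scale_left_diff_distrib)
qed

text \<open>Up to a nonzero factor and modulo \<open>Z\<close>, \<open>u t\<close> is a product
  \<open>[w c x][w d y]\<close> of earlier diamonds. By the Leibniz rule \<open>[v x]\<close> acts
  on the factors and produces the central \<open>A (Suc c)\<close> and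
  \<open>Sg (Suc d)\<close>.\<close>

lemma u_vx_0:
  assumes tp: "ps < t" "t mod ps \<noteq> 0"
  shows "u t \<diamondop> (v \<diamondop> x) = 0"
proof -
  \<comment> \<open>Both \<open>d\<close> and \<open>Suc d\<close> must have infinite type, and the
    product must be nonzero in the model. The choice \<open>c = ps\<close> works unless
    \<open>t\<close> is of finite type, for then \<open>d\<close> would be too; in that case
    \<open>c = 2\<close> is taken.\<close>
  obtain c d where cd: "c + d = t" "1 \<le> c" "1 \<le> d" "\<not> fin d" "\<not> fin (Suc d)"
    and nz: "D (ZZ c) * ZZ (Suc d) \<noteq> 0"
  proof (cases "fin t")
    case False
    define d where "d = t - ps"
    have d: "ps + d = t" "1 \<le> d" using tp by (auto simp: d_def)
    have "d mod ps = t mod ps" using d(1) by (metis mod_add_self1)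
    hence nf: "\<not> fin d" "\<not> fin (Suc d)" using False tp(2) by (auto simp: fin_def mod_Suc split: if_splits)
    have "1 \<le> Suc d" by simp
    hence "D (ZZ ps) * ZZ (Suc d) \<noteq> 0"
    proof (cases rule: fin_cases)
      case (fin r)
      thus ?thesis using nf fin_iff(1) by simp
    next
      case (inf r j)
      have "D (ZZ ps) * ZZ (Suc d) = (-1) ^ j * (zt (ps - j) * U ^ (Suc (Suc r)) * gg ^ (ps + Suc d))"
        using D_ZZ_ps[of 0] unfolding inf ZZ_inf[OF inf(2,3)] by (simp add: power_add mult_ac)
      moreover have "((-1) ^ j :: 'f coef) = 1 \<or> ((-1) ^ j :: 'f coef) = - 1" by (cases "even j") auto
      ultimately show ?thesis using zt_Ug_nz[of "ps - j" "Suc (Suc r)" "ps + Suc d"] by auto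
    qed
    with d nf show ?thesis using ps_gt(2) by (intro that[of ps d]) auto
  next
    case True
    then obtain r where r: "t = r * ps + 1" using tp t1 fin_iff(2) by (cases rule: fin_cases[OF t1]) auto
    then obtain r' where r': "r = Suc r'" using tp ps_gt(2) by (cases r) auto
    define d where "d = t - 2"
    have d: "2 + d = t" "Suc d = Suc r' * ps" "1 \<le> d" using r r' ps_gt(2) by (auto simp: d_def)
    have nf: "\<not> fin (Suc d)" "\<not> fin d"
      using not_fin'[of r' "Suc d"] not_fin'[of r' d] d ps_gt(2) by auto
    have "D (ZZ 2) = zt (ps - 2) * U * gg ^ 2"
      using D_ZZ_inf[of 1 0] ps_gt(2) by (simp add: numeral_2_eq_2)
    hence "D (ZZ 2) * ZZ (Suc d) = - (zt (ps - 2) * zt 1 * (U ^ Suc (Suc r') * gg ^ (2 + Suc d)))"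
      unfolding d(2) ZZ_ps by (simp only: power_add power_Suc mult_ac mult_minus_right)
    also have "\<dots> = zt (ps - 1) * U ^ Suc (Suc r') * gg ^ (2 + Suc d)"
      unfolding zt_1_ps2 by (simp only: mult_minus_left minus_minus mult.assoc)
    finally have "D (ZZ 2) * ZZ (Suc d) \<noteq> 0" by (simp only: zt_Ug_nz simp_thms)
    with d nf show ?thesis by (intro that[of 2 d]) auto
  qed
  have gc: "good c" "good (Suc c)" "good d" "good (Suc d)" using gk cd by auto
  obtain k where k: "Xp c d - k *s u t \<in> Z"
    using span_u_0[OF gs order_refl] comp_Xp[OF cd(2,3)] cd(1) by blast
  have "k \<noteq> 0"
  proof
    assume "k = 0"
    hence "ph (Xp c d) \<oslash> XX = 0" using ph_Z(1)[OF k] by simp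
    moreover have "ph (Xp c d) = me (q - 2) (D (ZZ c) * ZZ (Suc d))"
      unfolding ph_Xp[OF cd(2,3)] using al_be_inf(2)[OF cd(4)] by (simp add: me_minus)
    ultimately have "me (q - 3) (D (ZZ c) * ZZ (Suc d)) = 0" using q5 by (simp add: mb_XX numeral_3_eq_3 numeral_2_eq_2)
    thus False using nz by (simp add: me_eq_0_iff)
  qed
  have "k *s (u t \<diamondop> (v \<diamondop> x)) = Xp c d \<diamondop> (v \<diamondop> x)"
    using Z_cong[OF k, of "v \<diamondop> x"] by (simp add: br_linear)
  also have "\<dots> = w c \<diamondop> x \<diamondop> (v \<diamondop> x) \<diamondop> (w d \<diamondop> y) + w c \<diamondop> x \<diamondop> (w d \<diamondop> y \<diamondop> (v \<diamondop> x))"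
    unfolding Xp_def by (rule br_deriv)
  also have "\<dots> = al c *s (A (Suc c) \<diamondop> (w d \<diamondop> y)) + be d *s (w c \<diamondop> x \<diamondop> Sg (Suc d))"
    by (simp add: wx_vx[OF gc(1)] wy_vx[OF gc(3)] br_linear)
  also have "A (Suc c) \<diamondop> (w d \<diamondop> y) = 0" using goodD(2)[OF gc(2)] by (intro Z_br) auto
  also have "w c \<diamondop> x \<diamondop> Sg (Suc d) = 0" using Sg_Z[OF gc(4) cd(5)] by (intro Z_br') auto
  finally show ?thesis using \<open>k \<noteq> 0\<close> by simp
qed

end

end

context nott
begin

lemma fin_ex: "1 \<le> k \<Longrightarrow> fin k \<Longrightarrow> \<exists>r. k = r * ps + 1"
proof (erule fin_cases)
  fix r assume "k = r * ps + 1"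
  thus ?thesis by blast
qed (use fin_iff(2) in blast)+

lemma zero_add_neg: "(0::'a) = a + b \<Longrightarrow> b = - a"
proof -
  assume e: "(0::'a) = a + b"
  have "b = (a + b) - a" by simp
  thus ?thesis unfolding e[symmetric] by simp
qed

lemma Z_I: "a \<diamondop> x = 0 \<Longrightarrow> a \<diamondop> y = 0 \<Longrightarrow> a \<in> Z"
  unfolding Z_def by blast

context
  fixes t assumes gs: "goods t" and t1: "1 \<le> t"
begin

lemma gj: "1 \<le> k \<Longrightarrow> k \<le> t \<Longrightarrow> good k"
  by (rule goodsD[OF gs])

lemma gsj: "k \<le> t \<Longrightarrow> goods k"
  using gs by (auto simp: goods_def)

section \<open>Diamonds after one of type 1\<close>

text \<open>The products \<open>Yp k c\<close> are transported by \<open>v\<close> twice, starting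
  from a degree where they are central. This expresses a line of products by the unknown
  \<open>T\<close> and an auxiliary \<open>W\<close>. A bracket with \<open>w ps\<close> instead of
  \<open>v\<close> evaluates one more product; comparison cancels \<open>W\<close> and leaves
  \<open>al C\<close> times \<open>T\<close>, where \<open>C\<close> is the previous diamond of
  finite type.\<close>

lemma A_y:
  assumes ty: "be t = 0" and tp: "ps < t" and E: "u t \<diamondop> (v \<diamondop> x) = 0"
  shows "A (Suc t) \<diamondop> y = 0"
proof -
  have ft: "fin t" using al_be_inf(2)[of t] ty by force
  then obtain r where r: "t = r * ps + 1" using fin_iff(2) by (cases rule: fin_cases[OF t1]) auto
  have al: "al t = 1" using al_be_1[OF ft] ty by simp
  obtain r' where r': "r = Suc r'" using r tp ps_gt(2) by (cases r) auto
  define C where "C = r' * ps + 1"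
  have tC: "t = C + ps" "1 \<le> C" using r r' by (auto simp: C_def)
  define T where "T = A (Suc t) \<diamondop> y"
  define W where "W = u t \<diamondop> x \<diamondop> v"
  have g: "good t" and g1: "good 1" using gj t1 by auto
  have SxT: "Sg (Suc t) \<diamondop> x = - T"
    using E u_vx[OF g] by (simp add: T_def eq_neg_iff_add_eq_0)
  have Y1: "Yp 1 t = T" using Yp_1[OF g g1] al SxT by simp
  have ninf: "\<not> fin k" "al k = 1" "be k = - 1" if "C < k" "k < t" for k
    using not_fin'[of r' k] al_be_inf[of k] that tC(1) by (auto simp: C_def)
  have small: "\<not> fin k" "al k = 1" "be k = - 1" if "1 < k" "k \<le> ps" for k
    using not_fin[of k] al_be_inf[of k] that by auto
  have chn: "chain (u k)" if "k \<le> t" for k using goods_chain[OF gs that] .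
  have fC: "fin C" using fin_iff(1) C_def by simp
  have low: "Yp k (t - 1 - k) \<in> Z" if k: "1 \<le> k" "k < ps" for k
  proof (rule det_u[OF gsj, of "t - 1" "t - 1" 1])
    have c: "t - 1 - k = r' * ps + 1 + (ps - 1 - k)" using k r r' by simp
    have "D (ZZ (t - 1 - k)) * ZZ (0 * ps + 1 + k) = 0"
      unfolding c by (rule DZ0) (use k in auto)
    moreover have "1 \<le> t - 1 - k" using c by simp
    ultimately show "ph (Yp k (t - 1 - k)) \<oslash> XX = 0"
      using total_lie.br_zero_left[OF total_lie_model] by (simp add: ph_Yp mult.commute)
    have "Yp k (t - 1 - k) \<in> comp ((k + (t - 1 - k)) * (q - 1) + 2 + 1)"
      using c by (intro comp_Yp) simp
    thus "Yp k (t - 1 - k) \<in> comp ((t - 1) * (q - 1) + 2 + 1)" using k tC by simp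
  qed (use q5 t1 in auto)
  \<comment> \<open>First transport: the line through \<open>[u t x]\<close>, anchored at
    \<open>Yp 1 (t - 1)\<close>.\<close>
  have m: "Yp k (t - k) = (-1) ^ k *s (u t \<diamondop> x)" if "1 \<le> k" "k < ps" for k
    using that
  proof (induction k rule: nat_induct_at_least)
    case base
    have "Yp 1 (t - 1) = - (al (t - 1) *s (Sg (Suc (t - 1)) \<diamondop> x))"
      using tp ps_gt(2) by (intro Yp_1 g1 gj) auto
    also have "al (t - 1) = 1" using tC ps_gt(2) by (intro ninf) auto
    finally show ?case using Sg_u[OF g ft] t1 by simp
  next
    case (Suc k)
    define c where "c = t - 1 - k"
    have c: "C < c" "c < t" "Suc c = t - k" "t - Suc k = c" using Suc tC by (auto simp: c_def)
    have "0 = Yp k c \<diamondop> v" using low[of k] Suc c_def by (simp add: Z_br)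
    also have "\<dots> = - (2 * be (Suc k) + al (Suc k)) *s Yp (Suc k) c + al c *s Yp k (Suc c)"
      using Suc c tC by (intro Yp_v chn gj) auto
    finally have "0 = Yp (Suc k) c + Yp k (Suc c)" using small[of "Suc k"] ninf[of c] c Suc by simp
    hence "Yp (Suc k) c = - Yp k (Suc c)" by (simp add: eq_neg_iff_add_eq_0)
    thus ?case using Suc c by simp
  qed
  have mps: "Yp ps C = - al C *s (u t \<diamondop> x)"
  proof -
    define k where "k = ps - 1"
    have k: "Suc k = ps" "1 \<le> k" "k < ps" "t - 1 - k = C" "t - k = Suc C" "even k"
      using tC ps_gt(2) odd_ps by (auto simp: k_def)
    have "0 = Yp k C \<diamondop> v" using low[of k] k by (simp add: Z_br)
    also have "\<dots> = - (2 * be (Suc k) + al (Suc k)) *s Yp (Suc k) C + al C *s Yp k (Suc C)"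
      using k tC by (intro Yp_v chn gj) auto
    also have "Yp k (Suc C) = u t \<diamondop> x" using m[of k] k by simp
    finally have "0 = Yp ps C + al C *s (u t \<diamondop> x)" using small[of ps] ps_gt(2) k by simp
    thus ?thesis by (simp add: eq_neg_iff_add_eq_0)
  qed
  \<comment> \<open>Second transport: each step adds the inhomogeneous term \<open>(-1)^k W\<close>,
    and these accumulate to the factor \<open>k - 1\<close>.\<close>
  have ch: "Yp k (t + 1 - k) = (-1) ^ Suc k *s T - ((-1) ^ k * of_nat (k - 1)) *s W"
    if "1 \<le> k" "k \<le> ps" for k
    using that
  proof (induction k rule: nat_induct_at_least)
    case base
    show ?case using Y1 by simp
  next
    case (Suc k)
    define c where "c = t - k"
    have c: "C < c" "c < t" "t + 1 - k = Suc c" "t + 1 - Suc k = c" using Suc tC by (auto simp: c_def)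
    have "(-1) ^ k *s W = Yp k c \<diamondop> v" using m[of k] Suc unfolding c_def W_def by (simp add: br_linear)
    also have "\<dots> = - (2 * be (Suc k) + al (Suc k)) *s Yp (Suc k) c + al c *s Yp k (Suc c)"
      using Suc c tC by (intro Yp_v chn gj) auto
    finally have "(-1) ^ k *s W = Yp (Suc k) c + Yp k (Suc c)" using small[of "Suc k"] ninf[of c] c Suc by simp
    hence "Yp (Suc k) c = (-1) ^ k *s W - Yp k (Suc c)" by simp
    also have "Yp k (Suc c) = (-1) ^ Suc k *s T - ((-1) ^ k * of_nat (k - 1)) *s W" using Suc c by simp
    finally have e: "Yp (Suc k) c = (-1) ^ k *s W - ((-1) ^ Suc k *s T - ((-1) ^ k * of_nat (k - 1)) *s W)" .
    show ?case
      unfolding c(4) e using Suc.hyps by (cases k) (simp_all add: lin algebra_simps)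
  qed
  have Yps: "Yp ps (Suc C) = T - W"
  proof -
    have "of_nat (ps - 1) = (- 1 :: 'f)" using ps_0 ps_gt(2) of_nat_diff[of 1 ps, where 'a = 'f] by simp
    moreover have "t + 1 - ps = Suc C" using tC by simp
    ultimately show ?thesis using ch[of ps] ps_gt(2) odd_ps by simp
  qed
  \<comment> \<open>\<open>Yp 1 C\<close> vanishes; bracketing it with \<open>w ps\<close> turns
    \<open>u 1\<close> into \<open>u (Suc ps)\<close> modulo \<open>Z\<close> and
    \<open>[w C x]\<close> into a central element.\<close>
  have YK: "Yp (Suc ps) C = 0"
  proof -
    have SC: "Sg (Suc C) \<in> Z" using tC ps_gt(2) by (intro Sg_Z gj ninf) auto
    have "Yp 1 C = 0" using Yp_1[of C] gj[of C] g1 tC SC by simp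
    hence "0 = Yp 1 C \<diamondop> w ps" by simp
    also have "\<dots> = u 1 \<diamondop> w ps \<diamondop> (w C \<diamondop> x) + u 1 \<diamondop> (w C \<diamondop> x \<diamondop> w ps)"
      unfolding Yp_def by (rule br_deriv)
    also have "u 1 \<diamondop> (w C \<diamondop> x \<diamondop> w ps) = 0"
    proof (rule Z_br')
      show "w C \<diamondop> x \<diamondop> w ps \<in> Z"
      proof (rule det_d[OF gs t1 order_refl])
        have "w C \<diamondop> x \<diamondop> w ps \<in> comp ((C * (q - 1) + 1) + ps * (q - 1))"
          using tC ps_gt(2) by (intro comp_br comp_w_Suc comp_w) auto
        moreover have "(C * (q - 1) + 1) + ps * (q - 1) = t * (q - 1) + 1"
          using tC by (simp add: add_mult_distrib)
        ultimately show "w C \<diamondop> x \<diamondop> w ps \<in> comp (t * (q - 1) + 1)" by simp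
        have "D (ZZ (r' * ps + 1 + 0)) * ZZ (0 * ps + 1 + (ps - 1)) = 0"
          using ps_gt(2) by (intro DZ0) auto
        hence "D (ZZ C) * ZZ ps = 0" using ps_gt(2) by (simp add: C_def)
        hence "ph (w C \<diamondop> x \<diamondop> w ps) = 0"
          using tC ps_gt(2) unfolding ph_br[of "w C \<diamondop> x" "w ps"] by (simp add: ph_wx ph_w mb_W mb_W[unfolded One_nat_def])
        thus "ph (w C \<diamondop> x \<diamondop> w ps) \<oslash> XX = 0" "ph (w C \<diamondop> x \<diamondop> w ps) \<oslash> YY = 0"
          using total_lie.br_zero_left[OF total_lie_model] by simp_all
      qed
    qed simp
    also have "u 1 \<diamondop> w ps \<diamondop> (w C \<diamondop> x) = u (Suc ps) \<diamondop> (w C \<diamondop> x)"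
    proof (rule Z_cong)
      have "u 1 \<diamondop> w ps - 1 *s pw (u (Suc ps)) x 0 \<in> Z"
      proof (rule det_eq[OF gs])
        have "u 1 \<diamondop> w ps \<in> comp ((1 * (q - 1) + 2) + ps * (q - 1))"
          using ps_gt(2) by (intro comp_br comp_u comp_w) auto
        thus "u 1 \<diamondop> w ps \<in> comp (Suc ps * (q - 1) + 2 + 0)" by (simp add: add_ac)
        have Z2: "ZZ 2 = zt (ps - 1) * U * gg ^ 2" and DZ2: "D (ZZ 2) = zt (ps - 2) * U * gg ^ 2"
          using ZZ_inf[of 1 0] D_ZZ_inf[of 1 0] ps_gt(2) by (simp_all add: numeral_2_eq_2)
        have ZK: "ZZ (Suc (Suc ps)) = zt (ps - 1) * U ^ 2 * gg ^ Suc (Suc ps)"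
          using ZZ_inf[of 1 1] ps_gt(2) by (simp add: numeral_2_eq_2)
        have Zp: "ZZ ps = - (zt 1 * U * gg ^ ps)" "D (ZZ ps) = - (U * gg ^ ps)"
          using ZZ_ps[of 0] D_ZZ_ps[of 0] by simp_all
        have q2: "of_nat (q - 2) = (- 2 :: 'f coef)"
          using of_nat_q2 by (metis hconst_of_nat hconst_simps(2,3,5) one_add_one)
        have "of_nat (q - 2) * ZZ 2 * D (ZZ ps) = 2 * (zt (ps - 1) * (U ^ 2 * gg ^ Suc (Suc ps)))"
          unfolding q2 Z2 Zp(2) by (simp add: power2_eq_square mult_ac)
        moreover have "D (ZZ 2) * ZZ ps = - (zt (ps - 2) * zt 1 * (U ^ 2 * gg ^ Suc (Suc ps)))"
          unfolding DZ2 Zp(1) by (simp add: power2_eq_square mult_ac)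
        hence "D (ZZ 2) * ZZ ps = zt (ps - 1) * (U ^ 2 * gg ^ Suc (Suc ps))"
          unfolding zt_1_ps2 by simp
        ultimately have e: "of_nat (q - 2) * ZZ 2 * D (ZZ ps) - D (ZZ 2) * ZZ ps = ZZ (Suc (Suc ps))"
          unfolding ZK by (simp add: mult.assoc)
        have "ph (u 1 \<diamondop> w ps) = me (q - 2) (ZZ (Suc (Suc ps)))"
          unfolding ph_br[of "u 1" "w ps"] ph_u using ps_gt(2) e by (simp add: ph_w mb_W mb_W[unfolded One_nat_def] numeral_2_eq_2)
        thus "ph (u 1 \<diamondop> w ps) = mscale 1 (me (q - 2 - 0) (ZZ (Suc (Suc ps))))" by (simp add: mscale_def)
      qed (use tC in auto)
      thus "u 1 \<diamondop> w ps - u (Suc ps) \<in> Z" by simp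
    qed simp
    finally show ?thesis by (simp add: Yp_def)
  qed
  have "- (al C *s W) = Yp ps C \<diamondop> v" unfolding mps W_def by (simp add: br_linear)
  also have "\<dots> = - (2 * be (Suc ps) + al (Suc ps)) *s Yp (Suc ps) C + al C *s Yp ps (Suc C)"
    using tC by (intro Yp_v chn gj) auto
  finally have "al C *s T = 0" unfolding YK Yps by (simp add: lin)
  \<comment> \<open>Type 1 at \<open>t\<close> means \<open>r * del - 1 = 1\<close>; one period
    earlier the type is therefore \<open>1 - del = - lam\<close>, which is nonzero.\<close>
  moreover have "al C \<noteq> 0"
  proof -
    have "of_nat r * del - 1 = 1" using al al_fin[of r] r by simp
    hence "of_nat r' * del + del - 1 = 1" using r' by (simp add: algebra_simps)
    hence e: "of_nat r' * del = 2 - del" by (simp add: eq_diff_eq diff_eq_eq)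
    have "al C = of_nat r' * del - 1" by (simp only: C_def al_fin)
    also have "\<dots> = - lam" unfolding e using del by simp
    finally show ?thesis using lam by simp
  qed
  ultimately show ?thesis by (simp add: T_def)
qed

end

section \<open>The arithmetic progression of types\<close>

text \<open>Transport along \<open>b + c = Suc t\<close> from \<open>b = 1\<close> to
  \<open>b = ps\<close>. The preceding line is central by the model, and only the last step crosses
  the finite diamond \<open>Suc R * ps + 1\<close>, which contributes \<open>be\<close>.\<close>

lemma up_chain:
  assumes gs: "goods t" and t: "t = Suc (Suc R) * ps"
  shows "Xp 1 t = Sg (Suc t)" "Xp ps (Suc R * ps + 1) = be (Suc R * ps + 1) *s Sg (Suc t)"
proof -
  have gj: "good k" if "1 \<le> k" "k \<le> t" for k using goodsD[OF gs that] .
  have big: "\<not> fin k" "al k = 1" "be k = - 1" if "Suc R * ps + 1 < k" "k \<le> t" for k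
    using not_fin'[of "Suc R" k] al_be_inf[of k] that t by auto
  have small: "al k = 1" "be k = - 1" if "1 < k" "k \<le> ps" for k
    using not_fin[of k] al_be_inf[of k] that by auto
  have ps: "ps > 3" by (rule ps_gt)
  show X1: "Xp 1 t = Sg (Suc t)"
    using Xp_1'[of t] gj[of t] big[of t] t ps by simp
  have ch: "Xp b (Suc t - b) = (-1) ^ b *s Sg (Suc t)" if "2 \<le> b" "b < ps" for b
    using that
  proof (induction b rule: nat_induct_at_least)
    case base
    have "Xp 1 (t - 1) = Sg t" using Xp_1'[of "t - 1"] gj[of "t - 1"] big[of "t - 1"] t ps by simp
    hence "Xp 1 (t - 1) \<in> Z" using Sg_Z[of t] gj[of t] big[of t] t ps by simp
    hence "0 = Xp 1 (t - 1) \<diamondop> v" by (simp add: Z_br)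
    also have "\<dots> = al 1 *s Xp 2 (t - 1) - be (t - 1) *s Xp 1 t"
      using Xp_v[of 1 "t - 1"] gj t ps by (simp add: numeral_2_eq_2)
    finally have "0 = - Xp 2 (t - 1) + Sg (Suc t)"
      using X1 big[of "t - 1"] fin_1(2) t ps by simp
    moreover have "Suc t - 2 = t - 1" by simp
    ultimately show ?case by (simp add: neg_eq_iff_add_eq_0)
  next
    case (Suc b)
    define c where "c = t - b"
    have e: "Suc c = Suc R * ps + 1 + (ps - b)" "Suc R * ps + 1 < c" using Suc t by (auto simp: c_def)
    have c: "c \<le> t" "Suc t - b = Suc c" "Suc t - Suc b = c" "b + c = t" "1 \<le> c" using Suc t by (auto simp: c_def)
    have "D (ZZ (0 * ps + 1 + (b - 1))) * ZZ (Suc R * ps + 1 + (ps - b)) = 0"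
      using Suc by (intro DZ0) auto
    moreover have "0 * ps + 1 + (b - 1) = b" using Suc by simp
    ultimately have "D (ZZ b) * ZZ (Suc c) = 0" by (simp only: e(1))
    moreover have "goods (b + c)" using gs unfolding c(4) .
    ultimately have "Xp b c \<in> Z" using Suc.hyps c(5) by (intro low_Xp) simp_all
    hence "0 = Xp b c \<diamondop> v" by (simp add: Z_br)
    also have "\<dots> = al b *s Xp (Suc b) c - be c *s Xp b (Suc c)"
      using Suc c t by (intro Xp_v gj) auto
    also have "al b = 1" using Suc.hyps Suc.prems by (intro small(1)) simp_all
    also have "be c = - 1" by (rule big(3)[OF e(2) c(1)])
    finally have "0 = Xp (Suc b) c + Xp b (Suc c)" by simp
    hence "Xp (Suc b) c = - Xp b (Suc c)" by (simp add: eq_neg_iff_add_eq_0)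
    thus ?case using Suc c by simp
  qed
  define c where "c = Suc R * ps + 1"
  define b where "b = ps - 1"
  have bc: "b + c = t" "Suc b = ps" "1 \<le> b" "b < ps" "2 \<le> b" "1 \<le> c" "c \<le> t" "Suc t - b = Suc c" "even b"
    using t ps odd_ps by (auto simp: b_def c_def)
  have "D (ZZ (0 * ps + 1 + (b - 1))) * ZZ (Suc R * ps + 1 + 1) = 0"
    using bc by (intro DZ0) auto
  moreover have "0 * ps + 1 + (b - 1) = b" "Suc R * ps + 1 + 1 = Suc c" using bc by (simp_all add: c_def)
  ultimately have "D (ZZ b) * ZZ (Suc c) = 0" by (simp only:)
  moreover have "goods (b + c)" using gs unfolding bc(1) .
  ultimately have "Xp b c \<in> Z" using bc(3,6) by (intro low_Xp) simp_all
  hence "0 = Xp b c \<diamondop> v" by (simp add: Z_br)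
  also have "\<dots> = al b *s Xp (Suc b) c - be c *s Xp b (Suc c)"
    using bc t by (intro Xp_v gj) auto
  also have "Xp b (Suc c) = Sg (Suc t)" using ch[of b] bc by simp
  finally show "Xp ps (Suc R * ps + 1) = be (Suc R * ps + 1) *s Sg (Suc t)"
    using small[of b] bc by (simp add: c_def)
qed

text \<open>The mirror image, from \<open>c = 1\<close> to \<open>c = ps\<close>: the finite diamond
  is now the left factor and contributes \<open>al\<close>.\<close>

lemma down_chain:
  assumes gs: "goods t" and t: "t = Suc (Suc R) * ps"
  shows "Xp (Suc R * ps + 1) ps = - (al (Suc R * ps + 1) *s Sg (Suc t))"
proof -
  have gj: "good k" if "1 \<le> k" "k \<le> t" for k using goodsD[OF gs that] .
  have big: "\<not> fin k" "al k = 1" "be k = - 1" if "Suc R * ps + 1 < k" "k \<le> t" for k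
    using not_fin'[of "Suc R" k] al_be_inf[of k] that t by auto
  have small: "al k = 1" "be k = - 1" if "1 < k" "k \<le> ps" for k
    using not_fin[of k] al_be_inf[of k] that by auto
  have ps: "ps > 3" by (rule ps_gt)
  have low: "Xp (t - c) c \<in> Z" if "2 \<le> c" "c < ps" for c
  proof -
    have e: "t - c = Suc R * ps + 1 + (ps - 1 - c)" using that t by auto
    have "D (ZZ (Suc R * ps + 1 + (ps - 1 - c))) * ZZ (0 * ps + 1 + c) = 0"
      using that by (intro DZ0) auto
    moreover have "0 * ps + 1 + c = Suc c" by simp
    ultimately have "D (ZZ (t - c)) * ZZ (Suc c) = 0" by (simp only: e)
    moreover have "t - c + c = t" "1 \<le> t - c" using e that t by simp_all
    moreover from this have "goods (t - c + c)" using gs by simp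
    ultimately show ?thesis using that by (intro low_Xp) simp_all
  qed
  have ch: "Xp (Suc t - c) c = (-1) ^ c *s Sg (Suc t)" if "2 \<le> c" "c < ps" for c
    using that
  proof (induction c rule: nat_induct_at_least)
    case base
    have "Xp (t - 1) 1 = 2 *s Sg t" using Xp_1[of "t - 1"] gj[of "t - 1"] big[of "t - 1"] t ps by simp
    hence "Xp (t - 1) 1 \<in> Z" using Sg_Z[of t] gj[of t] big[of t] t ps by simp
    hence "0 = Xp (t - 1) 1 \<diamondop> v" by (simp add: Z_br)
    also have "\<dots> = al (t - 1) *s Xp t 1 - be 1 *s Xp (t - 1) 2"
      using Xp_v[of "t - 1" 1] gj t ps by (simp add: numeral_2_eq_2)
    also have "Xp t 1 = 2 *s Sg (Suc t)" using Xp_1[of t] gj[of t] big[of t] t ps by simp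
    finally have "0 = 2 *s (Sg (Suc t) - Xp (t - 1) 2)"
      using big[of "t - 1"] fin_1(3) t ps by (simp add: scale_right_diff_distrib)
    hence "Sg (Suc t) - Xp (t - 1) 2 = 0" using two_nz by (metis scale_eq_0_iff)
    moreover have "Suc t - 2 = t - 1" by simp
    ultimately show ?case by simp
  next
    case (Suc c)
    define b where "b = t - c"
    have b: "Suc R * ps + 1 < b" "b \<le> t" "Suc t - c = Suc b" "Suc t - Suc c = b" "1 \<le> b" using Suc t by (auto simp: b_def)
    have "0 = Xp b c \<diamondop> v" using low[of c] Suc by (simp add: Z_br b_def)
    also have "\<dots> = al b *s Xp (Suc b) c - be c *s Xp b (Suc c)"
      using Suc b t by (intro Xp_v gj) auto
    also have "al b = 1" by (rule big(2)[OF b(1,2)])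
    also have "be c = - 1" using Suc.hyps Suc.prems by (intro small(2)) simp_all
    finally have "0 = Xp (Suc b) c + Xp b (Suc c)" by simp
    hence "Xp b (Suc c) = - Xp (Suc b) c" by (simp add: eq_neg_iff_add_eq_0 add.commute)
    thus ?case using Suc b by simp
  qed
  define b where "b = Suc R * ps + 1"
  define c where "c = ps - 1"
  have bc: "t - c = b" "Suc c = ps" "1 \<le> c" "c < ps" "2 \<le> c" "1 \<le> b" "b \<le> t" "c \<le> t" "Suc t - c = Suc b" "even c"
    using t ps odd_ps by (auto simp: b_def c_def)
  have "0 = Xp b c \<diamondop> v" using low[of c] bc by (simp add: Z_br)
  also have "\<dots> = al b *s Xp (Suc b) c - be c *s Xp b (Suc c)"
    using bc by (intro Xp_v gj) auto
  also have "Xp (Suc b) c = Sg (Suc t)" using ch[of c] bc by simp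
  also have "be c = - 1" using bc by (intro small(2)) simp_all
  finally have "0 = al b *s Sg (Suc t) - (- 1) *s Xp b ps" unfolding bc(2) .
  hence e0: "0 = al b *s Sg (Suc t) + Xp b ps"
    by (metis scale_minus_left scale_one diff_minus_eq_add)
  have e: "Xp b ps = - (al b *s Sg (Suc t))"
    by (rule zero_add_neg[OF e0])
  show ?thesis
    by (rule e[unfolded b_def])
qed

text \<open>\<open>up_chain\<close> stops at the left factor \<open>w ps\<close>. The product with
  \<open>w (Suc ps)\<close> is therefore taken at \<open>2 * ps\<close> and raised by a bracket with
  \<open>w k\<close>, which shifts \<open>[w ps x]\<close> and \<open>Sg\<close> by \<open>k\<close>
  and makes \<open>[w (Suc ps) y]\<close> central.\<close>

lemma shift_product:
  assumes gs: "goods t" and t: "t = Suc (Suc (Suc R)) * ps"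
  shows "Xp (Suc (Suc R) * ps) (Suc ps) = be (Suc ps) *s Sg (Suc t)"
proof -
  define k where "k = Suc R * ps"
  have ps: "ps > 3" by (rule ps_gt)
  have tk: "t = 2 * ps + k" "Suc (Suc R) * ps = ps + k" "ps \<le> k" "1 \<le> k" using t ps by (auto simp: k_def)
  have t1: "1 \<le> t" using tk by simp
  have gj: "good j" if "1 \<le> j" "j \<le> t" for j using goodsD[OF gs that] .
  have gs2: "goods (2 * ps)" using gs tk by (auto simp: goods_def)
  have up: "Xp 1 (2 * ps) = Sg (Suc (2 * ps))" "Xp ps (Suc ps) = be (Suc ps) *s Sg (Suc (2 * ps))"
    using up_chain[OF gs2, of 0] by simp_all
  have up_t: "Xp 1 t = Sg (Suc t)" by (rule up_chain(1)[OF gs t])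
  have nk: "\<not> fin k" using not_fin'[of R k] ps by (simp add: k_def)
  have n2: "be (2 * ps) = - 1" and nt: "be t = - 1"
    using al_be_inf(2)[OF not_fin'[of 1 "2 * ps"]] al_be_inf(2)[OF not_fin'[of "Suc (Suc R)" t]] ps t by auto
  have mz: "0 \<oslash> h = 0" for h by (rule total_lie.br_zero_left[OF total_lie_model])
  have ZZk: "ZZ k = - (zt 1 * U ^ Suc R * gg ^ k)" and DZk: "D (ZZ k) = - (U ^ Suc R * gg ^ k)"
    unfolding k_def by (rule ZZ_ps, rule D_ZZ_ps)
  have w1k: "w 1 \<diamondop> x \<diamondop> w k = 0"
    using w_vx[OF gj[of k]] br_anti[of "v \<diamondop> x" "w k"] al_be_inf[OF nk] tk w_1 by simp
  have a1: "w (2 * ps) \<diamondop> y \<diamondop> w k - w t \<diamondop> y \<in> Z"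
  proof (rule det_d[OF gs _ order_refl])
    have "w (2 * ps) \<diamondop> y \<diamondop> w k \<in> comp ((2 * ps * (q - 1) + 1) + k * (q - 1))"
      using tk ps by (intro comp_br comp_w_Suc comp_w) auto
    moreover have "(2 * ps * (q - 1) + 1) + k * (q - 1) = t * (q - 1) + 1"
      unfolding tk(1) by (simp add: add_mult_distrib)
    ultimately have "w (2 * ps) \<diamondop> y \<diamondop> w k \<in> comp (t * (q - 1) + 1)" by (simp only:)
    thus "w (2 * ps) \<diamondop> y \<diamondop> w k - w t \<diamondop> y \<in> comp (t * (q - 1) + 1)"
      by (rule comp_diff[OF _ comp_w_Suc(2)[OF t1]])
    have Z2: "ZZ (Suc (2 * ps)) = U ^ 2 * gg ^ Suc (2 * ps)" using ZZ_fin[of 2] by simp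
    have Zt: "ZZ (Suc t) = U ^ Suc (Suc (Suc R)) * gg ^ Suc t" using ZZ_fin[of "Suc (Suc (Suc R))"] t by simp
    have pr: "ZZ (Suc (2 * ps)) * ZZ k = - (zt 1 * (U ^ Suc (Suc (Suc R)) * gg ^ Suc t))"
      unfolding Z2 ZZk tk(1) by (simp add: power_add power2_eq_square mult_ac)
    have z1: "zt 1 * D (U ^ Suc (Suc (Suc R)) * gg ^ Suc t) = 0"
    proof -
      have "zt 1 * D (U ^ Suc (Suc (Suc R)) * gg ^ Suc t) = zt 1 * zt (ps - 1) *
        ((of_nat (Suc t) - of_nat (Suc (Suc (Suc R))) * cst del) * U ^ Suc (Suc (Suc (Suc R))) * gg ^ Suc t)"
        unfolding D_Ug by (simp only: mult_ac)
      thus ?thesis using zt_ps_0[of 1] ps by simp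
    qed
    have "D (ZZ (Suc (2 * ps)) * ZZ k) = - ZZ (Suc t)"
      unfolding pr Zt derivation_minus[OF derivation_dz] derivation_mult[OF derivation_dz, of ps "zt 1"] z1 D_zt
      by simp
    moreover have "of_nat (q - 1) = (- 1 :: 'f coef)"
    proof -
      have "of_nat (q - 1) = (- 1 :: 'f)" using q_0 q5 of_nat_diff[of 1 q, where 'a = 'f] by simp
      thus ?thesis by (metis hconst_of_nat hconst_simps(2,5))
    qed
    moreover have "ph (w (2 * ps) \<diamondop> y) = me (q - 1) (- ZZ (Suc (2 * ps)))"
      using ph_wy[of "2 * ps"] ps n2 by simp
    ultimately have "ph (w (2 * ps) \<diamondop> y \<diamondop> w k) = me (q - 1) (- ZZ (Suc t))"
      unfolding ph_br[of "w (2 * ps) \<diamondop> y" "w k"] using tk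
      by (simp add: ph_w mb_W mb_W[unfolded One_nat_def] derivation_mult[OF derivation_dz] derivation_minus[OF derivation_dz] add.commute)
    hence "ph (w (2 * ps) \<diamondop> y \<diamondop> w k - w t \<diamondop> y) = 0"
      unfolding ph_diff using ph_wy[of t] tk nt by simp
    thus "ph (w (2 * ps) \<diamondop> y \<diamondop> w k - w t \<diamondop> y) \<oslash> XX = 0" "ph (w (2 * ps) \<diamondop> y \<diamondop> w k - w t \<diamondop> y) \<oslash> YY = 0"
      using mz by simp_all
  qed (use tk in simp)
  \<comment> \<open>\<open>Sg (Suc (2 * ps))\<close> is the product \<open>Xp 1 (2 * ps)\<close>,
    whose first factor commutes with \<open>w k\<close>.\<close>
  have S: "Sg (Suc (2 * ps)) \<diamondop> w k = Sg (Suc t)"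
  proof -
    have "Sg (Suc (2 * ps)) \<diamondop> w k = w 1 \<diamondop> x \<diamondop> w k \<diamondop> (w (2 * ps) \<diamondop> y) + w 1 \<diamondop> x \<diamondop> (w (2 * ps) \<diamondop> y \<diamondop> w k)"
      unfolding up(1)[symmetric] Xp_def by (rule br_deriv)
    also have "w 1 \<diamondop> x \<diamondop> (w (2 * ps) \<diamondop> y \<diamondop> w k) = w 1 \<diamondop> x \<diamondop> (w t \<diamondop> y)"
      by (rule Z_cong'[OF a1]) simp
    finally show ?thesis using w1k up_t by (simp add: Xp_def)
  qed
  have pk: "1 \<le> ps + k" "ps + k \<le> t" using tk by auto
  have a2: "w ps \<diamondop> x \<diamondop> w k - w (ps + k) \<diamondop> x \<in> Z"
  proof (rule det_d[OF gs pk])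
    have "w ps \<diamondop> x \<diamondop> w k \<in> comp ((ps * (q - 1) + 1) + k * (q - 1))"
      using tk ps by (intro comp_br comp_w_Suc comp_w) auto
    moreover have "(ps * (q - 1) + 1) + k * (q - 1) = (ps + k) * (q - 1) + 1"
      by (simp add: add_mult_distrib)
    ultimately have "w ps \<diamondop> x \<diamondop> w k \<in> comp ((ps + k) * (q - 1) + 1)" by (simp only:)
    thus "w ps \<diamondop> x \<diamondop> w k - w (ps + k) \<diamondop> x \<in> comp ((ps + k) * (q - 1) + 1)"
      by (rule comp_diff[OF _ comp_w_Suc(1)[OF pk(1)]])
    have "ZZ (ps + k) = - (zt 1 * U ^ Suc (Suc R) * gg ^ (ps + k))"
      using ZZ_ps[of "Suc R"] tk(2) by simp
    moreover have "D (ZZ ps) = - (U * gg ^ ps)" using D_ZZ_ps[of 0] by simp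
    ultimately have "- (D (ZZ ps) * ZZ k) = ZZ (ps + k)"
      unfolding ZZk by (simp add: power_add mult_ac)
    hence "ph (w ps \<diamondop> x \<diamondop> w k - w (ps + k) \<diamondop> x) = 0"
      unfolding ph_diff ph_br[of "w ps \<diamondop> x" "w k"] using ps tk by (simp add: ph_w ph_wx mb_W mb_W[unfolded One_nat_def])
    thus "ph (w ps \<diamondop> x \<diamondop> w k - w (ps + k) \<diamondop> x) \<oslash> XX = 0" "ph (w ps \<diamondop> x \<diamondop> w k - w (ps + k) \<diamondop> x) \<oslash> YY = 0"
      using mz by simp_all
  qed
  have pk': "1 \<le> Suc ps + k" "Suc ps + k \<le> t" using tk ps by auto
  have a3: "w (Suc ps) \<diamondop> y \<diamondop> w k \<in> Z"
  proof (rule det_d[OF gs pk'])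
    have "w (Suc ps) \<diamondop> y \<diamondop> w k \<in> comp ((Suc ps * (q - 1) + 1) + k * (q - 1))"
      using tk ps by (intro comp_br comp_w_Suc comp_w) auto
    moreover have "(Suc ps * (q - 1) + 1) + k * (q - 1) = (Suc ps + k) * (q - 1) + 1"
      by (simp only: add_mult_distrib add_ac)
    ultimately show "w (Suc ps) \<diamondop> y \<diamondop> w k \<in> comp ((Suc ps + k) * (q - 1) + 1)" by (simp only:)
    have "ZZ (Suc (Suc ps)) = zt (ps - 1) * U ^ 2 * gg ^ Suc (Suc ps)"
      using ZZ_inf[of 1 1] ps by (simp add: numeral_2_eq_2)
    hence "ZZ (Suc (Suc ps)) * ZZ k = - (zt 1 * zt (ps - 1) * (U ^ 2 * gg ^ Suc (Suc ps) * U ^ Suc R * gg ^ k))"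
      unfolding ZZk by (simp only: mult_ac mult_minus_right)
    moreover have "zt 1 * zt (ps - 1) = 0" using ps by (intro zt_ps_0) auto
    ultimately have "ZZ (Suc (Suc ps)) * ZZ k = 0" by (simp only: mult_zero_left minus_zero)
    hence pr: "cst (be (Suc ps)) * ZZ (Suc (Suc ps)) * ZZ k = 0" by (simp add: mult.assoc)
    have q1: "of_nat (q - 1) = (- 1 :: 'f coef)"
    proof -
      have "of_nat (q - 1) = (- 1 :: 'f)" using q_0 q5 of_nat_diff[of 1 q, where 'a = 'f] by simp
      thus ?thesis by (metis hconst_of_nat hconst_simps(2,5))
    qed
    define c where "c = cst (be (Suc ps)) * ZZ (Suc (Suc ps))"
    have "D (c * ZZ k) = 0" using pr derivation_0[OF derivation_dz] by (simp add: c_def)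
    hence "D c * ZZ k + c * D (ZZ k) = 0" unfolding derivation_mult[OF derivation_dz] .
    hence "of_nat (q - 1) * c * D (ZZ k) - D c * ZZ k = 0"
    proof -
      assume e: "D c * ZZ k + c * D (ZZ k) = 0"
      have "of_nat (q - 1) * c * D (ZZ k) - D c * ZZ k = - (D c * ZZ k + c * D (ZZ k))"
        unfolding q1 by (simp add: algebra_simps)
      thus ?thesis unfolding e by simp
    qed
    hence "ph (w (Suc ps) \<diamondop> y \<diamondop> w k) = 0"
      unfolding ph_br[of "w (Suc ps) \<diamondop> y" "w k"] using ph_wy[of "Suc ps"] tk
      by (simp add: ph_w mb_W mb_W[unfolded One_nat_def] c_def)
    thus "ph (w (Suc ps) \<diamondop> y \<diamondop> w k) \<oslash> XX = 0" "ph (w (Suc ps) \<diamondop> y \<diamondop> w k) \<oslash> YY = 0"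
      using mz by simp_all
  qed
  have "be (Suc ps) *s Sg (Suc t) = Xp ps (Suc ps) \<diamondop> w k"
    unfolding up(2) br_scale_left S ..
  also have "\<dots> = w ps \<diamondop> x \<diamondop> w k \<diamondop> (w (Suc ps) \<diamondop> y) + w ps \<diamondop> x \<diamondop> (w (Suc ps) \<diamondop> y \<diamondop> w k)"
    unfolding Xp_def by (rule br_deriv)
  also have "w ps \<diamondop> x \<diamondop> (w (Suc ps) \<diamondop> y \<diamondop> w k) = 0" by (rule Z_br'[OF a3]) simp
  also have "w ps \<diamondop> x \<diamondop> w k \<diamondop> (w (Suc ps) \<diamondop> y) = w (ps + k) \<diamondop> x \<diamondop> (w (Suc ps) \<diamondop> y)"
    by (rule Z_cong[OF a2]) simp
  finally show ?thesis unfolding tk(2) Xp_def by simp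
qed

text \<open>Modulo \<open>Z\<close>, \<open>Xp b ps\<close> is \<open>- u t\<close>. Its bracket
  with \<open>v\<close> is \<open>Q + Sg\<close> by the chain formula, and by the Leibniz rule a sum
  of two products already expressed by \<open>Sg\<close>. Comparison gives
  \<open>be (Suc t) = be (Suc ps) - al (Suc b) - 1\<close>, an additive recursion for the
  types.\<close>

lemma type_progression:
  assumes gs: "goods t" and t: "t = Suc (Suc R) * ps"
  shows "P (Suc t) = al (Suc t) *s Sg (Suc t)" "Q (Suc t) = be (Suc t) *s Sg (Suc t)"
proof -
  have ps: "ps > 3" by (rule ps_gt)
  define b where "b = Suc R * ps"
  have b: "b + ps = t" "1 \<le> b" "b \<le> t" "ps \<le> t" "Suc b = Suc R * ps + 1" "Suc ps + b = Suc t" using t ps by (auto simp: b_def)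
  have g: "good t" "good b" "good ps" using goodsD[OF gs] b ps by auto
  have XbK: "Xp b (Suc ps) = be (Suc ps) *s Sg (Suc t)"
  proof (cases R)
    case 0
    thus ?thesis using up_chain(2)[OF gs t] by (simp add: b_def)
  next
    case (Suc R')
    thus ?thesis using shift_product[OF gs, of R'] t by (simp add: b_def)
  qed
  have XC: "Xp (Suc b) ps = - (al (Suc b) *s Sg (Suc t))"
    using down_chain[OF gs t] unfolding b(5) .
  have nb: "al b = 1" "be ps = - 1"
    using al_be_inf(1)[OF not_fin'[of R b]] al_be_inf(2)[OF not_fin[of ps]] ps by (auto simp: b_def)
  have "Xp b ps - (- 1) *s pw (u t) x 0 \<in> Z"
  proof (rule det_eq[OF gs order_refl])
    show "Xp b ps \<in> comp (t * (q - 1) + 2 + 0)" using comp_Xp[of b ps] b ps by simp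
    have "D (ZZ b) = - (U ^ Suc R * gg ^ b)" unfolding b_def by (rule D_ZZ_ps)
    moreover have "ZZ (Suc ps) = U * gg ^ Suc ps" using ZZ_fin[of 1] by simp
    moreover have "ZZ (Suc t) = U ^ Suc (Suc R) * gg ^ Suc t" using ZZ_fin[of "Suc (Suc R)"] t by simp
    ultimately have "D (ZZ b) * ZZ (Suc ps) = - ZZ (Suc t)"
      unfolding b(6)[symmetric] by (simp add: power_add mult_ac)
    thus "ph (Xp b ps) = mscale (- 1) (me (q - 2 - 0) (ZZ (Suc t)))"
      using ph_Xp[of b ps] b ps nb by (simp add: me_minus mscale_me)
  qed simp
  hence "Xp b ps \<diamondop> v = (- 1) *s u t \<diamondop> v" using Z_cong[of "Xp b ps" "- u t" v] by (simp add: br_minus_left)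
  also have "\<dots> = 2 *s Q (Suc t) + P (Suc t)" unfolding br_scale_left uv[OF g(1)] by simp
  finally have "Q (Suc t) + Sg (Suc t) = Xp b ps \<diamondop> v" by (simp add: Sg_def scale_numeral algebra_simps)
  also have "\<dots> = Xp (Suc b) ps + Xp b (Suc ps)" unfolding Xp_v[OF g(2,3)] nb by simp
  finally have Q1: "Q (Suc t) = (be (Suc ps) - al (Suc b) - 1) *s Sg (Suc t)"
    unfolding XC XbK by (simp add: scale_left_diff_distrib algebra_simps)
  have f: "Suc ps = 1 * ps + 1" "Suc b = Suc R * ps + 1" "Suc t = Suc (Suc R) * ps + 1" using b t by auto
  have "be (Suc ps) - al (Suc b) - 1 = be (Suc t)"
    unfolding f al_fin be_fin by (simp add: algebra_simps)
  thus Q2: "Q (Suc t) = be (Suc t) *s Sg (Suc t)" using Q1 by simp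
  have "al (Suc t) = 1 - be (Suc t)" using al_be_1[of "Suc t"] fin_iff(1)[of "Suc (Suc R)"] f by (simp add: eq_diff_eq)
  hence "al (Suc t) *s Sg (Suc t) = Sg (Suc t) - Q (Suc t)"
    unfolding Q2 by (simp add: scale_left_diff_distrib)
  thus "P (Suc t) = al (Suc t) *s Sg (Suc t)" by (simp add: Sg_def)
qed

section \<open>All diamonds\<close>

text \<open>The presentation gives this directly: \<open>[v y x] = -2 [v x y]\<close> is type
  \<open>-1\<close>, and \<open>[v y x^i y] = 0\<close> is the chain condition.\<close>

lemma good_1: "good 1"
proof -
  have S: "u 1 = Sg 1" using u_fin fin_1 by simp
  have Q1: "Q 1 = (- 2) *s P 1" unfolding Q_def P_def w_1 by (rule v_rel(3))
  have "u 1 = - P 1" unfolding S Sg_def Q1 by (simp add: scale_numeral)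
  hence PQ: "P 1 = al 1 *s u 1" "Q 1 = be 1 *s u 1" unfolding Q1 fin_1 by simp_all
  have "chain (u 1)"
    unfolding chain_def
  proof (intro conjI allI impI)
    fix i assume i: "i < q - 3"
    have "2 *s (pw (u 1) x i \<diamondop> y) = pw (Q 1) x i \<diamondop> y" unfolding PQ fin_1 by (simp add: pw_scale br_linear)
    also have "\<dots> = pw (v \<diamondop> y) x (Suc i) \<diamondop> y" by (simp add: Q_def w_1[unfolded One_nat_def] pw_Suc_left)
    also have "\<dots> = 0" using vy_rel[of "Suc i"] i by simp
    finally show "pw (u 1) x i \<diamondop> y \<in> Z" using two_nz by simp
  qed simp
  thus ?thesis
    unfolding good_def using PQ fin_1 two_nz v_rel by (simp add: A_def w_1[unfolded One_nat_def])
qed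

lemma good_Suc:
  assumes gs: "goods t" and t1: "1 \<le> t" and fp: "FP t"
  shows "good (Suc t)"
proof -
  have g: "good t" using goodsD[OF gs t1] by simp
  have Ez: "u t \<diamondop> (v \<diamondop> x) = 0" if "ps < t" "t mod ps \<noteq> 0" using u_vx_0[OF gs t1 that] .
  have ta: "al t \<noteq> 0" if "be t = 0" using al_be_nz that by blast
  \<comment> \<open>At the second diamond \<open>be\<close> is 2, so a finite diamond with
    \<open>be t = 0\<close> lies beyond the first period.\<close>
  have bps: "ps < t \<and> t mod ps \<noteq> 0" if b: "be t = 0"
  proof -
    have f: "fin t" using al_be_inf(2)[of t] b by force
    have "t \<noteq> 1" using fin_1 b two_nz by auto
    hence "ps < t" using not_fin[of t] f t1 by (cases "ps < t") auto
    thus ?thesis using f by (simp add: fin_def)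
  qed
  have AZ: "A (Suc t) \<in> Z"
  proof (cases "be t = 0")
    case True
    have "A (Suc t) \<diamondop> y = 0" using A_y[OF gs t1 True] bps[OF True] Ez by blast
    moreover have "A (Suc t) \<diamondop> x = 0" using A_Suc(2)[OF g] ta[OF True] by simp
    ultimately show ?thesis by (intro Z_I)
  next
    case False
    thus ?thesis using A_Suc(1)[OF g] by simp
  qed
  have A0: "A (Suc t) = 0" if "be t \<noteq> 0" using A_Suc(1)[OF g] that by simp
  have fincase: "P (Suc t) = al (Suc t) *s u (Suc t)" "Q (Suc t) = be (Suc t) *s u (Suc t)" if f: "fin (Suc t)"
  proof -
    obtain r where r: "Suc t = r * ps + 1" using fin_ex[OF _ f] by auto
    have "P (Suc t) = al (Suc t) *s Sg (Suc t) \<and> Q (Suc t) = be (Suc t) *s Sg (Suc t)"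
    proof (cases "r = 1")
      case True
      thus ?thesis using first_finite[OF gs t1] r by simp
    next
      case False
      then obtain R where "r = Suc (Suc R)" using r t1 by (cases r; cases "r - 1") auto
      thus ?thesis using type_progression[OF gs, of R] r by simp
    qed
    thus "P (Suc t) = al (Suc t) *s u (Suc t)" "Q (Suc t) = be (Suc t) *s u (Suc t)"
      using u_fin[of "Suc t"] f by simp_all
  qed
  have infcase: "Sg (Suc t) \<in> Z" if f: "\<not> fin (Suc t)"
  proof (cases "Suc t \<le> ps")
    case True
    thus ?thesis using first_period(1)[OF gs t1 fp] by simp
  next
    case False
    moreover have "t \<noteq> ps" using f fin_iff(1)[of 1] by auto
    ultimately have p: "ps < t" by simp
    have "t mod ps \<noteq> 0"
    proof
      assume "t mod ps = 0"
      hence "Suc t mod ps = 1" using ps_gt(2) by (simp add: mod_Suc)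
      thus False using f by (simp add: fin_def)
    qed
    hence "Sg (Suc t) \<diamondop> x + A (Suc t) \<diamondop> y = 0" using Ez p u_vx[OF g] by simp
    hence "Sg (Suc t) \<diamondop> x = 0" using AZ by simp
    thus ?thesis using Sg_y(3)[OF g] by (intro Z_I)
  qed
  have PQ: "P (Suc t) - al (Suc t) *s u (Suc t) \<in> Z" "Q (Suc t) - be (Suc t) *s u (Suc t) \<in> Z"
  proof -
    show "P (Suc t) - al (Suc t) *s u (Suc t) \<in> Z"
      using fincase(1) u_inf[of "Suc t"] al_be_inf(1)[of "Suc t"] by (cases "fin (Suc t)") auto
    show "Q (Suc t) - be (Suc t) *s u (Suc t) \<in> Z"
    proof (cases "fin (Suc t)")
      case False
      thus ?thesis using infcase u_inf[of "Suc t"] al_be_inf(2)[of "Suc t"] by (simp add: Sg_def add.commute)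
    qed (use fincase(2) in simp)
  qed
  \<comment> \<open>Diamonds of finite type are never consecutive, so \<open>be t\<close> is nonzero
    and \<open>A (Suc t)\<close> vanishes exactly.\<close>
  have "w (Suc t) \<diamondop> x \<in> Z" if a: "al (Suc t) = 0"
  proof -
    have f: "fin (Suc t)" using al_be_inf(1)[of "Suc t"] a by force
    hence "\<not> fin t" using fin_adjacent by blast
    hence "be t \<noteq> 0" using al_be_inf(2)[of t] by simp
    thus ?thesis using A0 fincase(1)[OF f] a by (intro Z_I) (simp_all add: A_def P_def)
  qed
  moreover have "w (Suc t) \<diamondop> y \<in> Z" if b: "be (Suc t) = 0"
  proof -
    have f: "fin (Suc t)" using al_be_inf(2)[of "Suc t"] b by force
    thus ?thesis using wyy'[OF g] fincase(2)[OF f] b by (intro Z_I) (simp_all add: Q_def)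
  qed
  moreover have "chain (u (Suc t))" by (rule chain_Suc[OF g AZ PQ])
  ultimately show ?thesis
    unfolding good_def using AZ wyy'[OF g] PQ fincase by simp
qed

lemma all_good: "t \<ge> 1 \<Longrightarrow> good t"
proof -
  have "goods t \<and> FP t" for t
  proof (induction t)
    case 0
    show ?case by (auto simp: goods_def FP_def)
  next
    case (Suc t)
    show ?case
    proof (cases "t = 0")
      case True
      thus ?thesis using good_1 by (auto simp: goods_def FP_def le_Suc_eq)
    next
      case False
      hence t1: "1 \<le> t" by simp
      have "good (Suc t)" using good_Suc[OF _ t1] Suc by blast
      hence "goods (Suc t)" using Suc by (auto simp: goods_def le_Suc_eq)
      moreover have "FP (Suc t)"
      proof (cases "Suc t \<le> ps")
        case True
        thus ?thesis using first_period(2)[OF _ t1] Suc by blast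
      next
        case False
        have "b + c \<le> t" if "b + c \<le> ps" for b c :: nat using that False by simp
        thus ?thesis using Suc unfolding FP_def by blast
      qed
      ultimately show ?thesis by blast
    qed
  qed
  moreover assume "t \<ge> 1"
  ultimately show ?thesis using goodsD by blast
qed

end

context nott
begin

section \<open>Components modulo the centre\<close>

lemma all_goods: "goods T"
  using all_good by (simp add: goods_def)

lemmas span_u' = span_u[OF all_goods order_refl] and span_d' = span_d[OF all_goods _ le_SucI[OF order_refl]]

section \<open>Degrees, independence and covering\<close>

lemma degree_cases:
  assumes "i \<ge> 1"
  obtains (1) "i = 1" | (chain) t j where "i = t * (q - 1) + 2 + j" "j \<le> q - 3"
    | (diamond) t where "t \<ge> 1" "i = t * (q - 1) + 1"
proof -
  define t j where "t = (i - 1) div (q - 1)" and "j = (i - 1) mod (q - 1)"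
  have i: "i = t * (q - 1) + 1 + j"
    using div_mult_mod_eq[of "i - 1" "q - 1"] assms by (simp add: t_def j_def)
  have j: "j < q - 1" using q5 by (simp add: j_def)
  show ?thesis
  proof (cases "j = 0")
    case True
    thus ?thesis using i that(1) that(3)[of t] by (cases "t = 0") auto
  next
    case False
    hence "i = t * (q - 1) + 2 + (j - 1)" "j - 1 \<le> q - 3" using i j by auto
    thus ?thesis by (rule that(2))
  qed
qed

text \<open>Nothing collapses along a chain: in the model the bracket with \<open>x\<close> is still
  a nonzero monomial for \<open>j = q - 3\<close>.\<close>

lemma pw_u_indep:
  assumes "j \<le> q - 3" "c *s pw (u t) x j \<in> Z" shows "c = 0"
proof -
  have "ph (pw (u t) x j) \<oslash> XX = me (q - 2 - j - 1) (ZZ (Suc t))"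
    using ph_pw_u[of j t] assms(1) q5 by (simp add: mb_XX)
  hence "me (q - 2 - j - 1) (cst c * ZZ (Suc t)) = 0"
    using ph_Z(1)[OF assms(2)] by (simp add: ph_scale mb_scale mscale_me)
  thus ?thesis by (simp add: me_eq_0_iff cst_ZZ)
qed

lemma pw_u_notin: "j \<le> q - 3 \<Longrightarrow> pw (u t) x j \<notin> Z"
  using pw_u_indep[of j 1 t] by auto

lemma gens_indep:
  assumes "c *s x + d *s y \<in> Z" shows "c = 0 \<and> d = 0"
proof -
  have 0: "pw (u 0) x 0 = y \<diamondop> x" by (simp add: u_def uf_def)
  have "d *s pw (u 0) x 0 = (c *s x + d *s y) \<diamondop> x" unfolding 0 by (simp add: br_linear br_self)
  also have "\<dots> = 0" by (rule Z_x[OF assms])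
  finally have "d *s pw (u 0) x 0 \<in> Z" by (simp only: Z_0)
  moreover have "c *s pw (u 0) x 0 = - ((c *s x + d *s y) \<diamondop> y)"
    unfolding 0 by (simp add: br_linear br_self br_anti[of x y])
  hence "c *s pw (u 0) x 0 = 0" unfolding Z_y[OF assms] by (simp only: minus_zero)
  hence "c *s pw (u 0) x 0 \<in> Z" by (simp only: Z_0)
  ultimately show ?thesis using pw_u_indep[of 0] by blast
qed

text \<open>The factors \<open>al t\<close> and \<open>be t\<close> remain because at a fake diamond
  one of \<open>[w x]\<close> and \<open>[w y]\<close> is central.\<close>

lemma diamond_indep:
  assumes t: "t \<ge> 1" and z: "c *s (w t \<diamondop> x) + d *s (w t \<diamondop> y) \<in> Z"
  shows "c * al t = 0 \<and> d * be t = 0"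
proof -
  have g: "good t" using all_good t .
  have "(c *s (w t \<diamondop> x) + d *s (w t \<diamondop> y)) \<diamondop> y = c *s P t"
    using goodD(3)[OF g] by (simp add: br_linear P_def)
  hence P0: "c *s P t = 0" using Z_y[OF z] by simp
  have "(c * al t) *s pw (u t) x 0 = c *s P t - c *s (P t - al t *s u t)"
    by (simp add: scale_right_diff_distrib)
  hence e1: "(c * al t) *s pw (u t) x 0 = - (c *s (P t - al t *s u t))" unfolding P0 by (simp only: diff_0)
  have 1: "(c * al t) *s pw (u t) x 0 \<in> Z" unfolding e1 by (intro Z_minus Z_scale goodD(4)[OF g])
  have Q0: "c *s A t + d *s Q t = 0"
    using Z_x[OF z] by (simp only: br_linear A_def Q_def)
  have "(d * be t) *s pw (u t) x 0 = (c *s A t + d *s Q t) - (c *s A t + d *s (Q t - be t *s u t))"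
    by (simp add: scale_right_diff_distrib)
  hence e2: "(d * be t) *s pw (u t) x 0 = - (c *s A t + d *s (Q t - be t *s u t))"
    unfolding Q0 by (simp only: diff_0)
  have 2: "(d * be t) *s pw (u t) x 0 \<in> Z"
    unfolding e2 by (intro Z_minus Z_add Z_scale goodD(2,5)[OF g])
  show ?thesis using pw_u_indep[OF _ 1] pw_u_indep[OF _ 2] by simp
qed

text \<open>Inside a chain \<open>x\<close> alone covers the next degree, and at its top
  \<open>x\<close> and \<open>y\<close> reach the two spanning elements of the diamond. In degree 1
  and at a diamond the claim is one linear equation whose coefficients are not all zero.\<close>

lemma covering_mod_Z:
  assumes i: "i \<ge> 1" and z: "z \<in> comp i" "z \<notin> Z" and b: "b \<in> comp (Suc i)"
  shows "\<exists>c d. b - z \<diamondop> (c *s x + d *s y) \<in> Z"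
  using i
proof (cases rule: degree_cases)
  case 1
  obtain c d where cd: "z = c *s x + d *s y" using comp_1 z(1) 1 by blast
  have nz: "c \<noteq> 0 \<or> d \<noteq> 0" using cd z(2) by auto
  obtain k where k: "b - k *s u 0 \<in> Z" using span_u'[of 0 b 0] b 1 by (auto simp: numeral_2_eq_2)
  have 0: "u 0 = y \<diamondop> x" by (simp add: u_def uf_def)
  have m: "z \<diamondop> (a *s x + b *s y) = (a * d - b * c) *s u 0" for a b
    unfolding cd 0 by (simp add: br_linear br_self br_anti[of x y] scale_left_diff_distrib)
  have "\<exists>a b. a * d - b * c = k"
  proof (cases "d = 0")
    case True
    have "0 * d - (- k / c) * c = k" using nz True by simp
    thus ?thesis by blast
  next
    case False
    have "(k / d) * d - 0 * c = k" using False by simp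
    thus ?thesis by blast
  qed
  thus ?thesis using k m by metis
next
  case (chain t j)
  obtain c where c: "z - c *s pw (u t) x j \<in> Z" using span_u'[OF chain(2)] z(1) chain(1) by blast
  have "c \<noteq> 0" using c z(2) by auto
  have zx: "z \<diamondop> x = c *s pw (u t) x (Suc j)" "z \<diamondop> y = c *s (pw (u t) x j \<diamondop> y)"
    using Z_cong[OF c] by (simp_all add: br_linear pw_Suc)
  show ?thesis
  proof (cases "j = q - 3")
    case False
    hence j: "Suc j \<le> q - 3" using chain by simp
    obtain k where "b - k *s pw (u t) x (Suc j) \<in> Z"
      using span_u'[OF j, of b t] b chain(1) by auto
    moreover have "z \<diamondop> ((k / c) *s x + 0 *s y) = k *s pw (u t) x (Suc j)"
      using \<open>c \<noteq> 0\<close> zx by (simp add: br_linear)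
    ultimately show ?thesis by metis
  next
    case True
    have "Suc i = Suc t * (q - 1) + 1" using chain True q5 by simp
    then obtain k l where "b = k *s (w (Suc t) \<diamondop> x) + l *s (w (Suc t) \<diamondop> y)"
      using span_d'[of "Suc t" b] b by auto
    moreover have "z \<diamondop> ((k / c) *s x + (l / c) *s y) = k *s (w (Suc t) \<diamondop> x) + l *s (w (Suc t) \<diamondop> y)"
      using \<open>c \<noteq> 0\<close> zx True by (simp add: br_linear w_Suc pw_Suc)
    ultimately show ?thesis by (metis Z_0 diff_self)
  qed
next
  case (diamond t)
  note g = all_good[OF diamond(1)]
  obtain c d where cd: "z = c *s (w t \<diamondop> x) + d *s (w t \<diamondop> y)"
    using span_d'[OF diamond(1)] z(1) diamond(2) by blast
  have nz: "c * al t \<noteq> 0 \<or> d * be t \<noteq> 0"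
  proof (rule ccontr)
    assume "\<not> ?thesis"
    hence "c *s (w t \<diamondop> x) \<in> Z" "d *s (w t \<diamondop> y) \<in> Z" using goodD(8,9)[OF g] by auto
    thus False using z(2) cd by simp
  qed
  obtain k where k: "b - k *s u t \<in> Z" using span_u'[of 0 b t] b diamond by auto
  have zx: "z \<diamondop> x - (d * be t) *s u t \<in> Z"
  proof -
    have "z \<diamondop> x - (d * be t) *s u t = c *s A t + d *s (Q t - be t *s u t)"
      unfolding cd by (simp add: br_linear A_def Q_def scale_right_diff_distrib)
    thus ?thesis using goodD(2,5)[OF g] by simp
  qed
  have zy: "z \<diamondop> y - (c * al t) *s u t \<in> Z"
  proof -
    have "z \<diamondop> y - (c * al t) *s u t = c *s (P t - al t *s u t)"
      unfolding cd using goodD(3)[OF g] by (simp add: br_linear P_def scale_right_diff_distrib)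
    thus ?thesis using goodD(4)[OF g] by simp
  qed
  have "\<exists>a e. a * (d * be t) + e * (c * al t) = k"
  proof (cases "d * be t = 0")
    case True
    have "0 * (d * be t) + (k / (c * al t)) * (c * al t) = k" using nz True by simp
    thus ?thesis by blast
  next
    case False
    have "(k / (d * be t)) * (d * be t) + 0 * (c * al t) = k" using False by simp
    thus ?thesis by blast
  qed
  then obtain a e where ae: "a * (d * be t) + e * (c * al t) = k" by blast
  have e: "b - z \<diamondop> (a *s x + e *s y) = (b - k *s u t) - a *s (z \<diamondop> x - (d * be t) *s u t) -
      e *s (z \<diamondop> y - (c * al t) *s u t)"
    unfolding ae[symmetric] by (simp add: br_linear scale_right_diff_distrib scale_left_distrib)
  have "b - z \<diamondop> (a *s x + e *s y) \<in> Z"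
    unfolding e by (rule Z_diff[OF Z_diff[OF k Z_scale[OF zx]] Z_scale[OF zy]])
  thus ?thesis by blast
qed

lemma diamond_relations:
  assumes t: "t \<ge> 1"
  shows "A t \<in> Z" "w t \<diamondop> y \<diamondop> y \<in> Z" "\<not> fin t \<Longrightarrow> Q t + P t \<in> Z"
    "fin t \<Longrightarrow> al t *s Q t - (1 - al t) *s P t \<in> Z"
    "al t = 0 \<Longrightarrow> w t \<diamondop> x \<in> Z" "be t = 0 \<Longrightarrow> w t \<diamondop> y \<in> Z"
proof -
  note g = goodD[OF all_good[OF t]]
  show "A t \<in> Z" "w t \<diamondop> y \<diamondop> y \<in> Z" "al t = 0 \<Longrightarrow> w t \<diamondop> x \<in> Z" "be t = 0 \<Longrightarrow> w t \<diamondop> y \<in> Z" using g by simp_all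
  show "Q t + P t \<in> Z" if "\<not> fin t"
  proof -
    have e: "Q t + P t = (Q t - be t *s u t) + (P t - al t *s u t)" using al_be_inf[OF that] by simp
    show ?thesis unfolding e by (rule Z_add[OF g(5,4)])
  qed
  show "al t *s Q t - (1 - al t) *s P t \<in> Z" if "fin t"
  proof -
    have "1 - al t = be t" using al_be_1[OF that] by (simp add: diff_eq_eq add.commute)
    thus ?thesis using g(6,7)[OF that] by (simp add: mult.commute)
  qed
qed

end

section \<open>Homogeneous parts\<close>

locale presented = gen_lie scale br x y
  for scale :: "'f::field \<Rightarrow> 'a::ab_group_add \<Rightarrow> 'a" (infixr \<open>*s\<close> 75)
    and br :: "'a \<Rightarrow> 'a \<Rightarrow> 'a" (infixl \<open>\<diamondop>\<close> 80) and x y +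
  fixes R :: "(('f, gen) lie_term \<times> ('f, gen) lie_term) set"
  assumes ev_eq: "ev t = ev u \<longleftrightarrow> lie_cong R t u"
    and homogeneous_R: "(t, u) \<in> R \<Longrightarrow> \<exists>m. homogeneous m t \<and> homogeneous m u"
    and two: "(2::'f) \<noteq> 0"
begin

text \<open>The degree \<open>n\<close> part of a term, with the Cauchy product on brackets. Since
  the relations are homogeneous it respects \<open>lie_cong\<close>, and this makes the components
  of \<open>N\<close> independent.\<close>

primrec part :: "('f, gen) lie_term \<Rightarrow> nat \<Rightarrow> 'a" where
  "part (Gen g) = (\<lambda>n. if n = 1 then ev (Gen g) else 0)"
| "part Zero = (\<lambda>n. 0)"
| "part (Add t u) = (\<lambda>n. part t n + part u n)"
| "part (Scale c t) = (\<lambda>n. c *s part t n)"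
| "part (Br t u) = (\<lambda>n. \<Sum>i\<le>n. part t i \<diamondop> part u (n - i))"

lemma part_homogeneous: "homogeneous m t \<Longrightarrow> part t n = (if n = m then ev t else 0)"
proof (induction arbitrary: n rule: homogeneous.induct)
  case (5 m t k u)
  have "part (t \<cdot> u) n = (\<Sum>i\<le>n. if i = m \<and> n = m + k then ev t \<diamondop> ev u else 0)"
    unfolding part.simps using 5 by (intro sum.cong) auto
  also have "\<dots> = (if n = m + k then ev t \<diamondop> ev u else 0)"
    by (cases "n = m + k") auto
  finally show ?case by simp
qed auto

lemma cauchy_triple:
  fixes a b c :: "nat \<Rightarrow> 'a"
  shows "(\<Sum>k\<le>n. (\<Sum>i\<le>k. a i \<diamondop> b (k - i)) \<diamondop> c (n - k)) =
    (\<Sum>(i, j, l)\<in>{(i, j, l). i + j + l = n}. a i \<diamondop> b j \<diamondop> c l)"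
proof -
  have "(\<Sum>k\<le>n. (\<Sum>i\<le>k. a i \<diamondop> b (k - i)) \<diamondop> c (n - k)) =
    (\<Sum>(k, i)\<in>Sigma {..n} (\<lambda>k. {..k}). a i \<diamondop> b (k - i) \<diamondop> c (n - k))"
    by (simp add: br_sum_left sum.Sigma)
  also have "\<dots> = (\<Sum>(i, j, l)\<in>{(i, j, l). i + j + l = n}. a i \<diamondop> b j \<diamondop> c l)"
    by (rule sum.reindex_bij_witness[of _ "\<lambda>(i, j, l). (i + j, i)" "\<lambda>(k, i). (i, k - i, n - k)"]) auto
  finally show ?thesis .
qed

text \<open>Reversing the sum and antisymmetry give twice the sum equal to zero.\<close>

lemma part_self:
  fixes a :: "nat \<Rightarrow> 'a"
  shows "(\<Sum>i\<le>n. a i \<diamondop> a (n - i)) = 0"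
proof -
  let ?S = "\<Sum>i\<le>n. a i \<diamondop> a (n - i)"
  have "?S = (\<Sum>i\<le>n. a (n - i) \<diamondop> a i)"
    by (rule sum.reindex_bij_witness[of _ "\<lambda>i. n - i" "\<lambda>i. n - i"]) auto
  also have "\<dots> = (\<Sum>i\<le>n. - (a i \<diamondop> a (n - i)))" by (rule sum.cong[OF HOL.refl]) (rule br_anti)
  finally have "?S + ?S = 0" by (simp add: sum_negf eq_neg_iff_add_eq_0)
  hence "2 *s ?S = 0" using scale_left_distrib[of 1 1 ?S] by simp
  thus ?thesis using two by simp
qed

text \<open>Relabelling the index triples cyclically reduces the sum to the Jacobi identity for each
  triple.\<close>

lemma part_jacobi:
  fixes a b c :: "nat \<Rightarrow> 'a"
  shows "(\<Sum>k\<le>n. (\<Sum>i\<le>k. a i \<diamondop> b (k - i)) \<diamondop> c (n - k)) + (\<Sum>k\<le>n. (\<Sum>i\<le>k. b i \<diamondop> c (k - i)) \<diamondop> a (n - k)) +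
    (\<Sum>k\<le>n. (\<Sum>i\<le>k. c i \<diamondop> a (k - i)) \<diamondop> b (n - k)) = 0"
proof -
  let ?T = "{(i, j, l). i + j + l = n}"
  have 1: "(\<Sum>(i, j, l)\<in>?T. b i \<diamondop> c j \<diamondop> a l) = (\<Sum>(i, j, l)\<in>?T. b j \<diamondop> c l \<diamondop> a i)"
    by (rule sum.reindex_bij_witness[of _ "\<lambda>(i, j, l). (j, l, i)" "\<lambda>(i, j, l). (l, i, j)"]) auto
  have 2: "(\<Sum>(i, j, l)\<in>?T. c i \<diamondop> a j \<diamondop> b l) = (\<Sum>(i, j, l)\<in>?T. c l \<diamondop> a i \<diamondop> b j)"
    by (rule sum.reindex_bij_witness[of _ "\<lambda>(i, j, l). (l, i, j)" "\<lambda>(i, j, l). (j, l, i)"]) auto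
  show ?thesis
    unfolding cauchy_triple 1 2 sum.distrib[symmetric]
    by (intro sum.neutral) (auto simp: br_jacobi)
qed

lemma part_cong: "lie_cong R t u \<Longrightarrow> part t n = part u n"
proof (induction arbitrary: n rule: lie_cong.induct)
  case (rel t u)
  then obtain m where "homogeneous m t" "homogeneous m u" using homogeneous_R by blast
  moreover have "ev t = ev u" using rel ev_eq lie_cong.rel by blast
  ultimately show ?case by (simp add: part_homogeneous)
next
  case (Br_self t)
  show ?case using part_self by simp
next
  case (Br_jacobi t u w)
  show ?case using part_jacobi by simp
qed (simp_all add: br_linear sum.distrib scale_sum_right scale_right_distrib scale_left_distrib)

lemma sum_term:
  assumes "\<forall>i\<in>{1..n}. c i \<in> comp i"
  shows "\<exists>t. ev t = (\<Sum>i\<in>{1..n}. c i) \<and> (\<forall>m\<in>{1..n}. part t m = c m) \<and> (\<forall>m>n. part t m = 0)"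
  using assms
proof (induction n)
  case 0
  show ?case by (rule exI[of _ Zero]) simp
next
  case (Suc n)
  then obtain t where t: "ev t = (\<Sum>i\<in>{1..n}. c i)" "\<forall>m\<in>{1..n}. part t m = c m" "\<forall>m>n. part t m = 0"
    by auto
  have "c (Suc n) \<in> comp (Suc n)" using Suc.prems by simp
  then obtain u where u: "homogeneous (Suc n) u" "ev u = c (Suc n)" by (auto simp: comp_def)
  show ?case
    by (rule exI[of _ "Add t u"]) (use t u part_homogeneous[OF u(1)] in \<open>auto simp: le_Suc_eq\<close>)
qed

text \<open>The products of the sum with the generators vanish; taking the part of degree
  \<open>Suc m\<close> isolates the products of \<open>c m\<close>.\<close>

lemma graded_Z:
  assumes c: "\<forall>i\<in>{1..n}. c i \<in> comp i" and z: "(\<Sum>i\<in>{1..n}. c i) \<in> Z"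
  shows "\<forall>i\<in>{1..n}. c i \<in> Z"
proof
  fix m assume m: "m \<in> {1..n}"
  obtain t where t: "ev t = (\<Sum>i\<in>{1..n}. c i)" "\<forall>m\<in>{1..n}. part t m = c m" using sum_term[OF c] by blast
  have *: "part (t \<cdot> Gen g) (Suc m) = c m \<diamondop> ev (Gen g)" for g
  proof -
    have "part (t \<cdot> Gen g) (Suc m) = (\<Sum>i\<in>{m}. part t i \<diamondop> part (Gen g) (Suc m - i))"
      unfolding part.simps by (rule sum.mono_neutral_right) (auto simp: Suc_diff_le)
    thus ?thesis using t m by simp
  qed
  have "part (t \<cdot> Gen g) (Suc m) = part Zero (Suc m)" for g
  proof (rule part_cong)
    have "ev t \<diamondop> ev (Gen g) = 0" using z t(1) by (cases g) simp_all
    thus "lie_cong R (t \<cdot> Gen g) Zero" unfolding ev_eq[symmetric] by simp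
  qed
  hence "c m \<diamondop> ev (Gen g) = 0" for g unfolding * by (simp only: part.simps)
  from this[of Gen_x] this[of Gen_y] have "c m \<diamondop> x = 0" "c m \<diamondop> y = 0" by simp_all
  thus "c m \<in> Z" unfolding Z_def by blast
qed

text \<open>The family is homogeneous in all degrees and vanishes beyond \<open>n\<close>, so that
  two sums can be extended to a common length.\<close>

definition graded_sums :: "'a set" where
  "graded_sums = {\<Sum>i\<in>{1..n}. c i |n c. (\<forall>i. c i \<in> comp i) \<and> (\<forall>i>n. c i = 0)}"

lemma graded_sums_comp: "a \<in> comp m \<Longrightarrow> a \<in> graded_sums"
proof -
  assume a: "a \<in> comp m"
  let ?c = "\<lambda>i. if i = m then a else 0"
  have "(\<Sum>i\<in>{1..m}. ?c i) = a" using a comp_0 by (cases "m = 0") auto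
  moreover have "(\<Sum>i\<in>{1..m}. ?c i) \<in> graded_sums"
    unfolding graded_sums_def using a by (intro CollectI exI[of _ m] exI[of _ ?c]) auto
  ultimately show ?thesis by simp
qed

lemma graded_sums_add: "a \<in> graded_sums \<Longrightarrow> b \<in> graded_sums \<Longrightarrow> a + b \<in> graded_sums"
proof -
  assume "a \<in> graded_sums" "b \<in> graded_sums"
  then obtain m n c d where c: "a = (\<Sum>i\<in>{1..m}. c i)" "\<forall>i. c i \<in> comp i" "\<forall>i>m. c i = 0"
    and d: "b = (\<Sum>i\<in>{1..n}. d i)" "\<forall>i. d i \<in> comp i" "\<forall>i>n. d i = 0"
    by (auto simp: graded_sums_def)
  let ?k = "max m n"
  have "a = (\<Sum>i\<in>{1..?k}. c i)" "b = (\<Sum>i\<in>{1..?k}. d i)"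
    unfolding c(1) d(1) using c(3) d(3) by (auto intro!: sum.mono_neutral_left)
  hence "a + b = (\<Sum>i\<in>{1..?k}. c i + d i)" by (simp add: sum.distrib)
  moreover have "(\<Sum>i\<in>{1..?k}. c i + d i) \<in> graded_sums"
    unfolding graded_sums_def using c d
    by (intro CollectI exI[of _ ?k] exI[of _ "\<lambda>i. c i + d i"]) (auto simp: comp_add)
  ultimately show ?thesis by simp
qed

lemma graded_sums_sum: "(\<And>i. i \<in> S \<Longrightarrow> f i \<in> graded_sums) \<Longrightarrow> (\<Sum>i\<in>S. f i) \<in> graded_sums"
  by (induction S rule: infinite_finite_induct)
    (auto intro: graded_sums_add graded_sums_comp[of 0 0])

lemma ev_graded_sums: "ev t \<in> graded_sums"
proof (induction t)
  case (Gen g)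
  have "ev (Gen g) \<in> comp 1" using comp_x comp_y by (cases g) auto
  thus ?case by (rule graded_sums_comp)
next
  case Zero
  show ?case using graded_sums_comp[of 0 0] by simp
next
  case (Add t u)
  thus ?case by (simp add: graded_sums_add)
next
  case (Scale c t)
  then obtain n d where d: "ev t = (\<Sum>i\<in>{1..n}. d i)" "\<forall>i. d i \<in> comp i" by (auto simp: graded_sums_def)
  have "(\<Sum>i\<in>{1..n}. c *s d i) \<in> graded_sums"
    using d by (intro graded_sums_sum graded_sums_comp[OF comp_scale]) auto
  thus ?case by (simp add: d scale_sum_right)
next
  case (Br t u)
  then obtain m n c d where c: "ev t = (\<Sum>i\<in>{1..m}. c i)" "\<forall>i. c i \<in> comp i"
    and d: "ev u = (\<Sum>i\<in>{1..n}. d i)" "\<forall>i. d i \<in> comp i" by (auto simp: graded_sums_def)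
  have "(\<Sum>j\<in>{1..n}. \<Sum>i\<in>{1..m}. c i \<diamondop> d j) \<in> graded_sums"
    using c d by (intro graded_sums_sum graded_sums_comp[OF comp_br]) auto
  thus ?case by (simp add: c d br_sum_left br_sum_right)
qed

end

section \<open>Dimensions one and two\<close>

lemma has_dim_pair:
  fixes L :: "('f::field, 'a, 'm) lie_scheme"
  assumes L: "vectorspace class_ring L" and W: "subspace class_ring W L"
    and ab: "a \<in> W" "b \<in> W"
    and gen: "\<And>v. v \<in> W \<Longrightarrow> \<exists>c d. v = c \<odot>\<^bsub>L\<^esub> a \<oplus>\<^bsub>L\<^esub> d \<odot>\<^bsub>L\<^esub> b"
    and ind: "\<And>c d. c \<odot>\<^bsub>L\<^esub> a \<oplus>\<^bsub>L\<^esub> d \<odot>\<^bsub>L\<^esub> b = \<zero>\<^bsub>L\<^esub> \<Longrightarrow> c = 0 \<and> d = 0"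
  shows "has_dim L W 2"
proof -
  interpret V: vectorspace class_ring "L\<lparr>carrier := W\<rparr>"
    by (rule vectorspace.subspace_is_vs[OF L W])
  \<comment> \<open>Equality would contradict independence for the coefficients \<open>1\<close> and
    \<open>-1\<close>; without this \<open>{a, b}\<close> could be a singleton.\<close>
  have ne: "a \<noteq> b"
  proof
    assume e: "a = b"
    have "(1 + (- 1)) \<odot>\<^bsub>L\<^esub> a = 1 \<odot>\<^bsub>L\<^esub> a \<oplus>\<^bsub>L\<^esub> (- 1) \<odot>\<^bsub>L\<^esub> a"
      using V.smult_l_distr[of 1 "- 1" a] ab by simp
    moreover have "(1 + (- 1)) \<odot>\<^bsub>L\<^esub> a = \<zero>\<^bsub>L\<^esub>"
      using V.smult_l_null[of a] ab by simp
    ultimately show False using ind[of 1 "- 1"] e by simp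
  qed
  have lc: "V.lincomb f {a, b} = f a \<odot>\<^bsub>L\<^esub> a \<oplus>\<^bsub>L\<^esub> f b \<odot>\<^bsub>L\<^esub> b" for f
  proof -
    have s: "c \<odot>\<^bsub>L\<^esub> v \<in> W" if "v \<in> W" for c v using V.smult_closed[of c v] that by simp
    have "V.lincomb f {a, b} = f a \<odot>\<^bsub>L\<^esub> a \<oplus>\<^bsub>L\<^esub> (f b \<odot>\<^bsub>L\<^esub> b \<oplus>\<^bsub>L\<^esub> \<zero>\<^bsub>L\<^esub>)"
      unfolding V.lincomb_def using ne ab s by (simp add: V.finsum_insert Pi_def)
    thus ?thesis using V.r_zero[of "f b \<odot>\<^bsub>L\<^esub> b"] s[OF ab(2)] by simp
  qed
  have gs: "V.span {a, b} = carrier (L\<lparr>carrier := W\<rparr>)"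
  proof
    show "V.span {a, b} \<subseteq> carrier (L\<lparr>carrier := W\<rparr>)" using ab by (intro V.span_is_subset2) simp
    show "carrier (L\<lparr>carrier := W\<rparr>) \<subseteq> V.span {a, b}"
    proof
      fix v assume "v \<in> carrier (L\<lparr>carrier := W\<rparr>)"
      hence "v \<in> W" by simp
      from gen[OF this] obtain c d where "v = c \<odot>\<^bsub>L\<^esub> a \<oplus>\<^bsub>L\<^esub> d \<odot>\<^bsub>L\<^esub> b" by blast
      hence "v = V.lincomb (\<lambda>z. if z = a then c else d) {a, b}" unfolding lc using ne by simp
      thus "v \<in> V.span {a, b}" unfolding V.span_def by (auto simp: Pi_def)
    qed
  qed
  have li: "\<not> V.lin_dep {a, b}"
    by (rule V.finite_lin_indpt2) (use ab ind lc in auto)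
  have "V.basis {a, b}" unfolding V.basis_def using gs li ab by simp
  hence "V.dim = 2" using V.dim_basis[of "{a, b}"] ne by simp
  moreover have "V.fin_dim" unfolding V.fin_dim_def using gs ab by (intro exI[of _ "{a, b}"]) simp
  ultimately show ?thesis by (simp add: has_dim_def)
qed

lemma has_dim_single:
  fixes L :: "('f::field, 'a, 'm) lie_scheme"
  assumes L: "vectorspace class_ring L" and W: "subspace class_ring W L"
    and a: "a \<in> W"
    and gen: "\<And>v. v \<in> W \<Longrightarrow> \<exists>c. v = c \<odot>\<^bsub>L\<^esub> a"
    and ind: "\<And>c. c \<odot>\<^bsub>L\<^esub> a = \<zero>\<^bsub>L\<^esub> \<Longrightarrow> c = 0"
  shows "has_dim L W 1"
proof -
  interpret V: vectorspace class_ring "L\<lparr>carrier := W\<rparr>"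
    by (rule vectorspace.subspace_is_vs[OF L W])
  have lc: "V.lincomb f {a} = f a \<odot>\<^bsub>L\<^esub> a" for f
  proof -
    have s: "c \<odot>\<^bsub>L\<^esub> v \<in> W" if "v \<in> W" for c v using V.smult_closed[of c v] that by simp
    have "V.lincomb f {a} = f a \<odot>\<^bsub>L\<^esub> a \<oplus>\<^bsub>L\<^esub> \<zero>\<^bsub>L\<^esub>"
      unfolding V.lincomb_def using a s by (simp add: V.finsum_insert Pi_def)
    thus ?thesis using V.r_zero[of "f a \<odot>\<^bsub>L\<^esub> a"] s[OF a] by simp
  qed
  have gs: "V.span {a} = carrier (L\<lparr>carrier := W\<rparr>)"
  proof
    show "V.span {a} \<subseteq> carrier (L\<lparr>carrier := W\<rparr>)" using a by (intro V.span_is_subset2) simp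
    show "carrier (L\<lparr>carrier := W\<rparr>) \<subseteq> V.span {a}"
    proof
      fix v assume "v \<in> carrier (L\<lparr>carrier := W\<rparr>)"
      hence "v \<in> W" by simp
      from gen[OF this] obtain c where "v = c \<odot>\<^bsub>L\<^esub> a" by blast
      hence "v = V.lincomb (\<lambda>z. c) {a}" unfolding lc by simp
      thus "v \<in> V.span {a}" unfolding V.span_def by (auto simp: Pi_def)
    qed
  qed
  have li: "\<not> V.lin_dep {a}"
    by (rule V.finite_lin_indpt2) (use a ind lc in auto)
  have "V.basis {a}" unfolding V.basis_def using gs li a by simp
  hence "V.dim = 1" using V.dim_basis[of "{a}"] by simp
  moreover have "V.fin_dim" unfolding V.fin_dim_def using gs a by (intro exI[of _ "{a}"]) simp
  ultimately show ?thesis by (simp add: has_dim_def)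
qed

section \<open>The quotient by the centre\<close>

text \<open>The quotient is described by a map \<open>rho\<close> from \<open>N\<close> onto the
  carrier whose fibres are the cosets of \<open>Z\<close>; the cosets as sets enter only when the
  locale is interpreted.\<close>

locale central_quotient = presented scale br x y R
  for scale :: "'f::field \<Rightarrow> 'a::ab_group_add \<Rightarrow> 'a" (infixr \<open>*s\<close> 75)
    and br :: "'a \<Rightarrow> 'a \<Rightarrow> 'a" (infixl \<open>\<diamondop>\<close> 80) and x y R +
  fixes L :: "('f, 'b, 'm) lie_scheme" (structure) and G :: "nat \<Rightarrow> 'b set" and rho :: "'a \<Rightarrow> 'b"
  assumes carrier_L: "carrier L = rho ` N" and zero_L: "\<zero>\<^bsub>L\<^esub> = rho 0"
    and add_L: "\<And>a b. a \<in> N \<Longrightarrow> b \<in> N \<Longrightarrow> rho a \<oplus>\<^bsub>L\<^esub> rho b = rho (a + b)"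
    and smult_L: "\<And>c a. a \<in> N \<Longrightarrow> c \<odot>\<^bsub>L\<^esub> rho a = rho (c *s a)"
    and bracket_L: "\<And>a b. a \<in> N \<Longrightarrow> b \<in> N \<Longrightarrow> rho a \<star>\<^bsub>L\<^esub> rho b = rho (a \<diamondop> b)"
    and rho_eq: "\<And>a b. a \<in> N \<Longrightarrow> b \<in> N \<Longrightarrow> rho a = rho b \<longleftrightarrow> a - b \<in> Z"
    and G: "\<And>i. G i = rho ` comp i"
begin

lemma rho_0: "a \<in> N \<Longrightarrow> rho a = \<zero>\<^bsub>L\<^esub> \<longleftrightarrow> a \<in> Z"
  using rho_eq[of a 0] by (simp add: zero_L)

lemma rhoI: "a \<in> N \<Longrightarrow> b \<in> N \<Longrightarrow> a - b \<in> Z \<Longrightarrow> rho a = rho b"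
  by (simp add: rho_eq)

lemma rho_carrier [simp]: "a \<in> N \<Longrightarrow> rho a \<in> carrier L"
  by (simp add: carrier_L)

lemma carrierE:
  assumes "v \<in> carrier L" obtains a where "a \<in> N" "v = rho a"
  using assms by (auto simp: carrier_L)

lemmas L_ops = add_L smult_L bracket_L

lemma lie_L: "lie_algebra L"
proof -
  have ag: "abelian_group L"
  proof (rule abelian_groupI)
    fix a assume "a \<in> carrier L"
    then obtain a' where a: "a' \<in> N" "a = rho a'" by (rule carrierE)
    show "\<exists>b\<in>carrier L. b \<oplus>\<^bsub>L\<^esub> a = \<zero>\<^bsub>L\<^esub>"
      by (rule bexI[of _ "rho (- a')"]) (use a in \<open>simp_all add: L_ops zero_L\<close>)
    show "\<zero>\<^bsub>L\<^esub> \<oplus>\<^bsub>L\<^esub> a = a" using a by (simp add: zero_L L_ops)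
  qed (auto elim!: carrierE simp: L_ops zero_L add_ac)
  have "module class_ring L"
    by (rule moduleI[OF class_cring.cring_axioms ag])
      (auto elim!: carrierE simp: L_ops scale_left_distrib scale_right_distrib)
  hence "vectorspace class_ring L" using class_field by (simp add: vectorspace_def)
  moreover have "lie_algebra_axioms L"
    by unfold_locales (auto elim!: carrierE simp: L_ops zero_L br_linear br_self br_jacobi)
  ultimately show ?thesis by (simp add: lie_algebra_def)
qed

sublocale lie: lie_algebra L by (rule lie_L)

lemma rho_sum:
  assumes "finite S" "\<And>i. i \<in> S \<Longrightarrow> d i \<in> N"
  shows "(\<Sum>i\<in>S. d i) \<in> N \<and> (\<Oplus>\<^bsub>L\<^esub>i\<in>S. rho (d i)) = rho (\<Sum>i\<in>S. d i)"
  using assms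
proof (induction S rule: finite_induct)
  case (insert i S)
  hence "(\<Oplus>\<^bsub>L\<^esub>i\<in>insert i S. rho (d i)) = rho (d i) \<oplus>\<^bsub>L\<^esub> (\<Oplus>\<^bsub>L\<^esub>i\<in>S. rho (d i))"
    by (intro lie.finsum_insert) (auto simp: Pi_def)
  thus ?case using insert by (simp add: L_ops)
qed (simp add: zero_L)

lemma rho_minus: "a \<in> N \<Longrightarrow> \<ominus>\<^bsub>L\<^esub> rho a = rho (- a)"
  by (rule lie.minus_equality) (simp_all add: L_ops zero_L)

lemma rho_rpow: "a \<in> N \<Longrightarrow> b \<in> N \<Longrightarrow> rpow (bracket L) (rho a) (rho b) n = rho (pw a b n)"
proof (induction n)
  case (Suc n)
  have "rpow (bracket L) (rho a) (rho b) (Suc n) = rpow (bracket L) (rho a) (rho b) n \<star>\<^bsub>L\<^esub> rho b"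
    by (simp add: rpow_def)
  thus ?case using Suc by (simp add: pw_Suc L_ops)
qed (simp add: rpow_def)

lemma subspace_G: "VectorSpace.subspace class_ring (G i) L"
proof -
  have "submodule class_ring (G i) L"
  proof (rule submodule.intro)
    show "module class_ring L" ..
    show "G i \<subseteq> carrier L" using comp_N by (auto simp: G)
    show "\<zero>\<^bsub>L\<^esub> \<in> G i" unfolding G zero_L by simp
    show "a \<oplus>\<^bsub>L\<^esub> b \<in> G i" if "a \<in> G i" "b \<in> G i" for a b
      using that by (auto simp: G L_ops comp_N comp_add)
    show "c \<odot>\<^bsub>L\<^esub> a \<in> G i" if "a \<in> G i" for c a
      using that by (auto simp: G L_ops comp_N comp_scale)
  qed
  moreover have "vectorspace class_ring L" ..
  ultimately show ?thesis by (simp add: VectorSpace.subspace_def)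
qed

lemma components:
  assumes "\<forall>i\<in>{1..n}. c i \<in> G i"
  obtains d where "\<forall>i\<in>{1..n}. d i \<in> comp i" "\<forall>i\<in>{1..n}. c i = rho (d i)"
    "(\<Oplus>\<^bsub>L\<^esub>i\<in>{1..n}. c i) = rho (\<Sum>i\<in>{1..n}. d i)" "(\<Sum>i\<in>{1..n}. d i) \<in> N"
proof -
  have "\<forall>i\<in>{1..n}. \<exists>a. a \<in> comp i \<and> c i = rho a" using assms by (auto simp: G)
  then obtain d where d: "\<forall>i\<in>{1..n}. d i \<in> comp i \<and> c i = rho (d i)" by (meson bchoice)
  have dN: "d i \<in> N" if "i \<in> {1..n}" for i using d comp_N that by blast
  have "(\<Oplus>\<^bsub>L\<^esub>i\<in>{1..n}. c i) = (\<Oplus>\<^bsub>L\<^esub>i\<in>{1..n}. rho (d i))"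
    using d dN by (intro lie.finsum_cong') (auto simp: Pi_def)
  with rho_sum[of "{1..n}" d] dN d show ?thesis by (intro that[of d]) auto
qed

lemma graded_L: "graded_lie_algebra L G"
proof (intro graded_lie_algebra.intro lie_L graded_lie_algebra_axioms.intro)
  show "VectorSpace.subspace class_ring (G i) L" for i by (rule subspace_G)
  show "a \<star>\<^bsub>L\<^esub> b \<in> G (i + j)" if "a \<in> G i" "b \<in> G j" for i j a b
    using that by (auto simp: G L_ops comp_N comp_br)
  show "\<exists>n c. (\<forall>i\<in>{1..n}. c i \<in> G i) \<and> v = (\<Oplus>\<^bsub>L\<^esub>i\<in>{1..n}. c i)" if v: "v \<in> carrier L" for v
  proof -
    obtain t where t: "v = rho (ev t)" using v by (auto simp: carrier_L N_def)
    obtain n d where d: "ev t = (\<Sum>i\<in>{1..n}. d i)" "\<forall>i. d i \<in> comp i"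
      using ev_graded_sums[of t] by (auto simp: graded_sums_def)
    have "d i \<in> N" for i using d(2) comp_N by blast
    hence "v = (\<Oplus>\<^bsub>L\<^esub>i\<in>{1..n}. rho (d i))"
      using rho_sum[of "{1..n}" d] d(1) t by simp
    moreover have "\<forall>i\<in>{1..n}. rho (d i) \<in> G i" using d by (auto simp: G)
    ultimately show ?thesis by (intro exI[of _ n] exI[of _ "\<lambda>i. rho (d i)"] conjI)
  qed
  show "\<forall>i\<in>{1..n}. c i = \<zero>\<^bsub>L\<^esub>"
    if c: "\<forall>i\<in>{1..n}. c i \<in> G i" and z: "(\<Oplus>\<^bsub>L\<^esub>i\<in>{1..n}. c i) = \<zero>\<^bsub>L\<^esub>" for n c
  proof -
    obtain d where d: "\<forall>i\<in>{1..n}. d i \<in> comp i" "\<forall>i\<in>{1..n}. c i = rho (d i)"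
      "(\<Oplus>\<^bsub>L\<^esub>i\<in>{1..n}. c i) = rho (\<Sum>i\<in>{1..n}. d i)" "(\<Sum>i\<in>{1..n}. d i) \<in> N"
      using c by (rule components)
    have "(\<Sum>i\<in>{1..n}. d i) \<in> Z" using rho_0[OF d(4)] z d(3) by simp
    from graded_Z[OF d(1) this] show ?thesis using d(1,2) rho_0 comp_N by auto
  qed
qed

lemma G_nz: "a \<in> comp m \<Longrightarrow> a \<notin> Z \<Longrightarrow> G m \<noteq> {\<zero>\<^bsub>L\<^esub>}"
  using rho_0[of a] comp_N[of a m] by (auto simp: G)

lemma dim_1:
  assumes a: "a \<in> comp m" and gen: "\<And>b. b \<in> comp m \<Longrightarrow> \<exists>c. b - c *s a \<in> Z"
    and ind: "\<And>c. c *s a \<in> Z \<Longrightarrow> c = 0"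
  shows "has_dim L (G m) 1"
proof (rule has_dim_single[OF _ subspace_G])
  show "vectorspace class_ring L" ..
  have aN: "a \<in> N" using a comp_N by blast
  show "rho a \<in> G m" using a by (simp add: G)
  show "\<exists>c. v = c \<odot>\<^bsub>L\<^esub> rho a" if v: "v \<in> G m" for v
  proof -
    obtain b where b: "b \<in> comp m" "v = rho b" using v by (auto simp: G)
    obtain c where "b - c *s a \<in> Z" using gen[OF b(1)] by blast
    hence "v = c \<odot>\<^bsub>L\<^esub> rho a" using b comp_N[OF b(1)] aN by (simp add: L_ops rho_eq)
    thus ?thesis by blast
  qed
  show "c = 0" if "c \<odot>\<^bsub>L\<^esub> rho a = \<zero>\<^bsub>L\<^esub>" for c
    using that aN ind[of c] by (simp add: L_ops rho_0)
qed

lemma dim_2: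
  assumes a: "a \<in> comp m" "b \<in> comp m" and gen: "\<And>z. z \<in> comp m \<Longrightarrow> \<exists>c d. z = c *s a + d *s b"
    and ind: "\<And>c d. c *s a + d *s b \<in> Z \<Longrightarrow> c = 0 \<and> d = 0"
  shows "has_dim L (G m) 2"
proof (rule has_dim_pair[OF _ subspace_G])
  show "vectorspace class_ring L" ..
  have aN: "a \<in> N" "b \<in> N" using a comp_N by blast+
  show "rho a \<in> G m" "rho b \<in> G m" using a by (simp_all add: G)
  show "\<exists>c d. v = c \<odot>\<^bsub>L\<^esub> rho a \<oplus>\<^bsub>L\<^esub> d \<odot>\<^bsub>L\<^esub> rho b" if v: "v \<in> G m" for v
  proof -
    obtain z where z: "z \<in> comp m" "v = rho z" using v by (auto simp: G)
    obtain c d where "z = c *s a + d *s b" using gen[OF z(1)] by blast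
    hence "v = c \<odot>\<^bsub>L\<^esub> rho a \<oplus>\<^bsub>L\<^esub> d \<odot>\<^bsub>L\<^esub> rho b" using z aN by (simp add: L_ops)
    thus ?thesis by blast
  qed
  show "c = 0 \<and> d = 0" if "c \<odot>\<^bsub>L\<^esub> rho a \<oplus>\<^bsub>L\<^esub> d \<odot>\<^bsub>L\<^esub> rho b = \<zero>\<^bsub>L\<^esub>" for c d
  proof -
    have "rho (c *s a + d *s b) = \<zero>\<^bsub>L\<^esub>" using that aN by (simp add: L_ops)
    hence "c *s a + d *s b \<in> Z" using rho_0[of "c *s a + d *s b"] aN by simp
    thus ?thesis by (rule ind)
  qed
qed

end

section \<open>Nottingham algebras\<close>

locale nott_quotient = nott scale br x y p q s e del lam vv ph + central_quotient scale br x y R L G rho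
  for scale :: "'f::field \<Rightarrow> 'a::ab_group_add \<Rightarrow> 'a" (infixr \<open>*s\<close> 75)
    and br :: "'a \<Rightarrow> 'a \<Rightarrow> 'a" (infixl \<open>\<diamondop>\<close> 80) and x y :: 'a and p q s e :: nat and del lam :: 'f
    and vv ph R and L :: "('f, 'b, 'm) lie_scheme" (structure) and G rho
begin

lemma dim_G1: "has_dim L (G 1) 2"
  by (rule dim_2[OF comp_x comp_y comp_1 gens_indep])

lemma dim_chain: "j \<le> q - 3 \<Longrightarrow> has_dim L (G (t * (q - 1) + 2 + j)) 1"
  by (rule dim_1[OF comp_pw[OF comp_u] span_u' pw_u_indep])

lemma dim_diamond:
  assumes "t \<ge> 1" "al t \<noteq> 0" "be t \<noteq> 0" shows "has_dim L (G (t * (q - 1) + 1)) 2"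
proof (rule dim_2[OF comp_w_Suc[OF assms(1)] span_d'[OF assms(1)]])
  show "c = 0 \<and> d = 0" if "c *s (w t \<diamondop> x) + d *s (w t \<diamondop> y) \<in> Z" for c d
    using diamond_indep[OF assms(1) that] assms by simp
qed

lemma second_diamond_L: "second_diamond L G q"
proof -
  have "has_dim L (G (1 * (q - 1) + 1)) 2" using fin_1 two_nz by (intro dim_diamond) auto
  \<comment> \<open>All degrees strictly between \<open>1\<close> and \<open>q\<close> belong to the
    chain of \<open>u 0\<close>.\<close>
  moreover have "\<not> has_dim L (G j) 2" if j: "1 < j" "j < q" for j
  proof -
    have "0 * (q - 1) + 2 + (j - 2) = j" using j by simp
    moreover have "has_dim L (G (0 * (q - 1) + 2 + (j - 2))) 1" using j by (intro dim_chain) simp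
    ultimately have "has_dim L (G j) 1" by (simp only:)
    thus ?thesis using j by (auto simp: has_dim_def)
  qed
  ultimately show ?thesis using q5 by (simp add: second_diamond_def)
qed

lemma nottingham_L: "nottingham_algebra L G q"
proof -
  have "thin_lie_algebra L G"
  proof (intro thin_lie_algebra.intro graded_L thin_lie_algebra_axioms.intro dim_G1)
    show "\<exists>m>1. has_dim L (G m) 2" using second_diamond_L by (auto simp: second_diamond_def)
    fix i z assume i: "1 \<le> i" and z: "z \<in> G i" "z \<noteq> \<zero>\<^bsub>L\<^esub>"
    obtain a where a: "a \<in> comp i" "z = rho a" using z by (auto simp: G)
    have aN: "a \<in> N" using a comp_N by blast
    have aZ: "a \<notin> Z" using z(2) a rho_0[OF aN] by simp
    show "{z \<star>\<^bsub>L\<^esub> u |u. u \<in> G 1} = G (i + 1)"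
    proof (intro subset_antisym subsetI)
      fix v assume "v \<in> {z \<star>\<^bsub>L\<^esub> u |u. u \<in> G 1}"
      thus "v \<in> G (i + 1)" using a aN comp_N[of _ 1] comp_br[of a i _ 1]
        by (auto simp: G bracket_L)
    next
      fix v assume "v \<in> G (i + 1)"
      then obtain b where b: "b \<in> comp (Suc i)" "v = rho b" by (auto simp: G)
      obtain c d where cd: "b - a \<diamondop> (c *s x + d *s y) \<in> Z" using covering_mod_Z[OF i a(1) aZ b(1)] by blast
      have "v = rho a \<star>\<^bsub>L\<^esub> rho (c *s x + d *s y)"
        using cd b comp_N[OF b(1)] aN by (simp add: bracket_L rho_eq)
      moreover have "rho (c *s x + d *s y) \<in> G 1"
        unfolding G by (intro imageI comp_add comp_scale comp_x comp_y)
      ultimately show "v \<in> {z \<star>\<^bsub>L\<^esub> u |u. u \<in> G 1}" using a(2) by blast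
    qed
  qed
  moreover have "nottingham_algebra_axioms L G q"
    by unfold_locales (use char p3 q5 q second_diamond_L in auto)
  ultimately show ?thesis by (rule nottingham_algebra.intro)
qed

lemma standard_generators_L: "standard_generators L G q (rho x) (rho y)"
proof -
  have xy: "rho x \<in> G 1" "rho y \<in> G 1" unfolding G by (intro imageI comp_x comp_y)+
  have "lie.span {rho x, rho y} = G 1"
  proof
    show "lie.span {rho x, rho y} \<subseteq> G 1"
      using xy subspace_G[of 1] by (intro lie.span_is_subset lie.is_module) auto
    show "G 1 \<subseteq> lie.span {rho x, rho y}"
    proof
      fix v assume "v \<in> G 1"
      then obtain a where a: "a \<in> comp 1" "v = rho a" unfolding G by blast
      obtain c d where "a = c *s x + d *s y" using comp_1[OF a(1)] by blast
      hence v: "v = rho (c *s x + d *s y)" using a(2) by simp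
      have sm: "submodule class_ring (lie.span {rho x, rho y}) L"
        by (rule lie.span_is_submodule) simp
      have "{rho x, rho y} \<subseteq> lie.span {rho x, rho y}" by (rule lie.in_own_span) simp
      hence "c \<odot>\<^bsub>L\<^esub> rho x \<oplus>\<^bsub>L\<^esub> d \<odot>\<^bsub>L\<^esub> rho y \<in> lie.span {rho x, rho y}"
        using submodule.m_closed[OF sm] submodule.smult_closed[OF sm] by simp
      thus "v \<in> lie.span {rho x, rho y}" unfolding v by (simp add: L_ops)
    qed
  qed
  moreover have "y \<diamondop> x \<diamondop> y = 0" using rel_y[of 1] q5 by (simp add: pw_Suc)
  ultimately show ?thesis
    unfolding standard_generators_def Let_def using xy v_rel
    by (simp add: rho_rpow L_ops zero_L v_eq[symmetric])
qed

lemma before_diamond: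
  assumes t: "t \<ge> 1"
  shows "has_dim L (G (t * (q - 1) + 1 - 1)) 1" "G (t * (q - 1) + 1 + 1) \<noteq> {\<zero>\<^bsub>L\<^esub>}" "t * (q - 1) + 1 > 1"
    "\<And>z. z \<in> G (t * (q - 1) + 1 - 1) \<Longrightarrow> \<exists>c. z = rho (c *s w t)"
proof -
  obtain k where k: "t = Suc k" using t by (cases t) auto
  have e: "t * (q - 1) + 1 - 1 = k * (q - 1) + 2 + (q - 3)" using k q5 by simp
  show "has_dim L (G (t * (q - 1) + 1 - 1)) 1" unfolding e by (rule dim_chain) simp
  show "G (t * (q - 1) + 1 + 1) \<noteq> {\<zero>\<^bsub>L\<^esub>}"
    using comp_u[of t] pw_u_notin[of 0 t] by (intro G_nz[of "u t"]) simp_all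
  show "t * (q - 1) + 1 > 1" using t q5 by simp
  show "\<exists>c. z = rho (c *s w t)" if z: "z \<in> G (t * (q - 1) + 1 - 1)" for z
  proof -
    obtain b where b: "b \<in> comp (k * (q - 1) + 2 + (q - 3))" "z = rho b" using z unfolding e G by auto
    obtain c where "b - c *s w t \<in> Z" using span_u'[OF order_refl b(1)] unfolding k w_Suc by blast
    hence "z = rho (c *s w t)" using b comp_N[OF b(1)] by (simp add: rho_eq)
    thus ?thesis by blast
  qed
qed

lemma infinite_type_L:
  assumes t: "t \<ge> 1" and f: "\<not> fin t"
  shows "infinite_type_diamond L G (rho x) (rho y) (t * (q - 1) + 1)"
  unfolding infinite_type_diamond_def
proof (intro conjI before_diamond[OF t] ballI impI)
  show "has_dim L (G (t * (q - 1) + 1)) 2" using t al_be_inf[OF f] by (intro dim_diamond) auto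
  fix z assume "z \<in> G (t * (q - 1) + 1 - 1)"
  then obtain c where z: "z = rho (c *s w t)" using before_diamond(4)[OF t] by blast
  note r = diamond_relations[OF t]
  show "z \<star>\<^bsub>L\<^esub> rho x \<star>\<^bsub>L\<^esub> rho x = \<zero>\<^bsub>L\<^esub>"
    unfolding z using r(1) by (simp add: bracket_L rho_0 br_linear A_def)
  show "z \<star>\<^bsub>L\<^esub> rho y \<star>\<^bsub>L\<^esub> rho y = \<zero>\<^bsub>L\<^esub>"
    unfolding z using r(2) by (simp add: bracket_L rho_0 br_linear)
  have "c *s Q t - - (c *s P t) = c *s (Q t + P t)" by (simp add: scale_right_distrib)
  hence "c *s Q t - - (c *s P t) \<in> Z" using r(3)[OF f] Z_scale by metis
  hence "rho (c *s Q t) = rho (- (c *s P t))" by (intro rhoI) simp_all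
  thus "z \<star>\<^bsub>L\<^esub> rho y \<star>\<^bsub>L\<^esub> rho x = \<ominus>\<^bsub>L\<^esub> (z \<star>\<^bsub>L\<^esub> rho x \<star>\<^bsub>L\<^esub> rho y)"
    unfolding z by (simp add: bracket_L rho_minus br_linear P_def Q_def)
qed

text \<open>As \<open>al t + be t = 1\<close>, the fake diamonds are \<open>al t = 0\<close>, of
  type 0, and \<open>be t = 0\<close>, of type 1; otherwise \<open>[w x]\<close> and
  \<open>[w y]\<close> are independent.\<close>

lemma finite_type_L:
  assumes t: "t \<ge> 1" and f: "fin t"
  shows "finite_type_diamond L G (rho x) (rho y) (t * (q - 1) + 1) (al t)"
proof -
  note r = diamond_relations[OF t] and b = before_diamond[OF t]
  have xx: "z \<star>\<^bsub>L\<^esub> rho x \<star>\<^bsub>L\<^esub> rho x = \<zero>\<^bsub>L\<^esub>" and yy: "z \<star>\<^bsub>L\<^esub> rho y \<star>\<^bsub>L\<^esub> rho y = \<zero>\<^bsub>L\<^esub>"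
    if zG: "z \<in> G (t * (q - 1) + 1 - 1)" for z
  proof -
    obtain c where z: "z = rho (c *s w t)" using b(4)[OF zG] by blast
    show "z \<star>\<^bsub>L\<^esub> rho x \<star>\<^bsub>L\<^esub> rho x = \<zero>\<^bsub>L\<^esub>"
      unfolding z using r(1) by (simp add: bracket_L rho_0 br_linear A_def)
    show "z \<star>\<^bsub>L\<^esub> rho y \<star>\<^bsub>L\<^esub> rho y = \<zero>\<^bsub>L\<^esub>"
      unfolding z using r(2) by (simp add: bracket_L rho_0 br_linear)
  qed
  show ?thesis
  proof (cases "al t = 0 \<or> be t = 0")
    case False
    have "genuine_finite_type_diamond L G (rho x) (rho y) (t * (q - 1) + 1) (al t)"
      unfolding genuine_finite_type_diamond_def
    proof (intro conjI b(1-3) ballI impI xx yy)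
      show "has_dim L (G (t * (q - 1) + 1)) 2" using t False by (intro dim_diamond) auto
      fix z assume "z \<in> G (t * (q - 1) + 1 - 1)"
      then obtain c where z: "z = rho (c *s w t)" using b(4) by blast
      have "al t *s c *s Q t - (1 - al t) *s c *s P t = c *s (al t *s Q t - (1 - al t) *s P t)"
        by (simp add: scale_right_diff_distrib mult.commute)
      hence "al t *s c *s Q t - (1 - al t) *s c *s P t \<in> Z" using r(4)[OF f] Z_scale by metis
      hence "rho (al t *s c *s Q t) = rho ((1 - al t) *s c *s P t)" by (intro rhoI) simp_all
      thus "al t \<odot>\<^bsub>L\<^esub> (z \<star>\<^bsub>L\<^esub> rho y \<star>\<^bsub>L\<^esub> rho x) = (1 - al t) \<odot>\<^bsub>L\<^esub> (z \<star>\<^bsub>L\<^esub> rho x \<star>\<^bsub>L\<^esub> rho y)"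
        unfolding z by (simp add: bracket_L smult_L br_linear P_def Q_def)
    qed
    thus ?thesis by (simp add: finite_type_diamond_def)
  next
    case True
    show ?thesis
    proof (cases "al t = 0")
      case True
      have "z \<star>\<^bsub>L\<^esub> rho x = \<zero>\<^bsub>L\<^esub>" if "z \<in> G (t * (q - 1) + 1 - 1)" for z
        using b(4)[OF that] r(5)[OF True] by (auto simp: bracket_L rho_0 br_linear)
      hence "fake_diamond_type_0 L G (rho x) (rho y) (t * (q - 1) + 1)"
        unfolding fake_diamond_type_0_def using b(1-3) yy by blast
      thus ?thesis using True by (simp add: finite_type_diamond_def)
    next
      case False
      hence be: "be t = 0" using True by simp
      have "z \<star>\<^bsub>L\<^esub> rho y = \<zero>\<^bsub>L\<^esub>" if "z \<in> G (t * (q - 1) + 1 - 1)" for z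
        using b(4)[OF that] r(6)[OF be] by (auto simp: bracket_L rho_0 br_linear)
      hence "fake_diamond_type_1 L G (rho x) (rho y) (t * (q - 1) + 1)"
        unfolding fake_diamond_type_1_def using b(1-3) xx by blast
      moreover have "al t = 1" using al_be_1[OF f] be by simp
      ultimately show ?thesis by (simp add: finite_type_diamond_def)
    qed
  qed
qed

end

section \<open>The relations hold in the model\<close>

lemma nottingham_relation_cases:
  assumes "(t, u) \<in> nottingham_relations p q s lam"
  obtains (1) i where "0 < i" "i < q - 2" "t = rpow (\<cdot>) yt xt i \<cdot> yt" "u = Zero"
    | (2) "t = vterm q 1 \<cdot> xt \<cdot> xt" "u = Zero" | (3) "t = vterm q 1 \<cdot> yt \<cdot> yt" "u = Zero"
    | (4) "t = vterm q 1 \<cdot> yt \<cdot> xt" "u = Scale (-2) (vterm q 1 \<cdot> xt \<cdot> yt)"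
    | (5) i where "0 < i" "i < q - 2" "t = rpow (\<cdot>) (vterm q 1 \<cdot> yt) xt i \<cdot> yt" "u = Zero"
    | (6) k where "2 \<le> k" "k \<le> p ^ s" "t = Add (vterm q k \<cdot> yt \<cdot> xt) (vterm q k \<cdot> xt \<cdot> yt)" "u = Zero"
    | (7) "t = Scale lam (vterm q (p ^ s + 1) \<cdot> yt \<cdot> xt)" "u = Scale (1 - lam) (vterm q (p ^ s + 1) \<cdot> xt \<cdot> yt)"
  using assms unfolding nottingham_relations_def
  by blast

context gen_lie
begin

lemma ev_rpow: "ev (rpow (\<cdot>) t u n) = pw (ev t) (ev u) n"
  by (induction n) (simp_all add: rpow_def)

lemma ev_sound:
  assumes "lie_cong R t u" "\<And>t u. (t, u) \<in> R \<Longrightarrow> ev t = ev u" shows "ev t = ev u"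
  using assms(1)
proof induction
  case (rel t u)
  thus ?case by (rule assms(2))
next
  case (Br_jacobi t u w)
  show ?case using br_jacobi by simp
qed (simp_all add: br_linear br_self scale_left_distrib scale_right_distrib add_ac)

end

context model
begin

interpretation md: gen_lie mscale "mbr ps" XX YY
  by (rule gen_lie.intro[OF total_lie_model])

lemma pw_XX: "j \<le> i \<Longrightarrow> md.pw (me i c) XX j = me (i - j) c"
proof (induction j)
  case (Suc j)
  hence "i - j \<noteq> 0" "i - j - 1 = i - Suc j" by auto
  thus ?case using Suc by (simp add: md.pw_Suc mb_XX)
qed simp

lemma me_YY_0: "1 < i \<Longrightarrow> i < q \<Longrightarrow> me i c \<oslash> YY = 0"
  using mb_YY[of i c] by simp

lemma W_XX: "me 1 c \<oslash> XX = me 0 c" "me 0 c \<oslash> XX = 0" "me (q - 1) c \<oslash> XX = me (q - 2) c"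
  using q5 by (simp_all add: mb_XX numeral_2_eq_2)

lemma W_YY:
  assumes "t \<ge> 1"
  shows "me 1 (ZZ t) \<oslash> YY = mscale (be t) (me (q - 1) (ZZ (Suc t)))"
    "me 0 (ZZ t) \<oslash> YY = mscale (al t) (me (q - 2) (ZZ (Suc t)))"
  using mb_YY[of 1 "ZZ t"] mb_YY[of 0 "ZZ t"] q5 D_ZZ_gg[OF assms] D_ZZ_gg'[OF assms]
  by (simp_all add: mscale_me me_minus)

lemma vterm_products:
  assumes k: "k \<ge> 1" and W: "md.ev (vterm q k) = mscale a (me 1 (ZZ k))"
  shows "md.ev (vterm q k \<cdot> xt \<cdot> yt) = mscale (a * al k) (me (q - 2) (ZZ (Suc k)))"
    "md.ev (vterm q k \<cdot> yt \<cdot> xt) = mscale (a * be k) (me (q - 2) (ZZ (Suc k)))"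
    "md.ev (vterm q k \<cdot> xt \<cdot> xt) = 0" "md.ev (vterm q k \<cdot> yt \<cdot> yt) = 0"
  using W W_XX W_YY[OF k] me_YY_0[of "q - 1"] q5 by (simp_all add: md.br_linear)

lemma vterm_step:
  assumes k: "k \<ge> 1" and W: "md.ev (vterm q k) = mscale a (me 1 (ZZ k))"
  shows "md.ev (vterm q (Suc k)) = mscale (a * al k) (me 1 (ZZ (Suc k)))"
proof -
  obtain j where j: "k = Suc j" using k by (cases k) auto
  have "md.ev (vterm q (Suc k)) = md.pw (md.ev (vterm q k \<cdot> xt \<cdot> yt)) XX (q - 3)"
    unfolding j by (simp add: md.ev_rpow)
  also have "\<dots> = mscale (a * al k) (me (q - 2 - (q - 3)) (ZZ (Suc k)))"
    unfolding vterm_products(1)[OF k W] md.pw_scale by (subst pw_XX) simp_all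
  also have "q - 2 - (q - 3) = 1" using q5 by simp
  finally show ?thesis .
qed

lemma vterm_1: "md.ev (vterm q 1) = mscale 1 (me 1 (ZZ 1))"
proof -
  have "md.ev (vterm q 1) = md.pw YY XX (q - 2)" by (simp add: md.ev_rpow)
  also have "\<dots> = me (q - 1 - (q - 2)) gg" unfolding YY_def by (rule pw_XX) simp
  finally have "md.ev (vterm q 1) = me (q - 1 - (q - 2)) gg" .
  moreover have "q - 1 - (q - 2) = 1" using q5 by simp
  moreover have "ZZ 1 = gg" using ZZ_fin[of 0] by simp
  ultimately show ?thesis by simp
qed

lemma al_be_first: "al 1 = - 1" "be 1 = 2"
  using al_fin[of 0] be_fin[of 0] by simp_all

text \<open>The sign is \<open>al 1\<close>, and \<open>al k = 1\<close> until the next finite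
  type.\<close>

lemma vterm_model:
  assumes "2 \<le> k" "k \<le> Suc ps" shows "md.ev (vterm q k) = mscale (- 1) (me 1 (ZZ k))"
  using assms
proof (induction k rule: nat_induct_at_least)
  case base
  show ?case using vterm_step[OF order_refl vterm_1] al_be_first by (simp add: numeral_2_eq_2)
next
  case (Suc k)
  hence "\<not> fin k" by (cases "k = ps") (auto simp: fin_def)
  thus ?case using vterm_step[of k "- 1"] Suc al_be_inf(1)[of k] by simp
qed

text \<open>The relations ending in \<open>y\<close> after some power of \<open>x\<close> hold
  because \<open>y\<close> annihilates the exponents of \<open>\<xi>\<close> from \<open>2\<close>
  to \<open>q - 1\<close>. The others compare \<open>al\<close> and \<open>be\<close>:
  \<open>be 1 = -2 al 1\<close>, \<open>al k + be k = 0\<close> at infinite types, and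
  \<open>al = lam\<close>, \<open>be = 1 - lam\<close> at \<open>ps + 1\<close>.\<close>

lemma model_relations:
  assumes del: "del = lam + 1" and R: "(t, u) \<in> nottingham_relations p q s lam"
  shows "md.ev t = md.ev u"
proof -
  note V1 = vterm_products[OF order_refl vterm_1]
  have Y: "md.pw YY XX i \<oslash> YY = 0" if "0 < i" "i < q - 2" for i
  proof -
    have "md.pw YY XX i = me (q - 1 - i) gg" unfolding YY_def by (rule pw_XX) (use that in simp)
    thus ?thesis using me_YY_0[of "q - 1 - i" gg] that by simp
  qed
  have VY: "md.ev (vterm q 1 \<cdot> yt) = mscale 2 (me (q - 1) (ZZ 2))"
    using vterm_1 W_YY(1)[of 1] al_be_first by (simp add: numeral_2_eq_2)
  have VYi: "md.pw (md.ev (vterm q 1 \<cdot> yt)) XX i \<oslash> YY = 0" if "0 < i" "i < q - 2" for i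
    unfolding VY md.pw_scale using pw_XX[of i "q - 1" "ZZ 2"] me_YY_0[of "q - 1 - i" "ZZ 2"] that
    by (simp add: md.br_linear)
  have ev: "md.ev (Add (vterm q k \<cdot> yt \<cdot> xt) (vterm q k \<cdot> xt \<cdot> yt)) = 0" if k: "2 \<le> k" "k \<le> ps" for k
  proof -
    have "\<not> fin k" using k by (cases "k = ps") (auto simp: fin_def)
    hence "al k = 1" "be k = - 1" by (rule al_be_inf)+
    moreover have "md.ev (vterm q k) = mscale (- 1) (me 1 (ZZ k))" by (rule vterm_model) (use k in simp_all)
    moreover have "1 \<le> k" using k by simp
    ultimately show ?thesis using vterm_products(1,2)[of k "- 1"]
      by (simp only: md.ev.simps) (simp add: md.scale_left_distrib[symmetric])
  qed
  have lm: "md.ev (Scale lam (vterm q (ps + 1) \<cdot> yt \<cdot> xt)) = md.ev (Scale (1 - lam) (vterm q (ps + 1) \<cdot> xt \<cdot> yt))"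
  proof -
    have ab: "al (ps + 1) = lam" "be (ps + 1) = 1 - lam"
      using al_fin[of 1] be_fin[of 1] del by simp_all
    have W: "md.ev (vterm q (ps + 1)) = mscale (- 1) (me 1 (ZZ (ps + 1)))"
      by (rule vterm_model) (use ps_gt in simp_all)
    have "1 \<le> ps + 1" by simp
    note v = vterm_products(1,2)[OF this W, unfolded ab]
    have "lam * (- 1 * (1 - lam)) = (1 - lam) * (- 1 * lam)" by (simp add: algebra_simps)
    thus ?thesis by (simp only: md.ev.simps(4) v md.scale_scale)
  qed
  from R show ?thesis
  proof (cases rule: nottingham_relation_cases)
    case (1 i)
    have "md.ev t = md.pw YY XX i \<oslash> YY" unfolding 1 by (simp add: md.ev_rpow)
    thus ?thesis using Y[OF 1(1,2)] 1(4) by simp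
  next
    case 4
    have "md.ev u = mscale (- 2) (md.ev (vterm q 1 \<cdot> xt \<cdot> yt))" unfolding 4 by simp
    thus ?thesis unfolding 4(1) V1(1,2) al_be_first by simp
  next
    case (5 i)
    have "md.ev t = md.pw (md.ev (vterm q 1 \<cdot> yt)) XX i \<oslash> YY"
      unfolding 5(3) md.ev.simps(5)[of "rpow _ _ _ _"] md.ev_rpow by simp
    thus ?thesis using VYi[OF 5(1,2)] 5(4) by simp
  next
    case (6 k)
    show ?thesis unfolding 6(3,4) ev[OF 6(1,2)[folded ps_def]] by simp
  next
    case 7
    show ?thesis unfolding 7 ps_def[symmetric] by (rule lm)
  qed (simp_all only: V1 md.ev.simps(2))
qed

end

section \<open>The relations are homogeneous\<close>

lemma homogeneous_rpow:
  "homogeneous m t \<Longrightarrow> homogeneous 1 u \<Longrightarrow> homogeneous (m + n) (rpow (\<cdot>) t u n)"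
proof (induction n)
  case (Suc n)
  hence "homogeneous (m + n + 1) (rpow (\<cdot>) t u n \<cdot> u)" by (intro homogeneous.intros)
  thus ?case by (simp add: rpow_def)
qed (simp add: rpow_def)

lemma homogeneous_gen: "homogeneous 1 (Gen g)"
  by (rule homogeneous.intros)

lemma homogeneous_Br_Gen: "homogeneous m t \<Longrightarrow> homogeneous (Suc m) (t \<cdot> Gen g)"
  using homogeneous.intros(5)[OF _ homogeneous_gen, of m t g] by simp

lemma homogeneous_vterm: "\<exists>m. homogeneous m (vterm q k :: ('f, gen) lie_term)"
proof (induction q k rule: vterm.induct)
  case (1 q)
  show ?case unfolding vterm.simps by (rule exI, rule homogeneous.intros(2))
next
  case (2 q)
  show ?case unfolding vterm.simps by (rule exI, rule homogeneous_rpow[OF homogeneous_gen homogeneous_gen])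
next
  case (3 q k)
  then obtain m where "homogeneous m (vterm q (Suc k) :: ('f, gen) lie_term)" by blast
  from homogeneous_rpow[OF homogeneous_Br_Gen[OF homogeneous_Br_Gen[OF this]] homogeneous_gen]
  show ?case unfolding vterm.simps by blast
qed

lemma homogeneous_relations:
  fixes t u :: "('f::field, gen) lie_term"
  assumes "(t, u) \<in> nottingham_relations p q s lam"
  shows "\<exists>m. homogeneous m t \<and> homogeneous m u"
proof -
  note Z = homogeneous.intros(2)
  have V: "\<exists>m. \<forall>g h. homogeneous m (vterm q k \<cdot> Gen g \<cdot> Gen h :: ('f, gen) lie_term)" for k
  proof -
    obtain m where m: "homogeneous m (vterm q k :: ('f, gen) lie_term)" using homogeneous_vterm by blast
    have "homogeneous (Suc (Suc m)) (vterm q k \<cdot> Gen g \<cdot> Gen h :: ('f, gen) lie_term)" for g h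
      by (intro homogeneous_Br_Gen m)
    thus ?thesis by blast
  qed
  have Y: "\<exists>m. homogeneous m (rpow (\<cdot>) yt xt i \<cdot> yt :: ('f, gen) lie_term)" for i
    by (rule exI, rule homogeneous_Br_Gen[OF homogeneous_rpow[OF homogeneous_gen homogeneous_gen]])
  have VY: "\<exists>m. homogeneous m (rpow (\<cdot>) (vterm q 1 \<cdot> yt) xt i \<cdot> yt :: ('f, gen) lie_term)" for i
  proof -
    obtain m where "homogeneous m (vterm q 1 :: ('f, gen) lie_term)" using homogeneous_vterm by blast
    from homogeneous_Br_Gen[OF homogeneous_rpow[OF homogeneous_Br_Gen[OF this] homogeneous_gen]]
    show ?thesis by blast
  qed
  obtain m1 where m1: "\<forall>g h. homogeneous m1 (vterm q 1 \<cdot> Gen g \<cdot> Gen h :: ('f, gen) lie_term)" using V[of 1] by blast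
  from assms show ?thesis
  proof (cases rule: nottingham_relation_cases)
    case (1 i)
    obtain m where "homogeneous m t" using Y[of i] unfolding 1 by blast
    thus ?thesis using Z unfolding 1(4) by blast
  next
    case 2
    show ?thesis unfolding 2 by (rule exI[of _ m1], intro conjI Z m1[rule_format])
  next
    case 3
    show ?thesis unfolding 3 by (rule exI[of _ m1], intro conjI Z m1[rule_format])
  next
    case 4
    show ?thesis unfolding 4 by (rule exI[of _ m1], intro conjI homogeneous.intros(4) m1[rule_format])
  next
    case (5 i)
    obtain m where "homogeneous m t" using VY[of i] unfolding 5 by blast
    thus ?thesis using Z unfolding 5(4) by blast
  next
    case (6 k)
    obtain m where m: "\<forall>g h. homogeneous m (vterm q k \<cdot> Gen g \<cdot> Gen h :: ('f, gen) lie_term)" using V[of k] by blast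
    show ?thesis unfolding 6 by (rule exI[of _ m], intro conjI Z homogeneous.intros(3) m[rule_format])
  next
    case 7
    obtain m where m: "\<forall>g h. homogeneous m (vterm q (p ^ s + 1) \<cdot> Gen g \<cdot> Gen h :: ('f, gen) lie_term)"
      using V[of "p ^ s + 1"] by blast
    show ?thesis unfolding 7 by (rule exI[of _ m], intro conjI homogeneous.intros(4) m[rule_format])
  qed
qed

section \<open>The Lie algebras of all presentations at once\<close>

text \<open>A type cannot depend on the relations \<open>R\<close>; so this one contains the presented Lie algebras
  of all \<open>R\<close>, as its elements supported at \<open>R\<close>.\<close>

quotient_type (overloaded) ('f, 'g) pres =
  "(('f::field, 'g) lie_term \<times> ('f, 'g) lie_term) set \<Rightarrow> ('f, 'g) lie_term" /
  "\<lambda>f g. \<forall>R. lie_cong R (f R) (g R)"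
  by (rule equivpI) (blast intro: reflpI sympI transpI lie_cong.refl lie_cong.sym lie_cong.trans)+

instantiation pres :: (field, type) ab_group_add
begin

lift_definition zero_pres :: "('a, 'b) pres" is "\<lambda>R. Zero" .
lift_definition plus_pres :: "('a, 'b) pres \<Rightarrow> ('a, 'b) pres \<Rightarrow> ('a, 'b) pres" is
  "\<lambda>f g R. Add (f R) (g R)" by (blast intro: lie_cong.Add_cong)
lift_definition uminus_pres :: "('a, 'b) pres \<Rightarrow> ('a, 'b) pres" is
  "\<lambda>f R. Scale (- 1) (f R)" by (blast intro: lie_cong.Scale_cong)
lift_definition minus_pres :: "('a, 'b) pres \<Rightarrow> ('a, 'b) pres \<Rightarrow> ('a, 'b) pres" is
  "\<lambda>f g R. Add (f R) (Scale (- 1) (g R))" by (blast intro: lie_cong.Add_cong lie_cong.Scale_cong)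

instance
proof
  fix a b c :: "('a, 'b) pres"
  show "a + b + c = a + (b + c)" by transfer (blast intro: lie_cong.Add_assoc)
  show "a + b = b + a" by transfer (blast intro: lie_cong.Add_comm)
  show "0 + a = a" by transfer (blast intro: lie_cong.Add_comm lie_cong.Add_Zero lie_cong.trans)
  show "- a + a = 0" by transfer (blast intro: lie_cong.Add_comm lie_cong.Add_inverse lie_cong.trans)
  show "a - b = a + - b" by transfer (blast intro: lie_cong.refl)
qed

end

lift_definition pres_scale :: "'f::field \<Rightarrow> ('f, 'g) pres \<Rightarrow> ('f, 'g) pres" is
  "\<lambda>c f R. Scale c (f R)" by (blast intro: lie_cong.Scale_cong)
lift_definition pres_br :: "('f::field, 'g) pres \<Rightarrow> ('f, 'g) pres \<Rightarrow> ('f, 'g) pres" is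
  "\<lambda>f g R. f R \<cdot> g R" by (blast intro: lie_cong.Br_cong)

lemma total_lie_pres: "total_lie pres_scale pres_br"
proof unfold_locales
  fix a b c :: "('f::field, 'g) pres" and k l :: 'f
  show "pres_scale k (a + b) = pres_scale k a + pres_scale k b"
    by transfer (blast intro: lie_cong.Scale_Add)
  show "pres_scale (k + l) a = pres_scale k a + pres_scale l a"
    by transfer (blast intro: lie_cong.Scale_add)
  show "pres_scale k (pres_scale l a) = pres_scale (k * l) a"
    by transfer (blast intro: lie_cong.Scale_Scale)
  show "pres_scale 1 a = a" by transfer (blast intro: lie_cong.Scale_one)
  show "pres_br (a + b) c = pres_br a c + pres_br b c"
    by transfer (blast intro: lie_cong.Br_Add_left)
  show "pres_br a (b + c) = pres_br a b + pres_br a c"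
    by transfer (blast intro: lie_cong.Br_Add_right)
  show "pres_br (pres_scale k a) b = pres_scale k (pres_br a b)"
    by transfer (blast intro: lie_cong.Br_Scale_left)
  show "pres_br a (pres_scale k b) = pres_scale k (pres_br a b)"
    by transfer (blast intro: lie_cong.Br_Scale_right)
  show "pres_br a a = 0" by transfer (blast intro: lie_cong.Br_self)
  show "pres_br (pres_br a b) c + pres_br (pres_br b c) a + pres_br (pres_br c a) b = 0"
    by transfer (blast intro: lie_cong.Br_jacobi)
qed

lift_definition single :: "(('f::field, 'g) lie_term \<times> ('f, 'g) lie_term) set \<Rightarrow> ('f, 'g) lie_term \<Rightarrow> ('f, 'g) pres"
  is "\<lambda>R t R'. if R' = R then t else Zero" .

lemma single_eq: "single R t = single R u \<longleftrightarrow> lie_cong R t u"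
  by transfer (auto intro: lie_cong.refl)

lemma Scale_Zero: "lie_cong R (Scale c Zero) Zero"
proof -
  interpret total_lie pres_scale pres_br by (rule total_lie_pres)
  have "pres_scale c (0 :: ('a, 'b) pres) = 0" by simp
  thus ?thesis by transfer blast
qed

text \<open>At components other than \<open>R\<close> both sides are built from \<open>Zero\<close>,
  which accounts for the rules about \<open>Zero\<close>.\<close>

lemma single_simps:
  "single R Zero = 0" "single R (Add t u) = single R t + single R u"
  "single R (Scale c t) = pres_scale c (single R t)" "single R (t \<cdot> u) = pres_br (single R t) (single R u)"
  by (transfer; auto intro: lie_cong.refl lie_cong.sym lie_cong.Add_Zero Scale_Zero lie_cong.Br_self)+

lemma gen_lie_pres: "gen_lie pres_scale pres_br"
  by (rule gen_lie.intro[OF total_lie_pres])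

lemma ev_single: "gen_lie.ev pres_scale pres_br (single R xt) (single R yt) t = single R t"
proof -
  interpret gen_lie pres_scale pres_br "single R xt" "single R yt" by (rule gen_lie_pres)
  show ?thesis by (induction t) (simp_all add: single_simps split: gen.split)
qed

section \<open>Cosets of the centre\<close>

context presented
begin

text \<open>The set \<open>a + Z\<close>, read as a set of classes of terms: the form that cosets of
  the centre take in the quotient.\<close>

definition coset :: "'a \<Rightarrow> ('f, gen) lie_term set set" where
  "coset a = lie_class R ` {u. ev u - a \<in> Z}"

lemma mem_lie_class: "u \<in> lie_class R t \<longleftrightarrow> ev t = ev u"
  by (simp add: lie_class_def ev_eq)

lemma lie_class_eq: "lie_class R t = lie_class R u \<longleftrightarrow> ev t = ev u"
  using mem_lie_class by (auto simp: set_eq_iff)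

abbreviation "NN \<equiv> presented_lie_algebra R"

lemma NN_ops: "lie_class R t \<oplus>\<^bsub>NN\<^esub> lie_class R u = lie_class R (Add t u)"
  "c \<odot>\<^bsub>NN\<^esub> lie_class R t = lie_class R (Scale c t)"
  "lie_class R t \<star>\<^bsub>NN\<^esub> lie_class R u = lie_class R (t \<cdot> u)"
  by (auto simp: presented_lie_algebra_def mem_lie_class) (metis mem_lie_class)+

lemma NN_carrier: "carrier NN = range (lie_class R)" "\<zero>\<^bsub>NN\<^esub> = lie_class R Zero"
  by (simp_all add: presented_lie_algebra_def)

lemma center_NN: "center NN = coset 0"
proof -
  have Z_iff: "(\<forall>u. ev t \<diamondop> ev u = 0) \<longleftrightarrow> ev t \<in> Z" for t
  proof
    assume "\<forall>u. ev t \<diamondop> ev u = 0"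
    from this[rule_format, of xt] this[rule_format, of yt] have "ev t \<diamondop> x = 0" "ev t \<diamondop> y = 0" by simp_all
    thus "ev t \<in> Z" unfolding Z_def by blast
  next
    assume "ev t \<in> Z"
    thus "\<forall>u. ev t \<diamondop> ev u = 0" using Z_br by (auto simp: N_def)
  qed
  show ?thesis
  proof (intro subset_antisym subsetI)
    fix A assume A: "A \<in> center NN"
    then obtain t where t: "A = lie_class R t" by (auto simp: center_def NN_carrier)
    have "lie_class R t \<star>\<^bsub>NN\<^esub> lie_class R u = lie_class R Zero" for u
      using A unfolding t center_def NN_carrier by blast
    hence "\<forall>u. ev t \<diamondop> ev u = 0" unfolding NN_ops lie_class_eq by simp
    thus "A \<in> coset 0" unfolding Z_iff t coset_def by simp
  next
    fix A assume "A \<in> coset 0"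
    then obtain t where t: "A = lie_class R t" "ev t \<in> Z" by (auto simp: coset_def)
    from t(2) have "ev t \<diamondop> ev u = 0" for u unfolding Z_iff[symmetric] by blast
    thus "A \<in> center NN" unfolding t(1) center_def by (simp add: NN_carrier NN_ops lie_class_eq)
  qed
qed

lemma coset_cong: "a - b \<in> Z \<Longrightarrow> coset a = coset b"
proof -
  assume z: "a - b \<in> Z"
  have "ev u - a \<in> Z \<longleftrightarrow> ev u - b \<in> Z" for u
    using Z_add[OF _ z, of "ev u - a"] Z_diff[OF _ z, of "ev u - b"] by auto
  thus ?thesis by (simp add: coset_def)
qed

lemma coset_eq:
  assumes "a \<in> N" shows "coset a = coset b \<longleftrightarrow> a - b \<in> Z"
proof
  assume e: "coset a = coset b"
  obtain t where t: "a = ev t" using assms by (auto simp: N_def)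
  have "lie_class R t \<in> coset a" unfolding coset_def t by simp
  hence "lie_class R t \<in> coset b" using e by simp
  then obtain u where "lie_class R t = lie_class R u" "ev u - b \<in> Z" by (auto simp: coset_def)
  thus "a - b \<in> Z" using t by (simp add: lie_class_eq)
qed (rule coset_cong)

lemma r_coset_NN: "center NN +>\<^bsub>NN\<^esub> lie_class R t = coset (ev t)"
proof (intro subset_antisym subsetI)
  fix A assume "A \<in> center NN +>\<^bsub>NN\<^esub> lie_class R t"
  then obtain z where z: "ev z \<in> Z" "A = lie_class R (Add z t)"
    by (auto simp: a_r_coset_def' center_NN coset_def NN_ops)
  thus "A \<in> coset (ev t)" unfolding coset_def by (intro image_eqI[of _ _ "Add z t"]) auto
next
  fix A assume "A \<in> coset (ev t)"
  then obtain u where u: "ev u - ev t \<in> Z" "A = lie_class R u" by (auto simp: coset_def)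
  let ?z = "Add u (Scale (- 1) t)"
  have "ev ?z = ev u - ev t" by simp
  hence z: "lie_class R ?z \<in> center NN" unfolding center_NN coset_def using u(1) by (intro imageI CollectI) (simp only: diff_0_right)
  have "A = lie_class R ?z \<oplus>\<^bsub>NN\<^esub> lie_class R t" unfolding NN_ops u(2) lie_class_eq by simp
  thus "A \<in> center NN +>\<^bsub>NN\<^esub> lie_class R t" using z unfolding a_r_coset_def' by blast
qed

text \<open>The scalar multiplication and the bracket of the quotient are unions over
  representatives; each is shown to be a union of equal cosets, central differences being absorbed
  or killed.\<close>

lemma central_quotient_NN:
  "central_quotient scale br x y R (lie_quotient NN (center NN))
     (\<lambda>i. (\<lambda>u. center NN +>\<^bsub>NN\<^esub> u) ` presented_component R i) coset"
proof unfold_locales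
  let ?L = "lie_quotient NN (center NN)"
  show "carrier ?L = coset ` N"
    by (auto simp: lie_quotient_def A_RCOSETS_def' NN_carrier r_coset_NN N_def)
  show "\<zero>\<^bsub>?L\<^esub> = coset 0" by (simp add: lie_quotient_def center_NN)
  show "coset a = coset b \<longleftrightarrow> a - b \<in> Z" if "a \<in> N" for a b using that by (rule coset_eq)
  show "(\<lambda>u. center NN +>\<^bsub>NN\<^esub> u) ` presented_component R i = coset ` comp i" for i
    by (auto simp: presented_component_def comp_def r_coset_NN image_image)
  fix a b c
  assume "a \<in> N"
  then obtain s where s: "a = ev s" by (auto simp: N_def)
  have sm: "lie_class R s \<in> coset a" unfolding coset_def s by simp
  show "c \<odot>\<^bsub>?L\<^esub> coset a = coset (c *s a)"
  proof -
    have "center NN +>\<^bsub>NN\<^esub> (c \<odot>\<^bsub>NN\<^esub> A) = coset (c *s a)" if A: "A \<in> coset a" for A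
    proof -
      obtain u where u: "A = lie_class R u" "ev u - a \<in> Z" using A by (auto simp: coset_def)
      have "c *s ev u - c *s a \<in> Z" using Z_scale[OF u(2), of c] by (simp add: scale_right_diff_distrib)
      thus ?thesis unfolding u(1) NN_ops r_coset_NN by (simp add: coset_cong)
    qed
    thus ?thesis using sm by (auto simp: lie_quotient_def)
  qed
  assume "b \<in> N"
  then obtain t where t: "b = ev t" by (auto simp: N_def)
  have tm: "lie_class R t \<in> coset b" unfolding coset_def t by simp
  show "coset a \<oplus>\<^bsub>?L\<^esub> coset b = coset (a + b)"
  proof (intro subset_antisym subsetI)
    fix A assume "A \<in> coset a \<oplus>\<^bsub>?L\<^esub> coset b"
    then obtain u w where u: "ev u - a \<in> Z" "ev w - b \<in> Z" "A = lie_class R (Add u w)"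
      by (auto simp: lie_quotient_def set_add_def' coset_def NN_ops)
    have "ev (Add u w) - (a + b) = (ev u - a) + (ev w - b)" by simp
    hence "ev (Add u w) - (a + b) \<in> Z" using u(1,2) Z_add by metis
    thus "A \<in> coset (a + b)" unfolding coset_def u(3) by blast
  next
    fix A assume "A \<in> coset (a + b)"
    then obtain w where w: "ev w - (a + b) \<in> Z" "A = lie_class R w" by (auto simp: coset_def)
    let ?z = "Add w (Scale (- 1) t)"
    have "ev ?z - a = ev w - (a + b)" by (simp add: t)
    hence "lie_class R ?z \<in> coset a" unfolding coset_def using w(1) by (intro imageI CollectI) (simp only:)
    moreover have "A = lie_class R ?z \<oplus>\<^bsub>NN\<^esub> lie_class R t" unfolding NN_ops w(2) lie_class_eq by simp
    ultimately show "A \<in> coset a \<oplus>\<^bsub>?L\<^esub> coset b" using tm by (auto simp: lie_quotient_def set_add_def')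
  qed
  show "coset a \<star>\<^bsub>?L\<^esub> coset b = coset (a \<diamondop> b)"
  proof -
    have "center NN +>\<^bsub>NN\<^esub> (A \<star>\<^bsub>NN\<^esub> B) = coset (a \<diamondop> b)" if A: "A \<in> coset a" and B: "B \<in> coset b" for A B
    proof -
      obtain u where u: "A = lie_class R u" "ev u - a \<in> Z" using A by (auto simp: coset_def)
      obtain w where w: "B = lie_class R w" "ev w - b \<in> Z" using B by (auto simp: coset_def)
      have "ev u \<diamondop> ev w = a \<diamondop> b"
        using Z_cong[OF u(2), of "ev w"] Z_cong'[OF w(2), of a] s by (auto simp: N_def)
      thus ?thesis unfolding u(1) w(1) NN_ops r_coset_NN by simp
    qed
    thus ?thesis using sm tm by (auto simp: lie_quotient_def)
  qed
qed

end

theorem theorem25: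
  fixes p q s :: nat and lam :: "'f::field"
    and R :: "(('f, gen) lie_term \<times> ('f, gen) lie_term) set"
  assumes "prime p" "p > 3" "CHAR('f) = p"
    and "q > 5" "\<exists>n. q = p ^ n"
    and "lam \<noteq> 0" "s > 0"
    and R: "R = nottingham_relations p q s lam"
    and N: "N = presented_lie_algebra R"
    and Z: "Z = center N"
    and L: "L = lie_quotient N Z"
    and G: "G = (\<lambda>i. (\<lambda>u. Z +>\<^bsub>N\<^esub> u) ` presented_component R i)"
    and x: "x = Z +>\<^bsub>N\<^esub> lie_class R (Gen Gen_x)"
    and y: "y = Z +>\<^bsub>N\<^esub> lie_class R (Gen Gen_y)"
  shows "nottingham_algebra L G q \<and> standard_generators L G q x y \<and>
    (\<forall>t\<ge>1. \<not> [t = 1] (mod p ^ s) \<longrightarrow>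
       infinite_type_diamond L G x y (t * (q - 1) + 1)) \<and>
    (\<forall>t\<ge>1. \<forall>r. t = r * p ^ s + 1 \<longrightarrow>
       finite_type_diamond L G x y (t * (q - 1) + 1) (of_nat r * lam + of_nat r - 1))"
proof -
  obtain e where e: "q = p ^ e" using assms(5) by blast
  interpret model p q s e "lam + 1" by unfold_locales (use assms e in auto)
  interpret md: gen_lie mscale "mbr ps" XX YY by (rule gen_lie.intro[OF total_lie_model])
  interpret gl: gen_lie pres_scale pres_br "single R xt" "single R yt" by (rule gen_lie_pres)
  have ev: "gl.ev t = single R t" for t by (rule ev_single)
  have pw: "gl.pw (single R t) (single R u) n = single R (rpow (\<cdot>) t u n)" for t u n
    using gl.ev_rpow[of t u n] by (simp only: ev)
  have rl: "single R t = single R u" if "(t, u) \<in> R" for t u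
    unfolding single_eq using that by (rule lie_cong.rel)
  have two: "(2::'f) \<noteq> 0"
  proof -
    have "\<not> p dvd 2" using assms(2) by (auto dest: dvd_imp_le)
    hence "of_nat 2 \<noteq> (0::'f)" using assms(3) by (simp only: of_nat_eq_0_iff_char_dvd not_False_eq_True)
    thus ?thesis by simp
  qed
  have pr: "presented pres_scale pres_br (single R xt) (single R yt) R"
  proof unfold_locales
    show "gl.ev t = gl.ev u \<longleftrightarrow> lie_cong R t u" for t u unfolding ev by (rule single_eq)
    show "\<exists>m. homogeneous m t \<and> homogeneous m u" if "(t, u) \<in> R" for t u
      using that unfolding R by (rule homogeneous_relations)
  qed (rule two)
  \<comment> \<open>A representative is evaluated at the component \<open>R\<close>; this is
    independent of its choice because the relations hold in the model.\<close>
  define ph where "ph = (\<lambda>a. md.ev (rep_pres a R))"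
  have sound: "md.ev t = md.ev u" if "lie_cong R t u" for t u
    by (rule md.ev_sound[OF that], rule model_relations[OF HOL.refl]) (simp only: R)
  have rep: "lie_cong R (rep_pres (abs_pres f) R) (f R)" for f
    using Quotient3_rep_abs[OF Quotient3_pres, of f] lie_cong.refl by auto
  have ph_abs: "ph (abs_pres f) = md.ev (f R)" for f
    unfolding ph_def by (rule sound[OF rep])
  have abs_rep: "abs_pres (rep_pres a) = a" for a :: "('f, gen) pres"
    by (rule Quotient3_abs_rep[OF Quotient3_pres])
  have no: "nott pres_scale pres_br (single R xt) (single R yt) p q s e (lam + 1) lam (\<lambda>k. single R (vterm q k)) ph"
  proof unfold_locales
    show "single R (vterm q 1) = gl.pw (single R yt) (single R xt) (q - 2)" by (simp add: pw)
    show "single R (vterm q (Suc (Suc k))) =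
      gl.pw (pres_br (pres_br (single R (vterm q (Suc k))) (single R xt)) (single R yt)) (single R xt) (q - 3)" for k
      by (simp add: pw single_simps(4)[where R = R, symmetric])
    show "pres_br (gl.pw (single R yt) (single R xt) i) (single R yt) = 0" if "0 < i" "i < q - 2" for i
      unfolding pw single_simps(4,1)[where R = R, symmetric] by (rule rl) (use that in \<open>auto simp: R nottingham_relations_def\<close>)
    show "pres_br (pres_br (single R (vterm q 1)) (single R xt)) (single R xt) = 0"
      "pres_br (pres_br (single R (vterm q 1)) (single R yt)) (single R yt) = 0"
      unfolding single_simps(4,1)[where R = R, symmetric] by (rule rl; simp add: R nottingham_relations_def)+
    show "pres_br (pres_br (single R (vterm q 1)) (single R yt)) (single R xt) =
      pres_scale (- 2) (pres_br (pres_br (single R (vterm q 1)) (single R xt)) (single R yt))"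
      unfolding single_simps(3,4)[where R = R, symmetric] by (rule rl) (simp add: R nottingham_relations_def)
    show "pres_br (gl.pw (pres_br (single R (vterm q 1)) (single R yt)) (single R xt) i) (single R yt) = 0"
      if "0 < i" "i < q - 2" for i
      unfolding single_simps(4)[where R = R, symmetric] pw unfolding single_simps(4,1)[where R = R, symmetric]
      by (rule rl) (use that in \<open>auto simp: R nottingham_relations_def\<close>)
    show "pres_br (pres_br (single R (vterm q k)) (single R yt)) (single R xt) +
      pres_br (pres_br (single R (vterm q k)) (single R xt)) (single R yt) = 0" if "2 \<le> k" "k \<le> p ^ s" "even k" for k
      unfolding single_simps(1,2,4)[where R = R, symmetric] by (rule rl) (use that in \<open>auto simp: R nottingham_relations_def\<close>)
    show "pres_scale lam (pres_br (pres_br (single R (vterm q (p ^ s + 1))) (single R yt)) (single R xt)) =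
      pres_scale (1 - lam) (pres_br (pres_br (single R (vterm q (p ^ s + 1))) (single R xt)) (single R yt))"
      unfolding single_simps(3,4)[where R = R, symmetric] by (rule rl) (simp add: R nottingham_relations_def)
    show "ph (single R xt) = XX" "ph (single R yt) = YY"
      unfolding single.abs_eq ph_abs by simp_all
    show "ph (a + b) = ph a + ph b" for a b
      using ph_abs[of "\<lambda>R. Add (rep_pres a R) (rep_pres b R)"] plus_pres.abs_eq[of "rep_pres a" "rep_pres b"]
      by (simp add: abs_rep lie_cong.refl ph_def)
    show "ph (pres_scale c a) = mscale c (ph a)" for c a
      using ph_abs[of "\<lambda>R. Scale c (rep_pres a R)"] pres_scale.abs_eq[of c "rep_pres a"]
      by (simp add: abs_rep lie_cong.refl ph_def)
    show "ph (pres_br a b) = mbr ps (ph a) (ph b)" for a b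
      using ph_abs[of "\<lambda>R. rep_pres a R \<cdot> rep_pres b R"] pres_br.abs_eq[of "rep_pres a" "rep_pres b"]
      by (simp add: abs_rep lie_cong.refl ph_def)
  qed (use assms in auto)
  interpret pr: presented pres_scale pres_br "single R xt" "single R yt" R by (rule pr)
  interpret nq: nott_quotient pres_scale pres_br "single R xt" "single R yt" p q s e "lam + 1" lam
    "\<lambda>k. single R (vterm q k)" ph R L G pr.coset
    unfolding L G N Z by (intro nott_quotient.intro no pr.central_quotient_NN)
  have xy: "x = pr.coset (single R xt)" "y = pr.coset (single R yt)"
    unfolding x y N Z pr.r_coset_NN ev by simp_all
  have "infinite_type_diamond L G x y (t * (q - 1) + 1)" if "t \<ge> 1" "\<not> [t = 1] (mod p ^ s)" for t
    unfolding xy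
  proof (rule nq.infinite_type_L[OF that(1)])
    have "1 mod ps = 1" using ps_gt(2) by (intro mod_less) simp
    thus "\<not> fin t" using that(2) by (simp only: fin_def cong_def ps_def not_False_eq_True)
  qed
  moreover have "finite_type_diamond L G x y (t * (q - 1) + 1) (of_nat r * lam + of_nat r - 1)"
    if "t \<ge> 1" "t = r * p ^ s + 1" for t r
  proof -
    have t: "t = r * ps + 1" using that(2) by (simp add: ps_def)
    have "finite_type_diamond L G x y (t * (q - 1) + 1) (al t)"
      unfolding xy by (rule nq.finite_type_L[OF that(1)]) (simp only: t fin_iff)
    \<comment> \<open>With \<open>del = lam + 1\<close>, the type \<open>r * del - 1\<close> is the
      one claimed.\<close>
    moreover have "al t = of_nat r * lam + of_nat r - 1"
      unfolding t al_fin by (simp add: algebra_simps)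
    ultimately show ?thesis by simp
  qed
  ultimately show ?thesis
    using nq.nottingham_L nq.standard_generators_L unfolding xy by blast
qed

end
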